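(* Let $F:M\times\Gamma\rightarrow M$ be a non-resonant nearly-periodic map on a smooth manifold $M$ with parameter space $\Gamma$, and let $R_\gamma$ be its roto-rate. Then $F$ admits a normalizing transformation; that is, there exists a formal power series $G_\gamma = G_1[\gamma]+G_2[\gamma,\gamma]+\dots$ with no constant term, whose coefficients are homogeneous polynomial maps from $\Gamma$ into vector fields on $M$, such that $R_\gamma = \exp(\mathcal{L}_{G_\gamma})R_0$ in the sense of formal power series in $\gamma$, where $R_0$ is the limiting roto-rate of $F$.
   Context: Smooth means $C^\infty$. $M$ is a smooth manifold and $\Gamma$ is a finite-dimensional real vector space. A nearly-periodic map on $M$ with parameter space $\Gamma$ is a smooth map $F:M\times\Gamma\rightarrow M$ such that, writing $F_\gamma(m)=F(m,\gamma)$: (i) $F_\gamma:M\rightarrow M$ is a diffeomorphism for each $\gamma\in\Gamma$; (ii) there exist a (smooth) $U(1)$-action $\Phi_\theta:M\rightarrow M$ and a constant $\theta_0\in U(1)=\mathbb{R}/2\pi\mathbb{Z}$ such that $F_0=\Phi_{\theta_0}$. $F$ is called resonant if $\theta_0$ is a rational multiple of $2\pi$, and non-resonant otherwise. The infinitesimal generator $R_0$ of $\Phi_\theta$ is called the limiting roto-rate. A roto-rate for $F$ is a formal power series $R_\gamma = R_0+R_1[\gamma]+R_2[\gamma,\gamma]+\dots$, whose coefficients are homogeneous polynomial maps from $\Gamma$ into vector fields on $M$, such that $R_0$ is the limiting roto-rate, $F_\gamma^*R_\gamma=R_\gamma$, and $\exp(2\pi\mathcal{L}_{R_\gamma})=1$,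 the last two in the sense of formal power series in $\gamma$. Each non-resonant nearly-periodic map has a unique roto-rate. $\mathcal{L}$ denotes the Lie derivative. The pullback operator $F_\gamma^*$ acting on tensor fields is understood through its formal Taylor series in $\gamma$ at $\gamma=0$. For a formal power series of vector fields $R_\gamma$ with leading term $R_0$, $\exp(\theta\mathcal{L}_{R_\gamma})$ denotes the formal pullback flow of $R_\gamma$: the formal power series in $\gamma$ of operators on tensor fields, with leading term $\Phi_\theta^*$, solving $\frac{d}{d\theta}\exp(\theta\mathcal{L}_{R_\gamma})=\exp(\theta\mathcal{L}_{R_\gamma})\mathcal{L}_{R_\gamma}$ with value $1$ at $\theta=0$. For $G_\gamma$ with no constant term, $\exp(\mathcal{L}_{G_\gamma})=\sum_{k\ge0}\frac{1}{k!}\mathcal{L}_{G_\gamma}^k$ (the Lie transform with generator $G_\gamma$) is a formal power series in $\gamma$ whose coefficients are homogeneous polynomial maps from $\Gamma$ into differential operators on the tensor algebra over $M$. *)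

theory Defs
  imports "HOL-Analysis.Analysis"
begin

section \<open>Finite-dimensional spaces, including dimension zero\<close>

text \<open>
  Like \<^class>\<open>euclidean_space\<close>, but the trivial space is admitted, so that 0-dimensional
  manifolds and parameter spaces are not excluded. The inner product is auxiliary: nothing
  below depends on its choice. Completeness and the Heine--Borel property hold in every
  finite-dimensional inner product space; they are listed only so that library
  theorems stated for these classes apply.
\<close>

class finite_dim_space = real_inner + banach + heine_borel +
  assumes finite_spanning_set: "\<exists>B. finite B \<and> (\<forall>x. \<exists>c. x = (\<Sum>b\<in>B. c b *\<^sub>R b))"

instance euclidean_space \<subseteq> finite_dim_space
proof
  show "\<exists>B::'a set. finite B \<and> (\<forall>x. \<exists>c. x = (\<Sum>b\<in>B. c b *\<^sub>R b))"
    by (metis finite_Basis euclidean_representation)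
qed

section \<open>Smooth manifolds\<close>

text \<open>On an open subset of a finite-dimensional space, having continuous iterated directional
  derivatives of order up to k is the same as being of class C^k.\<close>

primrec differentiable_of_order_on ::
  "nat \<Rightarrow> 'a::real_normed_vector set \<Rightarrow> ('a \<Rightarrow> 'b::real_normed_vector) \<Rightarrow> bool" where
  "differentiable_of_order_on 0 S f \<longleftrightarrow> continuous_on S f"
| "differentiable_of_order_on (Suc k) S f \<longleftrightarrow>
     (\<forall>x\<in>S. f differentiable (at x)) \<and>
     (\<forall>v. differentiable_of_order_on k S (\<lambda>x. frechet_derivative f (at x) v))"

definition smooth_on :: "'a::real_normed_vector set \<Rightarrow> ('a \<Rightarrow> 'b::real_normed_vector) \<Rightarrow> bool" where
  "smooth_on S f \<longleftrightarrow> (\<forall>k. differentiable_of_order_on k S f)"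

text \<open>A chart is a pair of a domain and a coordinate map; the values of the coordinate map
  off its domain are irrelevant.\<close>

type_synonym ('m, 'e) chart = "'m set \<times> ('m \<Rightarrow> 'e)"

definition is_chart :: "('m::topological_space, 'e::real_normed_vector) chart \<Rightarrow> bool" where
  "is_chart c \<longleftrightarrow> (case c of (U, \<phi>) \<Rightarrow>
     open U \<and> open (\<phi> ` U) \<and> homeomorphism U (\<phi> ` U) \<phi> (inv_into U \<phi>))"

text \<open>The manifold is the whole type of points. Together with the Hausdorff and second
  countability sorts on this type, an atlas determines a smooth manifold of
  dimension \<open>dim (UNIV :: 'e set)\<close>; it need not be maximal.\<close>

definition smooth_manifold ::
  "('m::{t2_space,second_countable_topology}, 'e::finite_dim_space) chart set \<Rightarrow> bool" where
  "smooth_manifold A \<longleftrightarrow>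
     (\<forall>c\<in>A. is_chart c) \<and> (\<Union>c\<in>A. fst c) = UNIV \<and>
     (\<forall>(U, \<phi>)\<in>A. \<forall>(V, \<psi>)\<in>A. smooth_on (\<phi> ` (U \<inter> V)) (\<psi> \<circ> inv_into U \<phi>))"

definition std_atlas :: "('v::real_normed_vector, 'v) chart set" where
  "std_atlas = {(UNIV, id)}"

definition prod_atlas :: "('m, 'e) chart set \<Rightarrow> ('n, 'f) chart set \<Rightarrow> ('m \<times> 'n, 'e \<times> 'f) chart set" where
  "prod_atlas A B = {(U \<times> V, map_prod \<phi> \<psi>) | U \<phi> V \<psi>. (U, \<phi>) \<in> A \<and> (V, \<psi>) \<in> B}"

definition smooth_map ::
  "('m::topological_space, 'e::real_normed_vector) chart set \<Rightarrow>
   ('n::topological_space, 'f::real_normed_vector) chart set \<Rightarrow> ('m \<Rightarrow> 'n) \<Rightarrow> bool" where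
  "smooth_map A B f \<longleftrightarrow> continuous_on UNIV f \<and>
     (\<forall>(U, \<phi>)\<in>A. \<forall>(V, \<psi>)\<in>B. smooth_on (\<phi> ` (U \<inter> f -` V)) (\<psi> \<circ> f \<circ> inv_into U \<phi>))"

definition smooth_functions ::
  "('m::topological_space, 'e::real_normed_vector) chart set \<Rightarrow> ('m \<Rightarrow> real) set" where
  "smooth_functions A = {f. smooth_map A std_atlas f}"

definition diffeomorphism ::
  "('m::topological_space, 'e::real_normed_vector) chart set \<Rightarrow> ('m \<Rightarrow> 'm) \<Rightarrow> bool" where
  "diffeomorphism A f \<longleftrightarrow> bij f \<and> smooth_map A A f \<and> smooth_map A A (inv f)"

section \<open>Tensor fields\<close>

text \<open>Vector fields are derivations of the algebra of smooth functions, one-forms are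
  function-linear functionals on vector fields, and tensor fields of type (r, s) are
  function-multilinear functionals of r one-forms and s vector fields. Each is extended
  by zero to arguments outside its proper domain, so that equality of such objects is
  equality in HOL.\<close>

type_synonym 'm vfield = "('m \<Rightarrow> real) \<Rightarrow> 'm \<Rightarrow> real"
type_synonym 'm form = "'m vfield \<Rightarrow> 'm \<Rightarrow> real"
type_synonym 'm tensor = "'m form list \<Rightarrow> 'm vfield list \<Rightarrow> 'm \<Rightarrow> real"

definition vector_fields ::
  "('m::topological_space, 'e::real_normed_vector) chart set \<Rightarrow> 'm vfield set" where
  "vector_fields A = {X.
     (\<forall>f\<in>smooth_functions A. X f \<in> smooth_functions A) \<and>
     (\<forall>f. f \<notin> smooth_functions A \<longrightarrow> X f = (\<lambda>_. 0)) \<and>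
     (\<forall>f\<in>smooth_functions A. \<forall>g\<in>smooth_functions A. \<forall>a b m.
        X (\<lambda>x. a * f x + b * g x) m = a * X f m + b * X g m) \<and>
     (\<forall>f\<in>smooth_functions A. \<forall>g\<in>smooth_functions A. \<forall>m.
        X (\<lambda>x. f x * g x) m = f m * X g m + g m * X f m)}"

definition one_forms ::
  "('m::topological_space, 'e::real_normed_vector) chart set \<Rightarrow> 'm form set" where
  "one_forms A = {\<alpha>.
     (\<forall>X\<in>vector_fields A. \<alpha> X \<in> smooth_functions A) \<and>
     (\<forall>X. X \<notin> vector_fields A \<longrightarrow> \<alpha> X = (\<lambda>_. 0)) \<and>
     (\<forall>X\<in>vector_fields A. \<forall>Y\<in>vector_fields A.
      \<forall>f\<in>smooth_functions A. \<forall>g\<in>smooth_functions A. \<forall>m.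
        \<alpha> (\<lambda>h x. f x * X h x + g x * Y h x) m = f m * \<alpha> X m + g m * \<alpha> Y m)}"

definition tensor_fields ::
  "('m::topological_space, 'e::real_normed_vector) chart set \<Rightarrow> nat \<Rightarrow> nat \<Rightarrow> 'm tensor set" where
  "tensor_fields A r s = {T.
     (let args = {\<alpha>s. length \<alpha>s = r \<and> set \<alpha>s \<subseteq> one_forms A} \<times>
                 {Xs. length Xs = s \<and> set Xs \<subseteq> vector_fields A} in
      (\<forall>(\<alpha>s, Xs)\<in>args. T \<alpha>s Xs \<in> smooth_functions A) \<and>
      (\<forall>\<alpha>s Xs. (\<alpha>s, Xs) \<notin> args \<longrightarrow> T \<alpha>s Xs = (\<lambda>_. 0)) \<and>
      (\<forall>(\<alpha>s, Xs)\<in>args. \<forall>i<r. \<forall>\<beta>\<in>one_forms A. \<forall>\<gamma>\<in>one_forms A.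
       \<forall>f\<in>smooth_functions A. \<forall>g\<in>smooth_functions A. \<forall>m.
         T (\<alpha>s[i := (\<lambda>X x. f x * \<beta> X x + g x * \<gamma> X x)]) Xs m =
         f m * T (\<alpha>s[i := \<beta>]) Xs m + g m * T (\<alpha>s[i := \<gamma>]) Xs m) \<and>
      (\<forall>(\<alpha>s, Xs)\<in>args. \<forall>j<s. \<forall>Y\<in>vector_fields A. \<forall>Z\<in>vector_fields A.
       \<forall>f\<in>smooth_functions A. \<forall>g\<in>smooth_functions A. \<forall>m.
         T \<alpha>s (Xs[j := (\<lambda>h x. f x * Y h x + g x * Z h x)]) m =
         f m * T \<alpha>s (Xs[j := Y]) m + g m * T \<alpha>s (Xs[j := Z]) m))}"

subsection \<open>Lie derivatives\<close>

definition lie_bracket :: "'m vfield \<Rightarrow> 'm vfield \<Rightarrow> 'm vfield" where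
  "lie_bracket X Y = (\<lambda>f m. X (Y f) m - Y (X f) m)"

definition lie_form ::
  "('m::topological_space, 'e::real_normed_vector) chart set \<Rightarrow> 'm vfield \<Rightarrow> 'm form \<Rightarrow> 'm form" where
  "lie_form A X \<alpha> = (\<lambda>Y m.
     if Y \<in> vector_fields A then X (\<alpha> Y) m - \<alpha> (lie_bracket X Y) m else 0)"

definition lie_tensor ::
  "('m::topological_space, 'e::real_normed_vector) chart set \<Rightarrow> 'm vfield \<Rightarrow> 'm tensor \<Rightarrow> 'm tensor" where
  "lie_tensor A X T = (\<lambda>\<alpha>s Ys m.
     if set \<alpha>s \<subseteq> one_forms A \<and> set Ys \<subseteq> vector_fields A
     then X (T \<alpha>s Ys) m
          - (\<Sum>i<length \<alpha>s. T (\<alpha>s[i := lie_form A X (\<alpha>s ! i)]) Ys m)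
          - (\<Sum>j<length Ys. T \<alpha>s (Ys[j := lie_bracket X (Ys ! j)]) m)
     else 0)"

subsection \<open>Pullbacks along a diffeomorphism\<close>

definition pull_vfield :: "('m \<Rightarrow> 'm) \<Rightarrow> 'm vfield \<Rightarrow> 'm vfield" where
  "pull_vfield \<psi> X = (\<lambda>f. X (f \<circ> inv \<psi>) \<circ> \<psi>)"

definition pull_form :: "('m \<Rightarrow> 'm) \<Rightarrow> 'm form \<Rightarrow> 'm form" where
  "pull_form \<psi> \<alpha> = (\<lambda>Y. \<alpha> (pull_vfield (inv \<psi>) Y) \<circ> \<psi>)"

definition pull_tensor :: "('m \<Rightarrow> 'm) \<Rightarrow> 'm tensor \<Rightarrow> 'm tensor" where
  "pull_tensor \<psi> T = (\<lambda>\<alpha>s Ys.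
     T (map (pull_form (inv \<psi>)) \<alpha>s) (map (pull_vfield (inv \<psi>)) Ys) \<circ> \<psi>)"

section \<open>Nearly-periodic maps\<close>

text \<open>Actions of U(1) = \<open>\<real>/2\<pi>\<int>\<close> are \<open>2\<pi>\<close>-periodic actions of the reals, and elements of U(1)
  are given by real representatives.\<close>

definition circle_action ::
  "('m::topological_space, 'e::real_normed_vector) chart set \<Rightarrow> (real \<Rightarrow> 'm \<Rightarrow> 'm) \<Rightarrow> bool" where
  "circle_action A \<Phi> \<longleftrightarrow>
     smooth_map (prod_atlas std_atlas A) A (\<lambda>(\<theta>, m). \<Phi> \<theta> m) \<and>
     \<Phi> 0 = id \<and> (\<forall>s t. \<Phi> (s + t) = \<Phi> s \<circ> \<Phi> t) \<and> \<Phi> (2 * pi) = id"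

definition infinitesimal_generator ::
  "('m::topological_space, 'e::real_normed_vector) chart set \<Rightarrow> (real \<Rightarrow> 'm \<Rightarrow> 'm) \<Rightarrow> 'm vfield" where
  "infinitesimal_generator A \<Phi> = (\<lambda>f m.
     if f \<in> smooth_functions A then deriv (\<lambda>\<theta>. f (\<Phi> \<theta> m)) 0 else 0)"

text \<open>The circle action and the angle are not determined by \<open>F\<close> (for instance the action can be
  reversed together with the angle); as the limiting roto-rate refers to them, they are
  part of the data.\<close>

definition nearly_periodic_map ::
  "('m::{t2_space,second_countable_topology}, 'e::finite_dim_space) chart set \<Rightarrow>
   ('m \<times> 'g::finite_dim_space \<Rightarrow> 'm) \<Rightarrow> (real \<Rightarrow> 'm \<Rightarrow> 'm) \<Rightarrow> real \<Rightarrow> bool" where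
  "nearly_periodic_map A F \<Phi> \<theta>\<^sub>0 \<longleftrightarrow>
     smooth_map (prod_atlas A std_atlas) A F \<and>
     (\<forall>\<gamma>. diffeomorphism A (\<lambda>m. F (m, \<gamma>))) \<and>
     circle_action A \<Phi> \<and>
     (\<lambda>m. F (m, 0)) = \<Phi> \<theta>\<^sub>0"

definition resonant :: "real \<Rightarrow> bool" where
  "resonant \<theta>\<^sub>0 \<longleftrightarrow> (\<exists>q\<in>\<rat>. \<theta>\<^sub>0 = q * (2 * pi))"

section \<open>Formal power series on the parameter space\<close>

text \<open>\<open>P\<close> is a homogeneous polynomial map of degree n into \<open>W\<close>: the restriction to the diagonal of
  an n-linear map, given on argument lists of length n. Linear structure on \<open>W\<close> is
  pointwise, through the real-valued evaluations \<open>ev\<close>.\<close>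

definition homogeneous_polynomial ::
  "nat \<Rightarrow> 'w set \<Rightarrow> ('w \<Rightarrow> 'i \<Rightarrow> real) \<Rightarrow> ('g::real_vector \<Rightarrow> 'w) \<Rightarrow> bool" where
  "homogeneous_polynomial n W ev P \<longleftrightarrow> (\<exists>B.
     (\<forall>vs. length vs = n \<longrightarrow> B vs \<in> W) \<and>
     (\<forall>vs i x. length vs = n \<longrightarrow> i < n \<longrightarrow> linear (\<lambda>v. ev (B (vs[i := v])) x)) \<and>
     (\<forall>\<gamma>. P \<gamma> = B (replicate n \<gamma>)))"

text \<open>A formal power series is given by its coefficients: \<open>R n \<gamma>\<close> is the degree n term evaluated
  at the parameter \<open>\<gamma>\<close>.\<close>

type_synonym ('m, 'g) vfield_series = "nat \<Rightarrow> 'g \<Rightarrow> 'm vfield"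

definition vector_field_series ::
  "('m::topological_space, 'e::real_normed_vector) chart set \<Rightarrow>
   ('m, 'g::real_vector) vfield_series \<Rightarrow> bool" where
  "vector_field_series A R \<longleftrightarrow>
     (\<forall>n. homogeneous_polynomial n (vector_fields A) (\<lambda>X (f, m). X f m) (R n))"

definition const_series :: "'m vfield \<Rightarrow> ('m, 'g) vfield_series" where
  "const_series X = (\<lambda>n \<gamma>. if n = 0 then X else (\<lambda>f m. 0))"

definition lie_series ::
  "('m, 'g) vfield_series \<Rightarrow> ('m, 'g) vfield_series \<Rightarrow> ('m, 'g) vfield_series" where
  "lie_series G S = (\<lambda>n \<gamma> f m. \<Sum>j\<le>n. lie_bracket (G j \<gamma>) (S (n - j) \<gamma>) f m)"

text \<open>The action of \<open>exp(\<L>\<^sub>G) = \<Sum>k. \<L>\<^sub>G^k / k!\<close> on series of vector fields. It is meant for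
  \<open>G\<close> without constant term, in which case \<open>\<L>\<^sub>G^k\<close> raises degrees by at least k and the terms
  with \<open>k > n\<close> do not contribute to the degree n coefficient.\<close>

definition lie_transform ::
  "('m, 'g) vfield_series \<Rightarrow> ('m, 'g) vfield_series \<Rightarrow> ('m, 'g) vfield_series" where
  "lie_transform G S = (\<lambda>n \<gamma> f m. \<Sum>k\<le>n. ((lie_series G ^^ k) S) n \<gamma> f m / fact k)"

text \<open>Degree n coefficient of the formal Taylor series at \<open>\<gamma> = 0\<close> of the pullback of \<open>X\<close> along
  \<open>m \<mapsto> F (m, \<gamma>)\<close>.\<close>

definition pull_taylor ::
  "('m \<times> 'g::real_vector \<Rightarrow> 'm) \<Rightarrow> nat \<Rightarrow> 'g \<Rightarrow> 'm vfield \<Rightarrow> 'm vfield" where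
  "pull_taylor F n \<gamma> X = (\<lambda>f m.
     (deriv ^^ n) (\<lambda>t. pull_vfield (\<lambda>x. F (x, t *\<^sub>R \<gamma>)) X f m) 0 / fact n)"

definition pull_series ::
  "('m \<times> 'g::real_vector \<Rightarrow> 'm) \<Rightarrow> ('m, 'g) vfield_series \<Rightarrow> ('m, 'g) vfield_series" where
  "pull_series F R = (\<lambda>n \<gamma> f m. \<Sum>k\<le>n. pull_taylor F k \<gamma> (R (n - k) \<gamma>) f m)"

section \<open>The formal pullback flow and roto-rates\<close>

definition tensor_operators ::
  "('m::topological_space, 'e::real_normed_vector) chart set \<Rightarrow> ('m tensor \<Rightarrow> 'm tensor) set" where
  "tensor_operators A = {D.
     (\<forall>r s. \<forall>T\<in>tensor_fields A r s. D T \<in> tensor_fields A r s) \<and>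
     (\<forall>T. (\<forall>r s. T \<notin> tensor_fields A r s) \<longrightarrow> D T = (\<lambda>\<alpha>s Xs m. 0)) \<and>
     (\<forall>r s. \<forall>S\<in>tensor_fields A r s. \<forall>T\<in>tensor_fields A r s. \<forall>a b \<alpha>s Xs m.
        D (\<lambda>\<alpha>s Xs m. a * S \<alpha>s Xs m + b * T \<alpha>s Xs m) \<alpha>s Xs m =
        a * D S \<alpha>s Xs m + b * D T \<alpha>s Xs m)}"

definition smooth_tensor_family ::
  "('m::topological_space, 'e::real_normed_vector) chart set \<Rightarrow> nat \<Rightarrow> nat \<Rightarrow>
   (real \<Rightarrow> 'm tensor) \<Rightarrow> bool" where
  "smooth_tensor_family A r s T \<longleftrightarrow>
     (\<forall>\<tau>. T \<tau> \<in> tensor_fields A r s) \<and>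
     (\<forall>\<alpha>s Xs. smooth_map (prod_atlas std_atlas A) std_atlas (\<lambda>(\<tau>, m). T \<tau> \<alpha>s Xs m))"

text \<open>\<open>E \<theta> n \<gamma>\<close> is the degree n coefficient of \<open>exp(\<theta> \<L>\<^sub>R)\<close>, where \<open>R\<close> has leading term the
  generator of \<open>\<Phi>\<close>. The differential equation is evaluated on fixed tensor fields, arguments
  and points. The third conjunct says that \<open>E\<close> depends smoothly on \<open>\<theta>\<close> as a family of linear
  operators. It holds for families of differential operators with smooth coefficients
  composed with \<open>\<Phi>\<close>, as the flow is, and is what makes the solution unique: among
  arbitrary linear operators, without any continuity, the initial value problem can have
  several solutions.\<close>

definition formal_pullback_flow ::
  "('m::topological_space, 'e::real_normed_vector) chart set \<Rightarrow> (real \<Rightarrow> 'm \<Rightarrow> 'm) \<Rightarrow>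
   ('m, 'g::real_vector) vfield_series \<Rightarrow>
   (real \<Rightarrow> nat \<Rightarrow> 'g \<Rightarrow> 'm tensor \<Rightarrow> 'm tensor) \<Rightarrow> bool" where
  "formal_pullback_flow A \<Phi> R E \<longleftrightarrow>
     (\<forall>\<theta> n. homogeneous_polynomial n (tensor_operators A)
        (\<lambda>D (T, \<alpha>s, Xs, m). D T \<alpha>s Xs m) (E \<theta> n)) \<and>
     (\<forall>r s. \<forall>T\<in>tensor_fields A r s. \<forall>\<theta> \<gamma>. E \<theta> 0 \<gamma> T = pull_tensor (\<Phi> \<theta>) T) \<and>
     (\<forall>n \<gamma> r s T \<alpha>s Xs. smooth_tensor_family A r s T \<longrightarrow>
        smooth_map (prod_atlas std_atlas (prod_atlas std_atlas A)) std_atlas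
          (\<lambda>(\<theta>, \<tau>, m). E \<theta> n \<gamma> (T \<tau>) \<alpha>s Xs m)) \<and>
     (\<forall>r s. \<forall>T\<in>tensor_fields A r s. \<forall>n \<gamma>. E 0 n \<gamma> T = (if n = 0 then T else (\<lambda>\<alpha>s Xs m. 0))) \<and>
     (\<forall>r s. \<forall>T\<in>tensor_fields A r s. \<forall>n \<gamma> \<alpha>s Xs m \<theta>.
        ((\<lambda>\<theta>. E \<theta> n \<gamma> T \<alpha>s Xs m) has_real_derivative
          (\<Sum>k\<le>n. E \<theta> k \<gamma> (lie_tensor A (R (n - k) \<gamma>) T) \<alpha>s Xs m)) (at \<theta>))"

definition roto_rate ::
  "('m::topological_space, 'e::real_normed_vector) chart set \<Rightarrow> ('m \<times> 'g::real_vector \<Rightarrow> 'm) \<Rightarrow>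
   (real \<Rightarrow> 'm \<Rightarrow> 'm) \<Rightarrow> ('m, 'g) vfield_series \<Rightarrow> bool" where
  "roto_rate A F \<Phi> R \<longleftrightarrow>
     vector_field_series A R \<and>
     (\<forall>\<gamma>. R 0 \<gamma> = infinitesimal_generator A \<Phi>) \<and>
     pull_series F R = R \<and>
     (\<exists>E. formal_pullback_flow A \<Phi> R E \<and>
        (\<forall>r s. \<forall>T\<in>tensor_fields A r s. \<forall>n \<gamma>.
           E (2 * pi) n \<gamma> T = (if n = 0 then T else (\<lambda>\<alpha>s Xs m. 0))))"

definition normalizing_transformation ::
  "('m::topological_space, 'e::real_normed_vector) chart set \<Rightarrow> (real \<Rightarrow> 'm \<Rightarrow> 'm) \<Rightarrow>
   ('m, 'g::real_vector) vfield_series \<Rightarrow> ('m, 'g) vfield_series \<Rightarrow> bool" where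
  "normalizing_transformation A \<Phi> R G \<longleftrightarrow>
     vector_field_series A G \<and>
     (\<forall>\<gamma>. G 0 \<gamma> = (\<lambda>f m. 0)) \<and>
     R = lie_transform G (const_series (infinitesimal_generator A \<Phi>))"

end

theory Submission
  imports Defs
begin

text \<open>
  The generator is built degree by degree. Suppose
  \<open>S = exp(\<L>\<^sub>G) R\<^sub>0\<close> agrees with R in degrees below n, with \<open>D = R\<^sub>n - S\<^sub>n\<close> the first discrepancy. On
  functions, \<open>S exp(G) = exp(G) R\<^sub>0\<close>, so the derivative of
  \<open>exp(\<theta> \<L>\<^sub>R) exp(G) \<Phi>\<^sub>-\<^sub>\<theta>\<^sup>*\<close> has lowest order term \<open>\<Phi>\<^sub>\<theta>\<^sup>* D \<Phi>\<^sub>-\<^sub>\<theta>\<^sup>*\<close>. Both R and \<open>R\<^sub>0\<close> are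
  \<open>2\<pi>\<close>-periodic, hence D has zero average over the circle action, and
  \<open>X = - (2\<pi>)\<inverse> \<integral> \<theta> \<Phi>\<^sub>\<theta>\<^sup>* D \<Phi>\<^sub>-\<^sub>\<theta>\<^sup>* d\<theta>\<close> (over one period) solves \<open>[X, R\<^sub>0] = D\<close>. Adding X in degree n
  to G removes the discrepancy.

  Exchanging derivatives and integrals with operators needs these operators to preserve smooth
  one-parameter families of functions. For vector fields, which are defined as derivations, this
  follows from their coordinate expression; for the formal flow it is part of the definition.
\<close>

section \<open>Calculus of smooth functions on open sets\<close>

text \<open>A vector field is a derivation, hence determined by its values on functions, so the
  comparison of the two flows is made on functions, at one fixed parameter \<gamma> and one fixed
  point; convergence in \<gamma> never arises, as degree n of a Lie transform involves G only up to
  degree n. The average of D vanishes because, in degree n, the composite has the conjugate of D by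
  the flow as its whole derivative: every other contribution cancels by agreement below n.
  Integrating over a period leaves the difference of two endpoint values, and both equal the degree
  n part of exp(G). The weight \<theta> in X comes from integration by parts: the boundary term is 2
  pi times D and the remaining integral is the average, which is zero. Polynomial dependence on
  \<gamma> is kept apart from the analysis. X is linear in D, so the multilinear form behind D can
  be carried through each step.\<close>

lemma orthonormal_spanning_set:
  obtains B :: "'a::finite_dim_space set"
  where "finite B" "\<And>x. x = (\<Sum>b\<in>B. (x \<bullet> b) *\<^sub>R b)"
proof -
  obtain B0 :: "'a set" where B0: "finite B0" "\<forall>x. \<exists>c. x = (\<Sum>b\<in>B0. c b *\<^sub>R b)"
    using finite_spanning_set by blast
  obtain C where C: "finite C" "span C = span B0" "pairwise orthogonal C"
    using basis_orthogonal[OF B0(1)] by blast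
  have "x \<in> span B0" for x
    using B0 span_finite by blast
  then have span: "span (C - {0}) = UNIV"
    using C(2) by (auto simp: span_delete_0)
  \<comment> \<open>An orthogonal set may contain 0, which cannot be normalized; deleting it does
    not change the span. In dimension zero B is empty.\<close>
  define B where "B = (\<lambda>c. c /\<^sub>R norm c) ` (C - {0})"
  have fin: "finite B" using C(1) by (simp add: B_def)
  have "c \<in> span B" if "c \<in> C - {0}" for c
  proof -
    have "norm c *\<^sub>R (c /\<^sub>R norm c) \<in> span B"
      using that by (intro span_scale span_base) (auto simp: B_def)
    then show ?thesis using that by simp
  qed
  then have "span B = UNIV"
    using span span_minimal[of "C - {0}" "span B"] by auto
  have orth: "b \<bullet> b' = (if b = b' then 1 else 0)" if bb: "b \<in> B" "b' \<in> B" for b b'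
  proof -
    obtain c c' where c: "c \<in> C - {0}" "c' \<in> C - {0}" "b = c /\<^sub>R norm c" "b' = c' /\<^sub>R norm c'"
      using bb by (auto simp: B_def)
    show ?thesis
    proof (cases "c = c'")
      case True
      then show ?thesis using c by (simp add: dot_square_norm power2_eq_square)
    next
      case False
      then have "c \<bullet> c' = 0"
        using C(3) c by (auto simp: pairwise_def orthogonal_def)
      then have "b \<bullet> b' = 0" using c by simp
      moreover have "b \<bullet> b = 1" using c by (simp add: dot_square_norm power2_eq_square)
      ultimately show ?thesis by auto
    qed
  qed
  have "x = (\<Sum>b\<in>B. (x \<bullet> b) *\<^sub>R b)" for x
  proof -
    have "x \<in> span B" using \<open>span B = UNIV\<close> by simp
    then obtain u where u: "x = (\<Sum>v\<in>B. u v *\<^sub>R v)"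
      using span_finite[OF fin] by auto
    have "x \<bullet> b = u b" if "b \<in> B" for b
    proof -
      have "x \<bullet> b = (\<Sum>v\<in>B. u v * (v \<bullet> b))" by (subst u) (simp add: inner_sum_left)
      also have "\<dots> = (\<Sum>v\<in>B. if v = b then u v else 0)"
        by (rule sum.cong) (use orth that in auto)
      finally show ?thesis using fin that by simp
    qed
    then show ?thesis using u by simp
  qed
  then show ?thesis using fin that by blast
qed

text \<open>Coordinates of a product atlas live in a product space, and the chain rule
  \<open>order_compose\<close> sums over a finite spanning set of the intermediate space, so
  products have to stay in the class.\<close>

instance prod :: (finite_dim_space, finite_dim_space) finite_dim_space
proof
  obtain B :: "'a set" where B: "finite B" "\<And>x. x = (\<Sum>b\<in>B. (x \<bullet> b) *\<^sub>R b)"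
    by (rule orthonormal_spanning_set) blast
  obtain C :: "'b set" where C: "finite C" "\<And>x. x = (\<Sum>b\<in>C. (x \<bullet> b) *\<^sub>R b)"
    by (rule orthonormal_spanning_set) blast
  have "\<exists>c. x = (\<Sum>b\<in>(\<lambda>b. (b, 0)) ` B \<union> Pair 0 ` C. c b *\<^sub>R b)" for x :: "'a \<times> 'b"
  proof -
    have "x \<in> span ((\<lambda>b. (b, 0)) ` B \<union> Pair 0 ` C)"
    proof -
      have "((fst x, 0) :: 'a \<times> 'b) = (\<Sum>b\<in>B. (fst x \<bullet> b) *\<^sub>R (b, 0))"
        by (subst B(2)[of "fst x"]) (simp add: sum_prod)
      moreover have "((0, snd x) :: 'a \<times> 'b) = (\<Sum>b\<in>C. (snd x \<bullet> b) *\<^sub>R (0, b))"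
        by (subst C(2)[of "snd x"]) (simp add: sum_prod)
      moreover have "(\<Sum>b\<in>B. (fst x \<bullet> b) *\<^sub>R (b, 0)) \<in> span ((\<lambda>b. (b, 0)) ` B \<union> Pair 0 ` C)"
        by (intro span_sum span_scale span_base) auto
      moreover have "(\<Sum>b\<in>C. (snd x \<bullet> b) *\<^sub>R (0, b)) \<in> span ((\<lambda>b. (b, 0)) ` B \<union> Pair 0 ` C)"
        by (intro span_sum span_scale span_base) auto
      ultimately have "(fst x, 0) + (0, snd x) \<in> span ((\<lambda>b. (b, 0)) ` B \<union> Pair 0 ` C)"
        by (intro span_add) (simp_all only:)
      then show ?thesis by simp
    qed
    then show ?thesis using B(1) C(1) span_finite[of "(\<lambda>b. (b, 0)) ` B \<union> Pair 0 ` C"] by auto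
  qed
  then show "\<exists>B::('a \<times> 'b) set. finite B \<and> (\<forall>x. \<exists>c. x = (\<Sum>b\<in>B. c b *\<^sub>R b))"
    using B(1) C(1) by (intro exI[of _ "(\<lambda>b. (b, 0)) ` B \<union> Pair 0 ` C"]) auto
qed

subsection \<open>Finite order\<close>

lemma order_Suc_imp_order:
  "differentiable_of_order_on (Suc k) S f \<Longrightarrow> differentiable_of_order_on k S f"
proof (induction k arbitrary: f)
  case 0
  then show ?case
    by (auto intro!: continuous_at_imp_continuous_on differentiable_imp_continuous_within)
next
  case (Suc k)
  then show ?case by (metis differentiable_of_order_on.simps(2))
qed

lemma order_imp_continuous_on:
  "differentiable_of_order_on k S f \<Longrightarrow> continuous_on S f"
  by (induction k) (use order_Suc_imp_order in auto)

text \<open>\<open>frechet_derivative\<close> is a choice from the derivative predicate; equal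
  predicates give equal choices, whether or not a derivative exists.\<close>

lemma frechet_derivative_cong_open:
  assumes "open S" "x \<in> S" "\<And>y. y \<in> S \<Longrightarrow> f y = g y"
  shows "frechet_derivative f (at x) = frechet_derivative g (at x)"
proof -
  have "(f has_derivative D) (at x) \<longleftrightarrow> (g has_derivative D) (at x)" for D
    using assms by (metis has_derivative_transform_within_open)
  then show ?thesis by (simp add: frechet_derivative_def)
qed

lemma order_cong:
  assumes "open S" "\<And>x. x \<in> S \<Longrightarrow> f x = g x" "differentiable_of_order_on k S f"
  shows "differentiable_of_order_on k S g"
  using assms(2,3)
proof (induction k arbitrary: f g)
  case 0
  then show ?case by (metis continuous_on_cong differentiable_of_order_on.simps(1))
next
  case (Suc k)
  have "g differentiable (at x)" if x: "x \<in> S" for x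
  proof -
    obtain D where "(f has_derivative D) (at x)"
      using Suc.prems(2) x by (auto simp: differentiable_def)
    then have "(g has_derivative D) (at x)"
      by (rule has_derivative_transform_within_open[OF _ assms(1) x]) (use Suc.prems(1) in auto)
    then show ?thesis by (auto simp: differentiable_def)
  qed
  moreover have "differentiable_of_order_on k S (\<lambda>x. frechet_derivative g (at x) v)" for v
  proof (rule Suc.IH)
    show "differentiable_of_order_on k S (\<lambda>x. frechet_derivative f (at x) v)"
      using Suc.prems(2) by simp
    show "frechet_derivative f (at x) v = frechet_derivative g (at x) v" if "x \<in> S" for x
      using frechet_derivative_cong_open[OF assms(1) that Suc.prems(1)] by simp
  qed
  ultimately show ?case by simp
qed

text \<open>The entry point for the closure properties below: the chosen
  \<open>frechet_derivative\<close>, which is unspecified where no derivative exists, is traded for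
  an explicit formula valid on the open set.\<close>

lemma order_SucI:
  assumes "open S" "\<And>x. x \<in> S \<Longrightarrow> (f has_derivative f' x) (at x)"
    "\<And>v. differentiable_of_order_on k S (\<lambda>x. f' x v)"
  shows "differentiable_of_order_on (Suc k) S f"
proof -
  have "differentiable_of_order_on k S (\<lambda>x. frechet_derivative f (at x) v)" for v
    by (rule order_cong[OF assms(1) _ assms(3)[of v]]) (metis assms(2) frechet_derivative_at)
  then show ?thesis using assms(2) by (auto simp: differentiable_def)
qed

lemma order_subset:
  "T \<subseteq> S \<Longrightarrow> differentiable_of_order_on k S f \<Longrightarrow> differentiable_of_order_on k T f"
  by (induction k arbitrary: f) (auto intro: continuous_on_subset)

lemma order_local:
  assumes "\<And>x. x \<in> S \<Longrightarrow> \<exists>T. open T \<and> x \<in> T \<and> differentiable_of_order_on k T f"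
  shows "differentiable_of_order_on k S f"
  using assms
proof (induction k arbitrary: f)
  case 0
  then show ?case
    by (auto intro!: continuous_at_imp_continuous_on) (meson continuous_on_eq_continuous_at)
next
  case (Suc k)
  have "differentiable_of_order_on k S (\<lambda>x. frechet_derivative f (at x) v)" for v
  proof (rule Suc.IH)
    fix x assume "x \<in> S"
    then obtain T where "open T" "x \<in> T" "differentiable_of_order_on (Suc k) T f"
      using Suc.prems by blast
    then show "\<exists>T. open T \<and> x \<in> T \<and>
        differentiable_of_order_on k T (\<lambda>x. frechet_derivative f (at x) v)"
      by auto
  qed
  moreover have "f differentiable (at x)" if x: "x \<in> S" for x
  proof -
    obtain T where "x \<in> T" "differentiable_of_order_on (Suc k) T f"
      using Suc.prems x by blast
    then show ?thesis by auto
  qed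
  ultimately show ?case by simp
qed

lemma order_const: "differentiable_of_order_on k S (\<lambda>x. c)"
proof (induction k arbitrary: c)
  case (Suc k)
  have "frechet_derivative (\<lambda>x. c) (at x) = (\<lambda>v. 0)" for x
    by (metis frechet_derivative_at has_derivative_const)
  then show ?case using Suc by simp
qed simp

lemma order_bounded_linear:
  assumes "bounded_linear L"
  shows "differentiable_of_order_on k S L"
proof (cases k)
  case 0
  then show ?thesis using assms by (simp add: linear_continuous_on)
next
  case (Suc j)
  have "(L has_derivative L) (at x)" for x
    by (simp add: assms bounded_linear_imp_has_derivative)
  then have "frechet_derivative L (at x) = L" for x by (metis frechet_derivative_at)
  then show ?thesis using Suc \<open>\<And>x. (L has_derivative L) (at x)\<close>
    by (auto simp: differentiable_def order_const)
qed

lemma order_bounded_linear_image: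
  assumes "bounded_linear L" "open S" "differentiable_of_order_on k S f"
  shows "differentiable_of_order_on k S (\<lambda>x. L (f x))"
  using assms(3)
proof (induction k arbitrary: f)
  case 0
  then show ?case
    by (simp add: assms(1) bounded_linear.continuous_on)
next
  case (Suc k)
  show ?case
  proof (rule order_SucI[OF assms(2)])
    fix x assume "x \<in> S"
    then show "((\<lambda>x. L (f x)) has_derivative (\<lambda>v. L (frechet_derivative f (at x) v))) (at x)"
      using Suc.prems assms(1)
      by (auto intro: bounded_linear.has_derivative simp: frechet_derivative_works[symmetric])
  next
    fix v
    show "differentiable_of_order_on k S (\<lambda>x. L (frechet_derivative f (at x) v))"
      using Suc by simp
  qed
qed

lemma order_add:
  assumes "open S" "differentiable_of_order_on k S f" "differentiable_of_order_on k S g"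
  shows "differentiable_of_order_on k S (\<lambda>x. f x + g x)"
  using assms(2,3)
proof (induction k arbitrary: f g)
  case 0
  then show ?case by (simp add: continuous_on_add)
next
  case (Suc k)
  show ?case
  proof (rule order_SucI[OF assms(1)])
    fix x assume "x \<in> S"
    then show "((\<lambda>x. f x + g x) has_derivative
        (\<lambda>v. frechet_derivative f (at x) v + frechet_derivative g (at x) v)) (at x)"
      using Suc.prems by (auto intro!: has_derivative_add simp: frechet_derivative_works[symmetric])
  qed (use Suc in simp)
qed

lemma order_sum:
  assumes "open S" "\<And>i. i \<in> I \<Longrightarrow> differentiable_of_order_on k S (f i)"
  shows "differentiable_of_order_on k S (\<lambda>x. \<Sum>i\<in>I. f i x)"
  using assms(2) by (induction I rule: infinite_finite_induct) (simp_all add: order_const order_add assms(1))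

lemma order_bounded_bilinear:
  assumes "bounded_bilinear p" "open S" "differentiable_of_order_on k S f"
    "differentiable_of_order_on k S g"
  shows "differentiable_of_order_on k S (\<lambda>x. p (f x) (g x))"
  using assms(3,4)
proof (induction k arbitrary: f g)
  case 0
  then show ?case by (simp add: assms(1) bounded_bilinear.continuous_on)
next
  case (Suc k)
  show ?case
  proof (rule order_SucI[OF assms(2)])
    fix x assume "x \<in> S"
    then show "((\<lambda>x. p (f x) (g x)) has_derivative
        (\<lambda>v. p (f x) (frechet_derivative g (at x) v) + p (frechet_derivative f (at x) v) (g x))) (at x)"
      using Suc.prems
      by (auto intro!: bounded_bilinear.FDERIV[OF assms(1)] simp: frechet_derivative_works[symmetric])
  next
    fix v
    show "differentiable_of_order_on k S (\<lambda>x. p (f x) (frechet_derivative g (at x) v) +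
        p (frechet_derivative f (at x) v) (g x))"
    proof (intro order_add assms(2) Suc.IH)
      show "differentiable_of_order_on k S f" "differentiable_of_order_on k S g"
        using Suc.prems by (blast intro: order_Suc_imp_order)+
    qed (use Suc.prems in auto)
  qed
qed

text \<open>The derivative of g at \<open>f x\<close> is applied to a vector that itself varies with
  x, whereas the definition of order controls derivatives only in fixed directions. Expanding that
  vector in an orthonormal set leaves the fixed directions b, with coefficients of order k; the
  induction then runs over g with f fixed.\<close>

lemma order_compose:
  fixes f :: "'a::real_normed_vector \<Rightarrow> 'b::finite_dim_space"
  assumes "open S" "open T" "f ` S \<subseteq> T" "differentiable_of_order_on k S f"
    "differentiable_of_order_on k T g"
  shows "differentiable_of_order_on k S (\<lambda>x. g (f x))"
  using assms(4,5)
proof (induction k arbitrary: g)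
  case 0
  then show ?case using assms(3) by (auto intro: continuous_on_compose2)
next
  case (Suc k)
  obtain B :: "'b set" where B: "finite B" "\<And>x. x = (\<Sum>b\<in>B. (x \<bullet> b) *\<^sub>R b)"
    by (rule orthonormal_spanning_set) blast
  show ?case
  proof (rule order_SucI[OF assms(1)])
    fix x assume x: "x \<in> S"
    have gd: "(g has_derivative frechet_derivative g (at (f x))) (at (f x))"
      using x Suc.prems assms(3) by (auto simp: frechet_derivative_works[symmetric])
    have der: "((\<lambda>x. g (f x)) has_derivative
        (\<lambda>v. frechet_derivative g (at (f x)) (frechet_derivative f (at x) v))) (at x)"
      by (rule has_derivative_compose[where f = f and g = g, OF _ gd])
        (use x Suc.prems in \<open>auto simp: frechet_derivative_works[symmetric]\<close>)
    have "frechet_derivative g (at (f x)) w =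
        (\<Sum>b\<in>B. (w \<bullet> b) *\<^sub>R frechet_derivative g (at (f x)) b)" for w
    proof -
      have lin: "linear (frechet_derivative g (at (f x)))"
        using gd has_derivative_linear by blast
      show ?thesis
        by (subst B(2)[of w]) (simp add: linear_sum[OF lin] linear_cmul[OF lin])
    qed
    then show "((\<lambda>x. g (f x)) has_derivative
        (\<lambda>v. \<Sum>b\<in>B. (frechet_derivative f (at x) v \<bullet> b) *\<^sub>R frechet_derivative g (at (f x)) b)) (at x)"
      by (intro has_derivative_eq_rhs[OF der] ext)
  next
    fix v
    have "differentiable_of_order_on k S (\<lambda>x. frechet_derivative g (at (f x)) b)" for b
      using Suc.prems order_Suc_imp_order by (intro Suc.IH) auto
    moreover have "differentiable_of_order_on k S (\<lambda>x. frechet_derivative f (at x) v \<bullet> b)" for b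
      using Suc.prems by (intro order_bounded_linear_image[OF bounded_linear_inner_left assms(1)]) auto
    ultimately show "differentiable_of_order_on k S
        (\<lambda>x. \<Sum>b\<in>B. (frechet_derivative f (at x) v \<bullet> b) *\<^sub>R frechet_derivative g (at (f x)) b)"
      by (intro order_sum assms(1) order_bounded_bilinear[OF bounded_bilinear_scaleR]) auto
  qed
qed

lemma order_Pair:
  assumes "open S" "differentiable_of_order_on k S f" "differentiable_of_order_on k S g"
  shows "differentiable_of_order_on k S (\<lambda>x. (f x, g x))"
proof -
  have b: "bounded_linear (\<lambda>x. (x, 0))" "bounded_linear (\<lambda>x. (0, x))"
    by (auto intro!: bounded_linear_Pair bounded_linear_ident bounded_linear_zero)
  have "differentiable_of_order_on k S (\<lambda>x. (f x, 0) + (0, g x))"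
    by (intro order_add assms(1) order_bounded_linear_image[OF b(1) assms(1,2)]
        order_bounded_linear_image[OF b(2) assms(1,3)])
  then show ?thesis by simp
qed

lemma order_inverse:
  fixes f :: "'a::real_normed_vector \<Rightarrow> real"
  assumes "open S" "\<And>x. x \<in> S \<Longrightarrow> f x \<noteq> 0" "differentiable_of_order_on k S f"
  shows "differentiable_of_order_on k S (\<lambda>x. inverse (f x))"
  using assms(3)
proof (induction k)
  case 0
  then show ?case using assms(2) by (auto intro: continuous_on_inverse)
next
  case (Suc k)
  show ?case
  proof (rule order_SucI[OF assms(1)])
    fix x assume "x \<in> S"
    then show "((\<lambda>x. inverse (f x)) has_derivative
        (\<lambda>v. - (inverse (f x) * frechet_derivative f (at x) v * inverse (f x)))) (at x)"
      using Suc.prems assms(2)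
      by (intro Deriv.has_derivative_inverse) (auto simp: frechet_derivative_works[symmetric])
  next
    fix v
    show "differentiable_of_order_on k S (\<lambda>x. - (inverse (f x) * frechet_derivative f (at x) v * inverse (f x)))"
      using Suc order_Suc_imp_order
      by (intro order_bounded_linear_image[OF bounded_linear_minus[OF bounded_linear_ident]]
          order_bounded_bilinear[OF bounded_bilinear_mult] assms(1)) auto
  qed
qed

text \<open>Differentiation under the integral sign: each partial derivative of the kernel in a
  direction \<open>(0, c)\<close> is again a kernel on W, of order one less. The open set W is there
  because a closed interval is not open, while derivatives are taken on open sets.\<close>

lemma order_integral:
  fixes K :: "real \<times> 'a::finite_dim_space \<Rightarrow> real"
  assumes "open W" "open S" "{a..b} \<times> S \<subseteq> W" "differentiable_of_order_on k W K"
  shows "differentiable_of_order_on k S (\<lambda>x. integral {a..b} (\<lambda>t. K (t, x)))"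
  using assms(4)
proof (induction k arbitrary: K)
  case 0
  have "continuous_on (S \<times> cbox a b) (\<lambda>(x, t). K (t, x))"
    unfolding split_beta
    by (rule continuous_on_compose2[of W K]) (use 0 assms(3) in \<open>auto intro!: continuous_intros\<close>)
  from integral_continuous_on_param[OF this] show ?case by simp
next
  case (Suc k)
  obtain B :: "'a set" where B: "finite B" "\<And>x. x = (\<Sum>b\<in>B. (x \<bullet> b) *\<^sub>R b)"
    by (rule orthonormal_spanning_set) blast
  define D where "D c = (\<lambda>z. frechet_derivative K (at z) (0, c))" for c :: 'a
  have Dk: "differentiable_of_order_on k W (D c)" for c
    using Suc.prems by (simp add: D_def)
  have cK: "continuous_on W K" "continuous_on W (D c)" for c
    using Suc.prems Dk order_imp_continuous_on by blast+
  have cKt: "continuous_on {a..b} (\<lambda>t. K (t, x))" "continuous_on {a..b} (\<lambda>t. D c (t, x))" if "x \<in> S" for x c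
    using that assms(3)
    by (auto intro!: continuous_on_compose2[OF cK(1)] continuous_on_compose2[OF cK(2)] continuous_intros)
  \<comment> \<open>The x-derivative of the kernel as a bounded linear map, the form that
    \<open>leibniz_rule\<close> expects; as a finite sum of fixed functionals its continuity reduces
    to that of the scalar coefficients \<open>D c\<close>.\<close>
  define fx where "fx x t = (\<Sum>c\<in>B. D c (t, x) *\<^sub>R blinfun_inner_left c)" for x t
  have fx: "blinfun_apply (fx x t) v = (\<Sum>c\<in>B. D c (t, x) * (v \<bullet> c))" for x t v
    by (simp add: fx_def blinfun.sum_left blinfun.scaleR_left inner_commute)
  have der: "((\<lambda>x. K (t, x)) has_derivative blinfun_apply (fx x t)) (at x)"
    if "x \<in> S" "t \<in> {a..b}" for x t
  proof -
    have KD: "(K has_derivative frechet_derivative K (at (t, x))) (at (t, x))"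
      using Suc.prems that subsetD[OF assms(3), of "(t, x)"] by (auto simp: frechet_derivative_works[symmetric])
    have "((\<lambda>x. K (t, x)) has_derivative (\<lambda>v. frechet_derivative K (at (t, x)) (0, v))) (at x)"
      by (rule has_derivative_compose[of "\<lambda>x. (t, x)" _ _ _ K, OF _ KD]) (auto intro!: derivative_eq_intros)
    moreover have "frechet_derivative K (at (t, x)) (0, v) = blinfun_apply (fx x t) v" for v
    proof -
      have lin: "linear (\<lambda>v. frechet_derivative K (at (t, x)) (0, v))"
        using calculation has_derivative_linear by blast
      show ?thesis
        unfolding fx D_def
        by (subst B(2)[of v], subst linear_sum[OF lin], simp add: linear_cmul[OF lin])
          (simp add: linear_cmul[OF lin] mult.commute)
    qed
    ultimately show ?thesis by simp
  qed
  have cfx: "continuous_on (S \<times> cbox a b) (\<lambda>(x, t). fx x t)"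
    unfolding fx_def split_beta
    by (intro continuous_intros continuous_on_compose2[OF cK(2)]) (use assms(3) in auto)
  show ?case
  proof (rule order_SucI[OF assms(2)])
    fix x assume x: "x \<in> S"
    \<comment> \<open>\<open>leibniz_rule\<close> works over a convex parameter set; a ball inside S
      provides one.\<close>
    obtain e where e: "e > 0" "ball x e \<subseteq> S" using x assms(2) open_contains_ball by blast
    have "((\<lambda>x. integral (cbox a b) (\<lambda>t. K (t, x))) has_derivative integral (cbox a b) (fx x)) (at x within ball x e)"
    proof (rule leibniz_rule)
      show "continuous_on (ball x e \<times> cbox a b) (\<lambda>(x, t). fx x t)"
        by (rule continuous_on_subset[OF cfx]) (use e in auto)
      show "(\<lambda>t. K (t, y)) integrable_on cbox a b" if "y \<in> ball x e" for y
        using cKt that e by (auto intro!: integrable_continuous_real)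
      show "((\<lambda>x. K (t, x)) has_derivative blinfun_apply (fx y t)) (at y within ball x e)"
        if "y \<in> ball x e" "t \<in> cbox a b" for y t
        using that e by (auto intro!: has_derivative_at_withinI[OF der])
    qed (use e in auto)
    then have "((\<lambda>x. integral {a..b} (\<lambda>t. K (t, x))) has_derivative integral {a..b} (fx x)) (at x)"
      using e by (simp add: at_within_open[of x "ball x e"])
    moreover have "integral {a..b} (fx x) = (\<Sum>c\<in>B. integral {a..b} (\<lambda>t. D c (t, x)) *\<^sub>R blinfun_inner_left c)"
    proof -
      have "((\<lambda>t. D c (t, x) *\<^sub>R blinfun_inner_left c) has_integral
          integral {a..b} (\<lambda>t. D c (t, x)) *\<^sub>R blinfun_inner_left c) {a..b}" for c
        using has_integral_linear[OF integrable_integral[OF integrable_continuous_real[OF cKt(2)[OF x, of c]]]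
            bounded_linear_scaleR_left, of "blinfun_inner_left c"]
        by (simp add: o_def)
      then have "(fx x has_integral (\<Sum>c\<in>B. integral {a..b} (\<lambda>t. D c (t, x)) *\<^sub>R blinfun_inner_left c)) {a..b}"
        unfolding fx_def by (rule has_integral_sum[OF B(1)])
      then show ?thesis by blast
    qed
    moreover have "blinfun_apply (\<Sum>c\<in>B. integral {a..b} (\<lambda>t. D c (t, x)) *\<^sub>R blinfun_inner_left c) =
        (\<lambda>v. \<Sum>c\<in>B. integral {a..b} (\<lambda>t. D c (t, x)) * (v \<bullet> c))"
      by (rule ext) (simp add: blinfun.sum_left blinfun.scaleR_left inner_commute)
    ultimately show "((\<lambda>x. integral {a..b} (\<lambda>t. K (t, x))) has_derivative
        (\<lambda>v. \<Sum>c\<in>B. integral {a..b} (\<lambda>t. D c (t, x)) * (v \<bullet> c))) (at x)"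
      by metis
  next
    fix v
    show "differentiable_of_order_on k S (\<lambda>x. \<Sum>c\<in>B. integral {a..b} (\<lambda>t. D c (t, x)) * (v \<bullet> c))"
      using Suc.IH[OF Dk]
      by (intro order_sum assms(2) order_bounded_linear_image[OF bounded_linear_mult_left]) auto
  qed
qed

subsection \<open>Smooth functions\<close>

lemma smooth_on_imp_continuous_on: "smooth_on S f \<Longrightarrow> continuous_on S f"
  unfolding smooth_on_def using order_imp_continuous_on by blast

lemma smooth_on_has_derivative:
  "smooth_on S f \<Longrightarrow> x \<in> S \<Longrightarrow> (f has_derivative frechet_derivative f (at x)) (at x)"
  unfolding smooth_on_def frechet_derivative_works[symmetric]
  by (drule spec[of _ "Suc 0"]) simp

lemma smooth_on_frechet_derivative:
  assumes "smooth_on S f"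
  shows "smooth_on S (\<lambda>x. frechet_derivative f (at x) v)"
  unfolding smooth_on_def
proof
  fix k
  have "differentiable_of_order_on (Suc k) S f" using assms by (simp add: smooth_on_def)
  then show "differentiable_of_order_on k S (\<lambda>x. frechet_derivative f (at x) v)" by simp
qed

lemma smooth_on_cong:
  "open S \<Longrightarrow> (\<And>x. x \<in> S \<Longrightarrow> f x = g x) \<Longrightarrow> smooth_on S f \<Longrightarrow> smooth_on S g"
  unfolding smooth_on_def using order_cong by blast

lemma smooth_on_subset: "smooth_on S f \<Longrightarrow> T \<subseteq> S \<Longrightarrow> smooth_on T f"
  unfolding smooth_on_def using order_subset by blast

lemma smooth_on_local:
  assumes "\<And>x. x \<in> S \<Longrightarrow> \<exists>T. open T \<and> x \<in> T \<and> smooth_on T f"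
  shows "smooth_on S f"
  unfolding smooth_on_def
proof
  fix k
  show "differentiable_of_order_on k S f"
    by (rule order_local) (use assms in \<open>auto simp: smooth_on_def\<close>)
qed

lemma smooth_on_const: "smooth_on S (\<lambda>x. c)"
  by (simp add: smooth_on_def order_const)

lemma smooth_on_bounded_linear: "bounded_linear L \<Longrightarrow> smooth_on S L"
  by (simp add: smooth_on_def order_bounded_linear)

lemma smooth_on_id: "smooth_on S (\<lambda>x. x)"
  by (rule smooth_on_bounded_linear) (rule bounded_linear_ident)

lemma smooth_on_fst: "smooth_on S fst" and smooth_on_snd: "smooth_on S snd"
  by (auto intro: smooth_on_bounded_linear bounded_linear_fst bounded_linear_snd)

lemma smooth_on_add:
  "open S \<Longrightarrow> smooth_on S f \<Longrightarrow> smooth_on S g \<Longrightarrow> smooth_on S (\<lambda>x. f x + g x)"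
  by (simp add: smooth_on_def order_add)

lemma smooth_on_sum:
  "open S \<Longrightarrow> (\<And>i. i \<in> I \<Longrightarrow> smooth_on S (f i)) \<Longrightarrow> smooth_on S (\<lambda>x. \<Sum>i\<in>I. f i x)"
  by (simp add: smooth_on_def order_sum)

lemma smooth_on_scaleR:
  "open S \<Longrightarrow> smooth_on S f \<Longrightarrow> smooth_on S g \<Longrightarrow> smooth_on S (\<lambda>x. f x *\<^sub>R g x)"
  by (simp add: smooth_on_def order_bounded_bilinear[OF bounded_bilinear_scaleR])

lemma smooth_on_mult:
  fixes f g :: "_ \<Rightarrow> real"
  shows "open S \<Longrightarrow> smooth_on S f \<Longrightarrow> smooth_on S g \<Longrightarrow> smooth_on S (\<lambda>x. f x * g x)"
  by (simp add: smooth_on_def order_bounded_bilinear[OF bounded_bilinear_mult])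

lemma smooth_on_inner:
  "open S \<Longrightarrow> smooth_on S f \<Longrightarrow> smooth_on S g \<Longrightarrow> smooth_on S (\<lambda>x. f x \<bullet> g x)"
  by (simp add: smooth_on_def order_bounded_bilinear[OF bounded_bilinear_inner])

lemma smooth_on_diff:
  assumes "open S" "smooth_on S f" "smooth_on S g"
  shows "smooth_on S (\<lambda>x. f x - g x)"
  using smooth_on_add[OF assms(1,2) smooth_on_scaleR[OF assms(1) smooth_on_const assms(3), of "-1"]]
  by simp

lemma smooth_on_compose:
  fixes f :: "'a::real_normed_vector \<Rightarrow> 'b::finite_dim_space"
  shows "open S \<Longrightarrow> open T \<Longrightarrow> f ` S \<subseteq> T \<Longrightarrow> smooth_on S f \<Longrightarrow> smooth_on T g \<Longrightarrow>
    smooth_on S (\<lambda>x. g (f x))"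
  unfolding smooth_on_def using order_compose by blast

lemma smooth_on_Pair:
  "open S \<Longrightarrow> smooth_on S f \<Longrightarrow> smooth_on S g \<Longrightarrow> smooth_on S (\<lambda>x. (f x, g x))"
  by (simp add: smooth_on_def order_Pair)

lemma smooth_on_inverse:
  fixes f :: "_ \<Rightarrow> real"
  shows "open S \<Longrightarrow> (\<And>x. x \<in> S \<Longrightarrow> f x \<noteq> 0) \<Longrightarrow> smooth_on S f \<Longrightarrow> smooth_on S (\<lambda>x. inverse (f x))"
  by (simp add: smooth_on_def order_inverse)

lemma smooth_on_integral:
  fixes K :: "real \<times> 'a::finite_dim_space \<Rightarrow> real"
  shows "open W \<Longrightarrow> open S \<Longrightarrow> {a..b} \<times> S \<subseteq> W \<Longrightarrow> smooth_on W K \<Longrightarrow>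
    smooth_on S (\<lambda>x. integral {a..b} (\<lambda>t. K (t, x)))"
  unfolding smooth_on_def using order_integral by blast

subsection \<open>A smooth cutoff function\<close>

text \<open>For p = 1 this is the classical flat function exp(-1/t). The polynomial makes the family
  closed under differentiation: with s = 1/t, differentiating replaces p by s^2 (p - p'), which is
  the polynomial in \<open>cutoff_has_derivative\<close>.\<close>

definition cutoff :: "real poly \<Rightarrow> real \<Rightarrow> real" where
  "cutoff p t = (if t > 0 then poly p (inverse t) * exp (- inverse t) else 0)"

lemma poly_inverse_exp_tendsto_0:
  "((\<lambda>t. poly p (inverse t) * exp (- inverse t)) \<longlongrightarrow> 0) (at_right (0::real))"
proof -
  have "((\<lambda>s. poly p s * exp (- s)) \<longlongrightarrow> 0) at_top"
  proof -
    have "((\<lambda>s. \<Sum>i\<le>degree p. coeff p i * (s ^ i / exp s)) \<longlongrightarrow> (\<Sum>i\<le>degree p. coeff p i * 0)) at_top"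
      by (intro tendsto_intros tendsto_power_div_exp_0)
    then show ?thesis
      by (simp add: poly_altdef sum_distrib_right exp_minus divide_inverse mult.assoc)
  qed
  then show ?thesis
    using filterlim_compose filterlim_inverse_at_top_right by blast
qed

lemma cutoff_has_derivative:
  "(cutoff p has_real_derivative cutoff ([:0, 0, 1:] * (p - pderiv p)) t) (at t)"
proof -
  consider "t > 0" | "t < 0" | "t = 0" by linarith
  then show ?thesis
  proof cases
    case 1
    have "((\<lambda>t. poly p (inverse t) * exp (- inverse t)) has_real_derivative
        cutoff ([:0, 0, 1:] * (p - pderiv p)) t) (at t)"
      using 1 by (auto intro!: derivative_eq_intros simp: cutoff_def algebra_simps power2_eq_square)
    then show ?thesis
      by (rule has_field_derivative_transform_within_open[where S = "{0<..}"]) (use 1 in \<open>auto simp: cutoff_def\<close>)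
  next
    case 2
    have "((\<lambda>t. 0) has_real_derivative 0) (at t)" by simp
    then have "(cutoff p has_real_derivative 0) (at t)"
      by (rule has_field_derivative_transform_within_open[where S = "{..<0}"]) (use 2 in \<open>auto simp: cutoff_def\<close>)
    then show ?thesis using 2 by (simp add: cutoff_def)
  next
    case 3
    have "((\<lambda>h. cutoff p h / h) \<longlongrightarrow> 0) (at 0)"
    proof (rule filterlim_split_at)
      have "eventually (\<lambda>h::real. cutoff p h / h = 0) (at_left 0)"
        by (auto simp: eventually_at_filter cutoff_def)
      then show "((\<lambda>h. cutoff p h / h) \<longlongrightarrow> 0) (at_left 0)"
        by (rule tendsto_eventually)
      \<comment> \<open>Dividing by h multiplies the polynomial in 1/h by its variable, so the
        difference quotient at 0 has the same shape and the same limit 0.\<close>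
      have "eventually (\<lambda>h::real. poly ([:0, 1:] * p) (inverse h) * exp (- inverse h) = cutoff p h / h) (at_right 0)"
        by (auto simp: eventually_at_filter cutoff_def divide_inverse)
      then show "((\<lambda>h. cutoff p h / h) \<longlongrightarrow> 0) (at_right 0)"
        by (rule Lim_transform_eventually[OF poly_inverse_exp_tendsto_0])
    qed
    then show ?thesis using 3 by (simp add: DERIV_def cutoff_def)
  qed
qed

lemma smooth_on_cutoff: "smooth_on S (cutoff p)"
proof -
  have "differentiable_of_order_on k UNIV (cutoff p)" for k
  proof (induction k arbitrary: p)
    case 0
    show ?case
      by (auto intro!: continuous_at_imp_continuous_on DERIV_isCont cutoff_has_derivative)
  next
    case (Suc k)
    show ?case
    proof (rule order_SucI)
      fix x
      show "(cutoff p has_derivative (*) (cutoff ([:0, 0, 1:] * (p - pderiv p)) x)) (at x)"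
        using cutoff_has_derivative has_field_derivative_def by blast
      fix v :: real
      show "differentiable_of_order_on k UNIV (\<lambda>x. cutoff ([:0, 0, 1:] * (p - pderiv p)) x * v)"
        by (rule order_bounded_linear_image[OF bounded_linear_mult_left open_UNIV Suc])
    qed simp
  qed
  then show ?thesis
    unfolding smooth_on_def by (auto intro: order_subset[of S UNIV])
qed

text \<open>The squared distance is smooth even at the centre, and \<open>cutoff 1\<close> is
  nonzero exactly where its argument is positive. Nonvanishing on the whole open ball matters as
  much as the support: components of a vector field are later obtained by dividing by h.\<close>

lemma smooth_bump:
  fixes p :: "'a::finite_dim_space"
  assumes "r > 0"
  obtains h :: "'a \<Rightarrow> real"
  where "smooth_on UNIV h" "\<And>x. h x \<noteq> 0 \<longleftrightarrow> x \<in> ball p r"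
proof
  let ?h = "\<lambda>x. cutoff 1 (r\<^sup>2 - (x - p) \<bullet> (x - p))"
  show "smooth_on UNIV ?h"
    by (rule smooth_on_compose[OF open_UNIV open_UNIV _ _ smooth_on_cutoff])
      (auto intro!: smooth_on_diff smooth_on_inner smooth_on_id smooth_on_const)
  have "(r\<^sup>2 - (x - p) \<bullet> (x - p) > 0) = (norm (x - p) < r)" for x
    using assms power_mono_iff[of r "norm (x - p)" 2] by (auto simp: dot_square_norm not_le[symmetric])
  then show "?h x \<noteq> 0 \<longleftrightarrow> x \<in> ball p r" for x
    by (simp add: cutoff_def dist_norm norm_minus_commute)
qed

section \<open>Smooth maps between manifolds\<close>

lemma is_chartD:
  assumes "is_chart (U, \<phi>)"
  shows "open U" "open (\<phi> ` U)" "inj_on \<phi> U" "continuous_on U \<phi>"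
    "continuous_on (\<phi> ` U) (inv_into U \<phi>)"
  using assms by (auto simp: is_chart_def homeomorphism_def intro: inj_on_inverseI)

lemma is_chartI:
  assumes "open U" "open (\<phi> ` U)" "inj_on \<phi> U" "continuous_on U \<phi>"
    "continuous_on (\<phi> ` U) (inv_into U \<phi>)"
  shows "is_chart (U, \<phi>)"
  using assms by (auto simp: is_chart_def homeomorphism_def inv_into_into image_comp)

lemma chart_open_image:
  assumes "is_chart (U, \<phi>)" "open W" "W \<subseteq> U"
  shows "open (\<phi> ` W)"
proof -
  have "\<phi> ` W = inv_into U \<phi> -` W \<inter> \<phi> ` U"
    using assms(3) is_chartD(3)[OF assms(1)] by (auto simp: inv_into_f_f subset_iff)
  then show ?thesis
    using continuous_on_open_vimage[OF is_chartD(2)[OF assms(1)], THEN iffD1,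
        OF is_chartD(5)[OF assms(1)]] assms(2) by simp
qed

context
  fixes A :: "('m::{t2_space,second_countable_topology}, 'e::finite_dim_space) chart set"
  assumes A: "smooth_manifold A"
begin

lemma manifold_chart: "(U, \<phi>) \<in> A \<Longrightarrow> is_chart (U, \<phi>)"
  using A unfolding smooth_manifold_def by blast

lemma manifold_chart_at: obtains U \<phi> where "(U, \<phi>) \<in> A" "p \<in> U"
proof -
  have "p \<in> (\<Union>c\<in>A. fst c)" using A unfolding smooth_manifold_def by simp
  then show ?thesis using that by auto
qed

lemma manifold_transition:
  "(U, \<phi>) \<in> A \<Longrightarrow> (V, \<psi>) \<in> A \<Longrightarrow> smooth_on (\<phi> ` (U \<inter> V)) (\<psi> \<circ> inv_into U \<phi>)"
  using A unfolding smooth_manifold_def by blast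

end

lemma smooth_map_continuous: "smooth_map A B f \<Longrightarrow> continuous_on UNIV f"
  by (simp add: smooth_map_def)

lemma smooth_map_chart:
  "smooth_map A B f \<Longrightarrow> (U, \<phi>) \<in> A \<Longrightarrow> (V, \<psi>) \<in> B \<Longrightarrow>
    smooth_on (\<phi> ` (U \<inter> f -` V)) (\<psi> \<circ> f \<circ> inv_into U \<phi>)"
  by (auto simp: smooth_map_def)

text \<open>One pair of charts around each point is enough: in any other pair the coordinate
  expression is the given one between two transition maps. The set T collects the points of N at
  which the new charts apply as well.\<close>

lemma smooth_mapI_local:
  fixes A :: "('m::{t2_space,second_countable_topology}, 'e::finite_dim_space) chart set"
    and B :: "('n::{t2_space,second_countable_topology}, 'f::finite_dim_space) chart set"
  assumes A: "smooth_manifold A" and B: "smooth_manifold B"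
    and loc: "\<And>p. \<exists>U \<phi> V \<psi> N. (U, \<phi>) \<in> A \<and> (V, \<psi>) \<in> B \<and> open N \<and> p \<in> N \<and> N \<subseteq> U \<and>
      f ` N \<subseteq> V \<and> continuous_on N f \<and> smooth_on (\<phi> ` N) (\<psi> \<circ> f \<circ> inv_into U \<phi>)"
  shows "smooth_map A B f"
proof -
  have "isCont f p" for p
    using loc[of p] continuous_on_eq_continuous_at by blast
  then have cont: "continuous_on UNIV f"
    by (simp add: continuous_at_imp_continuous_on)
  have "smooth_on (\<phi>' ` (U' \<inter> f -` V')) (\<psi>' \<circ> f \<circ> inv_into U' \<phi>')"
    if U': "(U', \<phi>') \<in> A" and V': "(V', \<psi>') \<in> B" for U' \<phi>' V' \<psi>'
  proof (rule smooth_on_local)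
    fix y assume "y \<in> \<phi>' ` (U' \<inter> f -` V')"
    then obtain p where p: "p \<in> U'" "f p \<in> V'" "y = \<phi>' p" by auto
    obtain U \<phi> V \<psi> N where l: "(U, \<phi>) \<in> A" "(V, \<psi>) \<in> B" "open N" "p \<in> N" "N \<subseteq> U"
      "f ` N \<subseteq> V" "smooth_on (\<phi> ` N) (\<psi> \<circ> f \<circ> inv_into U \<phi>)"
      using loc[of p] by blast
    note cA = is_chartD[OF manifold_chart[OF A U']] is_chartD[OF manifold_chart[OF A l(1)]]
    note cB = is_chartD[OF manifold_chart[OF B V']] is_chartD[OF manifold_chart[OF B l(2)]]
    define T where "T = U' \<inter> N \<inter> f -` V'"
    have oT: "open T"
      unfolding T_def using cA cB l(3) cont by (auto intro!: open_Int open_vimage)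
    define S where "S = \<phi>' ` T"
    have oS: "open S" unfolding S_def
      by (rule chart_open_image[OF manifold_chart[OF A U'] oT]) (auto simp: T_def)
    have oN: "open (\<phi> ` N)"
      by (rule chart_open_image[OF manifold_chart[OF A l(1)] l(3,5)])
    have oVV: "open (\<psi> ` (V \<inter> V'))"
      by (rule chart_open_image[OF manifold_chart[OF B l(2)]]) (use cB in auto)
    have oT2: "open (\<phi> ` T)"
      by (rule chart_open_image[OF manifold_chart[OF A l(1)] oT]) (use l in \<open>auto simp: T_def\<close>)
    have s1: "smooth_on S (\<phi> \<circ> inv_into U' \<phi>')"
      by (rule smooth_on_subset[OF manifold_transition[OF A U' l(1)]])
        (use l(5) in \<open>auto simp: S_def T_def\<close>)
    have inv': "inv_into U' \<phi>' (\<phi>' q) = q" if "q \<in> T" for q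
      using that cA(3) by (auto simp: T_def)
    have inv: "inv_into U \<phi> (\<phi> q) = q" if "q \<in> T" for q
      using that cA(8) l(5) by (auto simp: T_def)
    have invV: "inv_into V \<psi> (\<psi> (f q)) = f q" if "q \<in> T" for q
      using that cB(8) l(5,6) by (auto simp: T_def)
    have i1: "(\<phi> \<circ> inv_into U' \<phi>') ` S \<subseteq> \<phi> ` T"
      using inv' by (auto simp: S_def)
    have s2: "smooth_on (\<phi> ` T) (\<psi> \<circ> f \<circ> inv_into U \<phi>)"
      by (rule smooth_on_subset[OF l(7)]) (auto simp: T_def)
    have i2: "(\<psi> \<circ> f \<circ> inv_into U \<phi>) ` (\<phi> ` T) \<subseteq> \<psi> ` (V \<inter> V')"
      using inv l(6) by (auto simp: T_def)
    have s3: "smooth_on (\<psi> ` (V \<inter> V')) (\<psi>' \<circ> inv_into V \<psi>)"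
      by (rule manifold_transition[OF B l(2) V'])
    have "smooth_on (\<phi> ` T) (\<lambda>x. (\<psi>' \<circ> inv_into V \<psi>) ((\<psi> \<circ> f \<circ> inv_into U \<phi>) x))"
      by (rule smooth_on_compose[OF oT2 oVV i2 s2 s3])
    from smooth_on_compose[OF oS oT2 i1 s1 this]
    have "smooth_on S (\<lambda>x. (\<psi>' \<circ> inv_into V \<psi>) ((\<psi> \<circ> f \<circ> inv_into U \<phi>) ((\<phi> \<circ> inv_into U' \<phi>') x)))" .
    then have "smooth_on S (\<psi>' \<circ> f \<circ> inv_into U' \<phi>')"
      by (rule smooth_on_cong[OF oS, rotated]) (auto simp: S_def inv inv' invV)
    moreover have "y \<in> S" using p l(4) by (auto simp: S_def T_def)
    ultimately show "\<exists>S. open S \<and> y \<in> S \<and> smooth_on S (\<psi>' \<circ> f \<circ> inv_into U' \<phi>')"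
      using oS by blast
  qed
  then show ?thesis using cont by (auto simp: smooth_map_def)
qed

lemma smooth_map_compose:
  fixes A :: "('m::{t2_space,second_countable_topology}, 'e::finite_dim_space) chart set"
    and B :: "('n::{t2_space,second_countable_topology}, 'f::finite_dim_space) chart set"
    and C :: "('o::{t2_space,second_countable_topology}, 'h::finite_dim_space) chart set"
  assumes A: "smooth_manifold A" and B: "smooth_manifold B" and C: "smooth_manifold C"
    and f: "smooth_map A B f" and g: "smooth_map B C g"
  shows "smooth_map A C (\<lambda>x. g (f x))"
proof (rule smooth_mapI_local[OF A C])
  fix p
  obtain U \<phi> where U: "(U, \<phi>) \<in> A" "p \<in> U" by (rule manifold_chart_at[OF A])
  obtain V \<psi> where V: "(V, \<psi>) \<in> B" "f p \<in> V" by (rule manifold_chart_at[OF B])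
  obtain W \<xi> where W: "(W, \<xi>) \<in> C" "g (f p) \<in> W" by (rule manifold_chart_at[OF C])
  note cU = is_chartD[OF manifold_chart[OF A U(1)]]
  note cV = is_chartD[OF manifold_chart[OF B V(1)]]
  note cW = is_chartD[OF manifold_chart[OF C W(1)]]
  note cf = smooth_map_continuous[OF f]
  note cg = smooth_map_continuous[OF g]
  have ogW: "open (V \<inter> g -` W)"
    by (intro open_Int open_vimage cV(1) cW(1) cg)
  define N where "N = U \<inter> f -` (V \<inter> g -` W)"
  have oN: "open N" unfolding N_def
    by (intro open_Int open_vimage[OF ogW cf] cU(1))
  have oN': "open (\<phi> ` N)"
    by (rule chart_open_image[OF manifold_chart[OF A U(1)] oN]) (auto simp: N_def)
  have oV': "open (\<psi> ` (V \<inter> g -` W))"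
    by (rule chart_open_image[OF manifold_chart[OF B V(1)] ogW]) auto
  have invU: "inv_into U \<phi> (\<phi> q) = q" if "q \<in> N" for q
    using that cU(3) by (auto simp: N_def)
  have invV: "inv_into V \<psi> (\<psi> q) = q" if "q \<in> V" for q
    using that cV(3) by auto
  have s1: "smooth_on (\<phi> ` N) (\<psi> \<circ> f \<circ> inv_into U \<phi>)"
    by (rule smooth_on_subset[OF smooth_map_chart[OF f U(1) V(1)]]) (auto simp: N_def)
  have i1: "(\<psi> \<circ> f \<circ> inv_into U \<phi>) ` (\<phi> ` N) \<subseteq> \<psi> ` (V \<inter> g -` W)"
    using invU by (auto simp: N_def)
  have "smooth_on (\<phi> ` N) (\<lambda>x. (\<xi> \<circ> g \<circ> inv_into V \<psi>) ((\<psi> \<circ> f \<circ> inv_into U \<phi>) x))"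
    by (rule smooth_on_compose[OF oN' oV' i1 s1 smooth_map_chart[OF g V(1) W(1)]])
  then have "smooth_on (\<phi> ` N) (\<xi> \<circ> (\<lambda>x. g (f x)) \<circ> inv_into U \<phi>)"
    by (rule smooth_on_cong[OF oN', rotated]) (auto simp: invU invV N_def)
  moreover have "continuous_on N (\<lambda>x. g (f x))"
    by (rule continuous_on_compose2[OF cg continuous_on_subset[OF cf]]) auto
  ultimately show "\<exists>U \<phi> V \<psi> N. (U, \<phi>) \<in> A \<and> (V, \<psi>) \<in> C \<and> open N \<and> p \<in> N \<and> N \<subseteq> U \<and>
      (\<lambda>x. g (f x)) ` N \<subseteq> V \<and> continuous_on N (\<lambda>x. g (f x)) \<and>
      smooth_on (\<phi> ` N) (\<psi> \<circ> (\<lambda>x. g (f x)) \<circ> inv_into U \<phi>)"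
    using U V W oN by (intro exI[of _ U] exI[of _ \<phi>] exI[of _ W] exI[of _ \<xi>] exI[of _ N])
      (auto simp: N_def)
qed

lemma smooth_manifold_std_atlas:
  "smooth_manifold (std_atlas :: ('v::{finite_dim_space,second_countable_topology}, 'v) chart set)"
  by (auto simp: smooth_manifold_def std_atlas_def is_chart_def homeomorphism_def
      intro!: smooth_on_id[folded id_def] continuous_on_id)

text \<open>With one global chart on the target the preimage of its domain is everything, so
  continuity, a separate conjunct of \<open>smooth_map\<close>, already follows from the smooth
  coordinate expressions.\<close>

lemma smooth_map_std_iff:
  fixes A :: "('m::{t2_space,second_countable_topology}, 'e::finite_dim_space) chart set"
  assumes A: "smooth_manifold A"
  shows "smooth_map A std_atlas f \<longleftrightarrow> (\<forall>(U, \<phi>)\<in>A. smooth_on (\<phi> ` U) (f \<circ> inv_into U \<phi>))"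
proof
  assume r: "\<forall>(U, \<phi>)\<in>A. smooth_on (\<phi> ` U) (f \<circ> inv_into U \<phi>)"
  have "isCont f p" for p
  proof -
    obtain U \<phi> where U: "(U, \<phi>) \<in> A" "p \<in> U" by (rule manifold_chart_at[OF A])
    note c = is_chartD[OF manifold_chart[OF A U(1)]]
    have "continuous_on (\<phi> ` U) (f \<circ> inv_into U \<phi>)"
      using r U smooth_on_imp_continuous_on by blast
    then have "continuous_on U (\<lambda>q. (f \<circ> inv_into U \<phi>) (\<phi> q))"
      using c(4) continuous_on_compose2 by blast
    then have "continuous_on U f"
      by (rule continuous_on_eq) (use c(3) in auto)
    then show ?thesis using U(2) c(1) continuous_on_eq_continuous_at by blast
  qed
  then show "smooth_map A std_atlas f"
    using r by (auto simp: smooth_map_def std_atlas_def continuous_at_imp_continuous_on o_def)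
qed (auto simp: smooth_map_def std_atlas_def o_def)

lemma smooth_map_std_std_iff:
  fixes f :: "'v::{finite_dim_space,second_countable_topology} \<Rightarrow> 'w::real_normed_vector"
  shows "smooth_map std_atlas std_atlas f \<longleftrightarrow> smooth_on UNIV f"
  by (subst smooth_map_std_iff[OF smooth_manifold_std_atlas]) (simp add: std_atlas_def)

subsection \<open>Products\<close>

lemma inv_into_map_prod:
  assumes "inj_on \<phi> U" "inj_on \<psi> V" "x \<in> \<phi> ` U" "y \<in> \<psi> ` V"
  shows "inv_into (U \<times> V) (map_prod \<phi> \<psi>) (x, y) = (inv_into U \<phi> x, inv_into V \<psi> y)"
proof (rule inv_into_f_eq)
  show "inj_on (map_prod \<phi> \<psi>) (U \<times> V)" using assms by (intro map_prod_inj_on)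
qed (use assms in \<open>auto simp: inv_into_into f_inv_into_f\<close>)

lemma smooth_manifold_prod_atlas:
  fixes A :: "('m::{t2_space,second_countable_topology}, 'e::finite_dim_space) chart set"
    and B :: "('n::{t2_space,second_countable_topology}, 'f::finite_dim_space) chart set"
  assumes A: "smooth_manifold A" and B: "smooth_manifold B"
  shows "smooth_manifold (prod_atlas A B)"
  unfolding smooth_manifold_def
proof (intro conjI ballI)
  fix c assume "c \<in> prod_atlas A B"
  then obtain U \<phi> V \<psi> where c: "c = (U \<times> V, map_prod \<phi> \<psi>)" "(U, \<phi>) \<in> A" "(V, \<psi>) \<in> B"
    by (auto simp: prod_atlas_def)
  note cA = is_chartD[OF manifold_chart[OF A c(2)]]
  note cB = is_chartD[OF manifold_chart[OF B c(3)]]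
  have im: "map_prod \<phi> \<psi> ` (U \<times> V) = \<phi> ` U \<times> \<psi> ` V" by auto
  show "is_chart c"
    unfolding c(1)
  proof (rule is_chartI)
    show "continuous_on (map_prod \<phi> \<psi> ` (U \<times> V)) (inv_into (U \<times> V) (map_prod \<phi> \<psi>))"
      unfolding im
    proof (rule continuous_on_eq)
      show "continuous_on (\<phi> ` U \<times> \<psi> ` V) (\<lambda>z. (inv_into U \<phi> (fst z), inv_into V \<psi> (snd z)))"
        by (intro continuous_intros continuous_on_compose2[OF cA(5)] continuous_on_compose2[OF cB(5)]) auto
    qed (use inv_into_map_prod[OF cA(3) cB(3)] in auto)
    show "continuous_on (U \<times> V) (map_prod \<phi> \<psi>)"
      unfolding map_prod_def split_beta
      by (intro continuous_intros continuous_on_compose2[OF cA(4)] continuous_on_compose2[OF cB(4)]) auto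
    show "open (map_prod \<phi> \<psi> ` (U \<times> V))"
      unfolding im by (intro open_Times cA cB)
  qed (use cA cB in \<open>auto intro: open_Times map_prod_inj_on\<close>)
next
  show "(\<Union>c\<in>prod_atlas A B. fst c) = UNIV"
  proof -
    have "\<exists>c\<in>prod_atlas A B. (p, q) \<in> fst c" for p q
    proof -
      obtain U \<phi> where U: "(U, \<phi>) \<in> A" "p \<in> U" by (rule manifold_chart_at[OF A])
      obtain V \<psi> where V: "(V, \<psi>) \<in> B" "q \<in> V" by (rule manifold_chart_at[OF B])
      have "(U \<times> V, map_prod \<phi> \<psi>) \<in> prod_atlas A B" using U V by (auto simp: prod_atlas_def)
      then show ?thesis using U V by (metis fst_conv SigmaI)
    qed
    then show ?thesis by auto
  qed
next
  fix c assume c_mem: "c \<in> prod_atlas A B"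
  have *: "case c of (U, \<phi>) \<Rightarrow> case c' of (V, \<psi>) \<Rightarrow> smooth_on (\<phi> ` (U \<inter> V)) (\<psi> \<circ> inv_into U \<phi>)"
    if c'_mem: "c' \<in> prod_atlas A B" for c'
  proof -
    from c_mem c'_mem obtain U \<phi> V \<psi> U' \<phi>' V' \<psi>' where c: "c = (U \<times> V, map_prod \<phi> \<psi>)" "(U, \<phi>) \<in> A" "(V, \<psi>) \<in> B"
      "c' = (U' \<times> V', map_prod \<phi>' \<psi>')" "(U', \<phi>') \<in> A" "(V', \<psi>') \<in> B"
      by (auto simp: prod_atlas_def)
    note cA = is_chartD[OF manifold_chart[OF A c(2)]] is_chartD[OF manifold_chart[OF A c(5)]]
    note cB = is_chartD[OF manifold_chart[OF B c(3)]] is_chartD[OF manifold_chart[OF B c(6)]]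
    define S T where "S = \<phi> ` (U \<inter> U')" and "T = \<psi> ` (V \<inter> V')"
    have oST: "open S" "open T"
      unfolding S_def T_def using cA cB
      by (auto intro!: chart_open_image[OF manifold_chart[OF A c(2)]] chart_open_image[OF manifold_chart[OF B c(3)]])
    have ST: "map_prod \<phi> \<psi> ` (U \<times> V \<inter> U' \<times> V') = S \<times> T"
      unfolding S_def T_def Times_Int_Times by (rule map_prod_image)
    have "smooth_on (S \<times> T) (\<lambda>z. ((\<phi>' \<circ> inv_into U \<phi>) (fst z), (\<psi>' \<circ> inv_into V \<psi>) (snd z)))"
    proof (rule smooth_on_Pair[OF open_Times[OF oST]])
      show "smooth_on (S \<times> T) (\<lambda>z. (\<phi>' \<circ> inv_into U \<phi>) (fst z))"
        by (rule smooth_on_compose[OF open_Times[OF oST] oST(1) _ smooth_on_fst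
              manifold_transition[OF A c(2,5), folded S_def]]) auto
      show "smooth_on (S \<times> T) (\<lambda>z. (\<psi>' \<circ> inv_into V \<psi>) (snd z))"
        by (rule smooth_on_compose[OF open_Times[OF oST] oST(2) _ smooth_on_snd
              manifold_transition[OF B c(3,6), folded T_def]]) auto
    qed
    then have "smooth_on (S \<times> T) (map_prod \<phi>' \<psi>' \<circ> inv_into (U \<times> V) (map_prod \<phi> \<psi>))"
      by (rule smooth_on_cong[OF open_Times[OF oST], rotated])
        (use inv_into_map_prod[OF cA(3) cB(3)] in \<open>auto simp: S_def T_def\<close>)
    then show ?thesis
      by (simp add: c ST)
  qed
  show "case c of (U, \<phi>) \<Rightarrow> \<forall>(V, \<psi>)\<in>prod_atlas A B. smooth_on (\<phi> ` (U \<inter> V)) (\<psi> \<circ> inv_into U \<phi>)"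
    using * by (cases c) auto
qed

lemma smooth_map_Pair:
  fixes A :: "('m::{t2_space,second_countable_topology}, 'e::finite_dim_space) chart set"
    and B :: "('n::{t2_space,second_countable_topology}, 'f::finite_dim_space) chart set"
    and C :: "('o::{t2_space,second_countable_topology}, 'h::finite_dim_space) chart set"
  assumes A: "smooth_manifold A" and B: "smooth_manifold B" and C: "smooth_manifold C"
    and f: "smooth_map A B f" and g: "smooth_map A C g"
  shows "smooth_map A (prod_atlas B C) (\<lambda>x. (f x, g x))"
proof (rule smooth_mapI_local[OF A smooth_manifold_prod_atlas[OF B C]])
  fix p
  obtain U \<phi> where U: "(U, \<phi>) \<in> A" "p \<in> U" by (rule manifold_chart_at[OF A])
  obtain V \<psi> where V: "(V, \<psi>) \<in> B" "f p \<in> V" by (rule manifold_chart_at[OF B])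
  obtain W \<xi> where W: "(W, \<xi>) \<in> C" "g p \<in> W" by (rule manifold_chart_at[OF C])
  note cU = is_chartD[OF manifold_chart[OF A U(1)]]
  note cf = smooth_map_continuous[OF f]
  note cg = smooth_map_continuous[OF g]
  define N where "N = U \<inter> (f -` V \<inter> g -` W)"
  have oN: "open N" unfolding N_def
    by (intro open_Int open_vimage cU(1) is_chartD(1)[OF manifold_chart[OF B V(1)]] cf cg
        is_chartD(1)[OF manifold_chart[OF C W(1)]])
  have oN': "open (\<phi> ` N)"
    by (rule chart_open_image[OF manifold_chart[OF A U(1)] oN]) (auto simp: N_def)
  have "smooth_on (\<phi> ` N) (\<lambda>x. ((\<psi> \<circ> f \<circ> inv_into U \<phi>) x, (\<xi> \<circ> g \<circ> inv_into U \<phi>) x))"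
    by (intro smooth_on_Pair oN' smooth_on_subset[OF smooth_map_chart[OF f U(1) V(1)]]
        smooth_on_subset[OF smooth_map_chart[OF g U(1) W(1)]]) (auto simp: N_def)
  then have "smooth_on (\<phi> ` N) (map_prod \<psi> \<xi> \<circ> (\<lambda>x. (f x, g x)) \<circ> inv_into U \<phi>)"
    by (rule smooth_on_cong[OF oN', rotated]) auto
  moreover have "continuous_on N (\<lambda>x. (f x, g x))"
    using cf cg by (auto intro!: continuous_intros intro: continuous_on_subset)
  moreover have "(V \<times> W, map_prod \<psi> \<xi>) \<in> prod_atlas B C"
    using V W by (auto simp: prod_atlas_def)
  ultimately show "\<exists>U \<phi> V \<psi> N. (U, \<phi>) \<in> A \<and> (V, \<psi>) \<in> prod_atlas B C \<and> open N \<and> p \<in> N \<and> N \<subseteq> U \<and>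
      (\<lambda>x. (f x, g x)) ` N \<subseteq> V \<and> continuous_on N (\<lambda>x. (f x, g x)) \<and>
      smooth_on (\<phi> ` N) (\<psi> \<circ> (\<lambda>x. (f x, g x)) \<circ> inv_into U \<phi>)"
    using U V W oN by (intro exI[of _ U] exI[of _ \<phi>] exI[of _ "V \<times> W"] exI[of _ "map_prod \<psi> \<xi>"] exI[of _ N])
      (auto simp: N_def)
qed

lemma smooth_map_const:
  fixes A :: "('m::{t2_space,second_countable_topology}, 'e::finite_dim_space) chart set"
    and B :: "('n::{t2_space,second_countable_topology}, 'f::finite_dim_space) chart set"
  assumes A: "smooth_manifold A" and B: "smooth_manifold B"
  shows "smooth_map A B (\<lambda>_. c)"
proof (rule smooth_mapI_local[OF A B])
  fix p
  obtain U \<phi> where U: "(U, \<phi>) \<in> A" "p \<in> U" by (rule manifold_chart_at[OF A])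
  obtain V \<psi> where V: "(V, \<psi>) \<in> B" "c \<in> V" by (rule manifold_chart_at[OF B])
  show "\<exists>U \<phi> V \<psi> N. (U, \<phi>) \<in> A \<and> (V, \<psi>) \<in> B \<and> open N \<and> p \<in> N \<and> N \<subseteq> U \<and>
      (\<lambda>_. c) ` N \<subseteq> V \<and> continuous_on N (\<lambda>_. c) \<and>
      smooth_on (\<phi> ` N) (\<psi> \<circ> (\<lambda>_. c) \<circ> inv_into U \<phi>)"
    using U V is_chartD(1)[OF manifold_chart[OF A U(1)]]
    by (intro exI[of _ U] exI[of _ \<phi>] exI[of _ V] exI[of _ \<psi>] exI[of _ U])
      (auto simp: o_def smooth_on_const)
qed

lemma smooth_map_id:
  fixes A :: "('m::{t2_space,second_countable_topology}, 'e::finite_dim_space) chart set"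
  assumes A: "smooth_manifold A"
  shows "smooth_map A A (\<lambda>x. x)"
proof (rule smooth_mapI_local[OF A A])
  fix p
  obtain U \<phi> where U: "(U, \<phi>) \<in> A" "p \<in> U" by (rule manifold_chart_at[OF A])
  have "smooth_on (\<phi> ` U) (\<phi> \<circ> inv_into U \<phi>)"
    using manifold_transition[OF A U(1) U(1)] by simp
  then show "\<exists>U \<phi> V \<psi> N. (U, \<phi>) \<in> A \<and> (V, \<psi>) \<in> A \<and> open N \<and> p \<in> N \<and> N \<subseteq> U \<and>
      (\<lambda>x. x) ` N \<subseteq> V \<and> continuous_on N (\<lambda>x. x) \<and>
      smooth_on (\<phi> ` N) (\<psi> \<circ> (\<lambda>x. x) \<circ> inv_into U \<phi>)"
    using U is_chartD(1)[OF manifold_chart[OF A U(1)]]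
    by (intro exI[of _ U] exI[of _ \<phi>] exI[of _ U] exI[of _ \<phi>] exI[of _ U])
      (auto simp: o_def continuous_on_id)
qed

lemma
  fixes A :: "('m::{t2_space,second_countable_topology}, 'e::finite_dim_space) chart set"
    and B :: "('n::{t2_space,second_countable_topology}, 'f::finite_dim_space) chart set"
  assumes A: "smooth_manifold A" and B: "smooth_manifold B"
  shows smooth_map_fst: "smooth_map (prod_atlas A B) A fst"
    and smooth_map_snd: "smooth_map (prod_atlas A B) B snd"
proof -
  have *: "\<exists>U \<phi> V \<psi>. (U, \<phi>) \<in> A \<and> (V, \<psi>) \<in> B \<and> (U \<times> V, map_prod \<phi> \<psi>) \<in> prod_atlas A B \<and> open (U \<times> V) \<and> p \<in> U \<times> V \<and>
      smooth_on (map_prod \<phi> \<psi> ` (U \<times> V)) (\<phi> \<circ> fst \<circ> inv_into (U \<times> V) (map_prod \<phi> \<psi>)) \<and>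
      smooth_on (map_prod \<phi> \<psi> ` (U \<times> V)) (\<psi> \<circ> snd \<circ> inv_into (U \<times> V) (map_prod \<phi> \<psi>))" for p
  proof -
    obtain U \<phi> where U: "(U, \<phi>) \<in> A" "fst p \<in> U" by (rule manifold_chart_at[OF A])
    obtain V \<psi> where V: "(V, \<psi>) \<in> B" "snd p \<in> V" by (rule manifold_chart_at[OF B])
    note cA = is_chartD[OF manifold_chart[OF A U(1)]]
    note cB = is_chartD[OF manifold_chart[OF B V(1)]]
    have im: "map_prod \<phi> \<psi> ` (U \<times> V) = \<phi> ` U \<times> \<psi> ` V" by auto
    have o: "open (\<phi> ` U \<times> \<psi> ` V)" by (intro open_Times cA cB)
    have "smooth_on (map_prod \<phi> \<psi> ` (U \<times> V)) (\<phi> \<circ> fst \<circ> inv_into (U \<times> V) (map_prod \<phi> \<psi>))"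
      unfolding im by (rule smooth_on_cong[OF o _ smooth_on_fst])
        (use inv_into_map_prod[OF cA(3) cB(3)] cA(3) in auto)
    moreover have "smooth_on (map_prod \<phi> \<psi> ` (U \<times> V)) (\<psi> \<circ> snd \<circ> inv_into (U \<times> V) (map_prod \<phi> \<psi>))"
      unfolding im by (rule smooth_on_cong[OF o _ smooth_on_snd])
        (use inv_into_map_prod[OF cA(3) cB(3)] cB(3) in auto)
    moreover have "(U \<times> V, map_prod \<phi> \<psi>) \<in> prod_atlas A B"
      using U V by (auto simp: prod_atlas_def)
    ultimately show ?thesis
      using U V open_Times[OF cA(1) cB(1)]
      by (intro exI[of _ U] exI[of _ \<phi>] exI[of _ V] exI[of _ \<psi>]) (simp add: mem_Times_iff)
  qed
  show "smooth_map (prod_atlas A B) A fst"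
  proof (rule smooth_mapI_local[OF smooth_manifold_prod_atlas[OF A B] A])
    fix p
    obtain U \<phi> V \<psi> where "(U, \<phi>) \<in> A" "(U \<times> V, map_prod \<phi> \<psi>) \<in> prod_atlas A B" "open (U \<times> V)" "p \<in> U \<times> V"
      "smooth_on (map_prod \<phi> \<psi> ` (U \<times> V)) (\<phi> \<circ> fst \<circ> inv_into (U \<times> V) (map_prod \<phi> \<psi>))"
      using *[of p] by blast
    then show "\<exists>U \<phi> V \<psi> N. (U, \<phi>) \<in> prod_atlas A B \<and> (V, \<psi>) \<in> A \<and> open N \<and> p \<in> N \<and> N \<subseteq> U \<and>
      fst ` N \<subseteq> V \<and> continuous_on N fst \<and> smooth_on (\<phi> ` N) (\<psi> \<circ> fst \<circ> inv_into U \<phi>)"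
      by (intro exI[of _ "U \<times> V"] exI[of _ "map_prod \<phi> \<psi>"] exI[of _ U] exI[of _ \<phi>] exI[of _ "U \<times> V"])
        (auto intro!: continuous_intros)
  qed
  show "smooth_map (prod_atlas A B) B snd"
  proof (rule smooth_mapI_local[OF smooth_manifold_prod_atlas[OF A B] B])
    fix p
    obtain U \<phi> V \<psi> where "(V, \<psi>) \<in> B" "(U \<times> V, map_prod \<phi> \<psi>) \<in> prod_atlas A B" "open (U \<times> V)" "p \<in> U \<times> V"
      "smooth_on (map_prod \<phi> \<psi> ` (U \<times> V)) (\<psi> \<circ> snd \<circ> inv_into (U \<times> V) (map_prod \<phi> \<psi>))"
      using *[of p] by blast
    then show "\<exists>U \<phi> V \<psi> N. (U, \<phi>) \<in> prod_atlas A B \<and> (V, \<psi>) \<in> B \<and> open N \<and> p \<in> N \<and> N \<subseteq> U \<and>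
      snd ` N \<subseteq> V \<and> continuous_on N snd \<and> smooth_on (\<phi> ` N) (\<psi> \<circ> snd \<circ> inv_into U \<phi>)"
      by (intro exI[of _ "U \<times> V"] exI[of _ "map_prod \<phi> \<psi>"] exI[of _ V] exI[of _ \<psi>] exI[of _ "U \<times> V"])
        (auto intro!: continuous_intros)
  qed
qed

lemma smooth_map_prod_std_iff:
  fixes A :: "('m::{t2_space,second_countable_topology}, 'e::finite_dim_space) chart set"
    and u :: "'v::{finite_dim_space,second_countable_topology} \<times> 'm \<Rightarrow> 'w::real_normed_vector"
  assumes A: "smooth_manifold A"
  shows "smooth_map (prod_atlas std_atlas A) std_atlas u \<longleftrightarrow>
    (\<forall>(U, \<phi>)\<in>A. smooth_on (UNIV \<times> \<phi> ` U) (\<lambda>z. u (fst z, inv_into U \<phi> (snd z))))"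
proof -
  have eqv: "smooth_on (map_prod id \<phi> ` (UNIV \<times> U)) (u \<circ> inv_into (UNIV \<times> U) (map_prod id \<phi>)) \<longleftrightarrow>
    smooth_on (UNIV \<times> \<phi> ` U) (\<lambda>z. u (fst z, inv_into U \<phi> (snd z)))" (is "?l \<longleftrightarrow> ?r")
    if "(U, \<phi>) \<in> A" for U \<phi>
  proof -
    note c = is_chartD[OF manifold_chart[OF A that]]
    have im: "map_prod id \<phi> ` (UNIV \<times> U) = (UNIV :: 'v set) \<times> \<phi> ` U"
      by (subst map_prod_image) simp
    have o: "open ((UNIV :: 'v set) \<times> \<phi> ` U)" by (intro open_Times c open_UNIV)
    have eq: "(u \<circ> inv_into (UNIV \<times> U) (map_prod id \<phi>)) z = u (fst z, inv_into U \<phi> (snd z))"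
      if "z \<in> UNIV \<times> \<phi> ` U" for z
      using that inv_into_map_prod[OF inj_on_id[of UNIV] c(3), of "fst z" "snd z"] by auto
    show ?thesis
      unfolding im
    proof
      assume "smooth_on (UNIV \<times> \<phi> ` U) (u \<circ> inv_into (UNIV \<times> U) (map_prod id \<phi>))"
      then show "smooth_on (UNIV \<times> \<phi> ` U) (\<lambda>z. u (fst z, inv_into U \<phi> (snd z)))"
        by (rule smooth_on_cong[OF o, rotated]) (rule eq)
    next
      assume "smooth_on (UNIV \<times> \<phi> ` U) (\<lambda>z. u (fst z, inv_into U \<phi> (snd z)))"
      then show "smooth_on (UNIV \<times> \<phi> ` U) (u \<circ> inv_into (UNIV \<times> U) (map_prod id \<phi>))"
        by (rule smooth_on_cong[OF o, rotated]) (rule eq[symmetric])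
    qed
  qed
  have atl: "prod_atlas std_atlas A = (\<lambda>(U, \<phi>). ((UNIV :: 'v set) \<times> U, map_prod id \<phi>)) ` A"
    by (auto simp: prod_atlas_def std_atlas_def image_iff split: prod.splits)
  show ?thesis
    unfolding smooth_map_std_iff[OF smooth_manifold_prod_atlas[OF smooth_manifold_std_atlas A]]
    unfolding atl ball_simps
  proof (rule ball_cong[OF refl], goal_cases)
    case (1 c)
    then show ?case using eqv[of "fst c" "snd c"] by (cases c) (simp only: prod.case fst_conv snd_conv)
  qed
qed

section \<open>Smooth functions and one-parameter families\<close>

definition smooth_family ::
  "('m::topological_space, 'e::real_normed_vector) chart set \<Rightarrow> (real \<Rightarrow> 'm \<Rightarrow> real) \<Rightarrow> bool" where
  "smooth_family A u \<longleftrightarrow> smooth_map (prod_atlas std_atlas A) std_atlas (\<lambda>(t, m). u t m)"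

text \<open>The derivative of g is integrated along the segment from q to x, which stays in the ball
  by convexity. The base point q is any point of the ball, not just its centre, so that the
  expansion can be used to evaluate a derivation at every nearby point.\<close>

lemma smooth_hadamard:
  fixes g :: "'e::finite_dim_space \<Rightarrow> real"
  assumes g: "smooth_on (ball c r) g" and q: "q \<in> ball c r"
    and B: "finite B" "\<And>x. x = (\<Sum>b\<in>B. (x \<bullet> b) *\<^sub>R b)"
  obtains h where "\<And>b. smooth_on (ball c r) (h b)" "\<And>b. h b q = frechet_derivative g (at q) b"
    "\<And>x. x \<in> ball c r \<Longrightarrow> g x = g q + (\<Sum>b\<in>B. ((x - q) \<bullet> b) * h b x)"
proof
  define D where "D b x = frechet_derivative g (at x) b" for b x
  define h where "h b x = integral {0..1} (\<lambda>t. D b (q + t *\<^sub>R (x - q)))" for b x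
  have D: "smooth_on (ball c r) (D b)" for b
    unfolding D_def by (rule smooth_on_frechet_derivative[OF g])
  have seg: "q + t *\<^sub>R (x - q) \<in> ball c r" if "x \<in> ball c r" "t \<in> {0..1}" for x t
  proof -
    have "(1 - t) *\<^sub>R q + t *\<^sub>R x \<in> ball c r"
      using that q by (intro convexD[OF convex_ball]) auto
    then show ?thesis by (simp add: algebra_simps)
  qed
  show "smooth_on (ball c r) (h b)" for b
  proof -
    \<comment> \<open>The open set of pairs (t, x) whose point on the line through q and x lies in
      the ball; it contains \<open>{0..1} \<times> ball c r\<close>, as
      \<open>smooth_on_integral\<close> demands.\<close>
    define W where "W = (\<lambda>z::real \<times> 'e. q + fst z *\<^sub>R (snd z - q)) -` ball c r"
    have oW: "open W"
      unfolding W_def by (intro open_vimage open_ball continuous_intros)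
    have lin: "smooth_on W (\<lambda>z. q + fst z *\<^sub>R (snd z - q))"
      by (intro smooth_on_add smooth_on_scaleR smooth_on_diff smooth_on_const smooth_on_fst smooth_on_snd oW)
    have "smooth_on W (\<lambda>z. D b (q + fst z *\<^sub>R (snd z - q)))"
      by (rule smooth_on_compose[OF oW open_ball _ lin D]) (auto simp: W_def)
    from smooth_on_integral[OF oW open_ball _ this, of 0 1 c r]
    show ?thesis using seg unfolding h_def W_def by fastforce
  qed
  show "h b q = frechet_derivative g (at q) b" for b
    by (simp add: h_def D_def)
  fix x assume x: "x \<in> ball c r"
  have int: "(\<lambda>t. D b (q + t *\<^sub>R (x - q))) integrable_on {0..1}" for b
    by (intro integrable_continuous_real continuous_on_compose2[OF smooth_on_imp_continuous_on[OF D]]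
        continuous_intros) (use seg[OF x] in auto)
  have "((\<lambda>t. \<Sum>b\<in>B. ((x - q) \<bullet> b) * D b (q + t *\<^sub>R (x - q))) has_integral
      g (q + 1 *\<^sub>R (x - q)) - g (q + 0 *\<^sub>R (x - q))) {0..1}"
  proof (rule fundamental_theorem_of_calculus)
    fix t :: real assume t: "t \<in> {0..1}"
    let ?y = "q + t *\<^sub>R (x - q)"
    have gd: "(g has_derivative frechet_derivative g (at ?y)) (at ?y)"
      using smooth_on_has_derivative[OF g] seg[OF x t] by simp
    have "((\<lambda>t. g (q + t *\<^sub>R (x - q))) has_derivative
        (\<lambda>s. frechet_derivative g (at ?y) (s *\<^sub>R (x - q)))) (at t)"
      by (rule has_derivative_compose[where f = "\<lambda>t. q + t *\<^sub>R (x - q)" and g = g, OF _ gd])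
        (auto intro!: derivative_eq_intros)
    moreover have "frechet_derivative g (at ?y) (s *\<^sub>R (x - q)) = s *\<^sub>R (\<Sum>b\<in>B. ((x - q) \<bullet> b) * D b ?y)" for s
    proof -
      have lin: "linear (frechet_derivative g (at ?y))" using gd has_derivative_linear by blast
      show ?thesis
        unfolding D_def linear_cmul[OF lin]
        by (subst B(2)[of "x - q"], subst linear_sum[OF lin]) (simp only: linear_cmul[OF lin] real_scaleR_def)
    qed
    ultimately have "((\<lambda>t. g (q + t *\<^sub>R (x - q))) has_vector_derivative
        (\<Sum>b\<in>B. ((x - q) \<bullet> b) * D b ?y)) (at t)"
      by (simp add: has_vector_derivative_def)
    then show "((\<lambda>t. g (q + t *\<^sub>R (x - q))) has_vector_derivative
        (\<Sum>b\<in>B. ((x - q) \<bullet> b) * D b ?y)) (at t within {0..1})"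
      by (rule has_vector_derivative_at_within)
  qed simp
  moreover have "((\<lambda>t. \<Sum>b\<in>B. ((x - q) \<bullet> b) * D b (q + t *\<^sub>R (x - q))) has_integral
      (\<Sum>b\<in>B. ((x - q) \<bullet> b) * h b x)) {0..1}"
    unfolding h_def by (intro has_integral_sum B(1) has_integral_mult_right integrable_integral int)
  ultimately have "g (q + 1 *\<^sub>R (x - q)) - g (q + 0 *\<^sub>R (x - q)) = (\<Sum>b\<in>B. ((x - q) \<bullet> b) * h b x)"
    using has_integral_unique by blast
  then show "g x = g q + (\<Sum>b\<in>B. ((x - q) \<bullet> b) * h b x)" by simp
qed

section \<open>Algebra of smooth functions and smooth one-parameter families\<close>

locale manifold =
  fixes A :: "('m::{t2_space,second_countable_topology}, 'e::finite_dim_space) chart set"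
  assumes A: "smooth_manifold A"
begin

abbreviation std_R :: "(real, real) chart set" where "std_R \<equiv> std_atlas"

lemmas std_R = smooth_manifold_std_atlas[where 'v = real]
lemmas RA = smooth_manifold_prod_atlas[OF std_R A]

lemma smooth_function_iff:
  "f \<in> smooth_functions A \<longleftrightarrow> (\<forall>(U, \<phi>)\<in>A. smooth_on (\<phi> ` U) (f \<circ> inv_into U \<phi>))"
  by (simp add: smooth_functions_def smooth_map_std_iff[OF A])

lemma smooth_family_iff:
  "smooth_family A u \<longleftrightarrow>
    (\<forall>(U, \<phi>)\<in>A. smooth_on (UNIV \<times> \<phi> ` U) (\<lambda>z. u (fst z) (inv_into U \<phi> (snd z))))"
  by (simp add: smooth_family_def smooth_map_prod_std_iff[OF A])

lemma smooth_function_chart: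
  "f \<in> smooth_functions A \<Longrightarrow> (U, \<phi>) \<in> A \<Longrightarrow> smooth_on (\<phi> ` U) (\<lambda>x. f (inv_into U \<phi> x))"
  by (auto simp: smooth_function_iff o_def)

lemma smooth_family_chart:
  "smooth_family A u \<Longrightarrow> (U, \<phi>) \<in> A \<Longrightarrow>
    smooth_on (UNIV \<times> \<phi> ` U) (\<lambda>z. u (fst z) (inv_into U \<phi> (snd z)))"
  by (auto simp: smooth_family_iff)

lemma chart_open: "(U, \<phi>) \<in> A \<Longrightarrow> open (\<phi> ` U)"
  using is_chartD(2) manifold_chart[OF A] by blast

lemma chart_open_Times: "(U, \<phi>) \<in> A \<Longrightarrow> open (UNIV \<times> \<phi> ` U)"
  using chart_open by (intro open_Times) auto

lemma smooth_family_const: "f \<in> smooth_functions A \<Longrightarrow> smooth_family A (\<lambda>_. f)"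
  unfolding smooth_family_def smooth_functions_def
  using smooth_map_compose[OF RA A std_R smooth_map_snd[OF std_R A], of f]
  by (simp add: case_prod_unfold)

lemma smooth_map_slice:
  assumes "smooth_family A u" "smooth_map A std_R f"
  shows "(\<lambda>m. u (f m) m) \<in> smooth_functions A"
  using smooth_map_compose[OF A RA std_R smooth_map_Pair[OF A std_R A assms(2) smooth_map_id[OF A]]
      assms(1)[unfolded smooth_family_def]]
  by (simp add: smooth_functions_def)

lemma smooth_family_slice: "smooth_family A u \<Longrightarrow> u t \<in> smooth_functions A"
  using smooth_map_slice[of u "\<lambda>_. t"] smooth_map_const[OF A std_R] by simp

lemma smooth_family_comp:
  assumes "smooth_family A u" "smooth_on UNIV f" "smooth_map (prod_atlas std_R A) A g"
  shows "smooth_family A (\<lambda>t m. u (f t) (g (t, m)))"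
proof -
  have "smooth_map (prod_atlas std_R A) std_R (\<lambda>z. f (fst z))"
    using smooth_map_compose[OF RA std_R std_R smooth_map_fst[OF std_R A]] assms(2)
    by (simp add: smooth_map_std_std_iff)
  from smooth_map_compose[OF RA RA std_R smooth_map_Pair[OF RA std_R A this assms(3)]
      assms(1)[unfolded smooth_family_def]]
  show ?thesis by (simp add: smooth_family_def case_prod_unfold)
qed

lemma smooth_family_param: "smooth_family A (\<lambda>t m. t)"
  by (auto simp: smooth_family_iff smooth_on_fst)

lemma smooth_family_add:
  "smooth_family A u \<Longrightarrow> smooth_family A v \<Longrightarrow> smooth_family A (\<lambda>t m. u t m + v t m)"
  using chart_open_Times by (fastforce simp: smooth_family_iff intro: smooth_on_add)

lemma smooth_family_mult:
  "smooth_family A u \<Longrightarrow> smooth_family A v \<Longrightarrow> smooth_family A (\<lambda>t m. u t m * v t m)"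
  using chart_open_Times by (fastforce simp: smooth_family_iff intro: smooth_on_mult)

lemma smooth_function_constI: "(\<lambda>_. c) \<in> smooth_functions A"
  by (auto simp: smooth_function_iff o_def smooth_on_const)

lemma smooth_function_add:
  "f \<in> smooth_functions A \<Longrightarrow> g \<in> smooth_functions A \<Longrightarrow> (\<lambda>m. f m + g m) \<in> smooth_functions A"
  using smooth_family_slice[OF smooth_family_add[OF smooth_family_const smooth_family_const]] by simp

lemma smooth_function_mult:
  "f \<in> smooth_functions A \<Longrightarrow> g \<in> smooth_functions A \<Longrightarrow> (\<lambda>m. f m * g m) \<in> smooth_functions A"
  using smooth_family_slice[OF smooth_family_mult[OF smooth_family_const smooth_family_const]] by simp

lemma smooth_function_cmult:
  "f \<in> smooth_functions A \<Longrightarrow> (\<lambda>m. c * f m) \<in> smooth_functions A"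
  using smooth_function_mult[OF smooth_function_constI] .

lemma smooth_function_diff:
  "f \<in> smooth_functions A \<Longrightarrow> g \<in> smooth_functions A \<Longrightarrow> (\<lambda>m. f m - g m) \<in> smooth_functions A"
  using smooth_function_add[OF _ smooth_function_cmult[of g "-1"]] by simp

lemma smooth_function_sum:
  "(\<And>i. i \<in> I \<Longrightarrow> f i \<in> smooth_functions A) \<Longrightarrow> (\<lambda>m. \<Sum>i\<in>I. f i m) \<in> smooth_functions A"
  by (induction I rule: infinite_finite_induct) (simp_all add: smooth_function_constI smooth_function_add)

lemma smooth_family_cmult: "smooth_family A u \<Longrightarrow> smooth_family A (\<lambda>t m. c * u t m)"
  using smooth_family_mult[OF smooth_family_const[OF smooth_function_constI]] by simp

lemma smooth_family_sum:
  "(\<And>i. i \<in> I \<Longrightarrow> smooth_family A (u i)) \<Longrightarrow> smooth_family A (\<lambda>t m. \<Sum>i\<in>I. u i t m)"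
  by (induction I rule: infinite_finite_induct)
    (simp_all add: smooth_family_const[OF smooth_function_constI] smooth_family_add)

lemma smooth_family_integral:
  assumes "smooth_family A u"
  shows "(\<lambda>m. integral {a..b} (\<lambda>t. u t m)) \<in> smooth_functions A"
proof -
  have "smooth_on (\<phi> ` U) (\<lambda>x. integral {a..b} (\<lambda>t. u (fst (t, x)) (inv_into U \<phi> (snd (t, x)))))"
    if "(U, \<phi>) \<in> A" for U \<phi>
    by (rule smooth_on_integral[OF chart_open_Times[OF that] chart_open[OF that] _
          smooth_family_chart[OF assms that]]) auto
  then show ?thesis by (auto simp: smooth_function_iff o_def)
qed

subsection \<open>Differentiation in the parameter\<close>

text \<open>In a chart, the parameter derivative is the Frechet derivative of the joint expression
  in the direction \<open>(1, 0)\<close>, which is again jointly smooth.\<close>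

lemma
  assumes u: "smooth_family A u"
  shows smooth_family_deriv: "smooth_family A (\<lambda>t m. deriv (\<lambda>t. u t m) t)"
    and smooth_family_has_deriv: "((\<lambda>t. u t m) has_real_derivative deriv (\<lambda>t. u t m) t) (at t)"
proof -
  have *: "((\<lambda>t. u t (inv_into U \<phi> x)) has_real_derivative
      frechet_derivative (\<lambda>z. u (fst z) (inv_into U \<phi> (snd z))) (at (t, x)) (1, 0)) (at t)"
    if U: "(U, \<phi>) \<in> A" and x: "x \<in> \<phi> ` U" for U \<phi> x t
  proof -
    let ?u = "\<lambda>z. u (fst z) (inv_into U \<phi> (snd z))"
    have ud: "(?u has_derivative frechet_derivative ?u (at (t, x))) (at (t, x))"
      using smooth_on_has_derivative[OF smooth_family_chart[OF u U]] x by auto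
    have "((\<lambda>t. ?u (t, x)) has_derivative (\<lambda>s. frechet_derivative ?u (at (t, x)) (s, 0))) (at t)"
      by (rule has_derivative_compose[where f = "\<lambda>t. (t, x)" and g = ?u, OF _ ud])
        (auto intro!: derivative_eq_intros)
    moreover have "(\<lambda>s. frechet_derivative ?u (at (t, x)) (s, 0)) = (*) (frechet_derivative ?u (at (t, x)) (1, 0))"
    proof
      fix s
      show "frechet_derivative ?u (at (t, x)) (s, 0) = frechet_derivative ?u (at (t, x)) (1, 0) * s"
        using linear_cmul[OF has_derivative_linear[OF ud], of s "(1, 0)"] by (simp add: mult.commute)
    qed
    ultimately have "((\<lambda>t. ?u (t, x)) has_derivative (*) (frechet_derivative ?u (at (t, x)) (1, 0))) (at t)"
      by (rule has_derivative_eq_rhs)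
    then show ?thesis by (simp add: has_field_derivative_def)
  qed
  show "((\<lambda>t. u t m) has_real_derivative deriv (\<lambda>t. u t m) t) (at t)"
  proof -
    obtain U \<phi> where U: "(U, \<phi>) \<in> A" "m \<in> U" by (rule manifold_chart_at[OF A])
    have "inv_into U \<phi> (\<phi> m) = m"
      using U is_chartD(3)[OF manifold_chart[OF A U(1)]] by simp
    then have "((\<lambda>t. u t m) has_real_derivative
        frechet_derivative (\<lambda>z. u (fst z) (inv_into U \<phi> (snd z))) (at (t, \<phi> m)) (1, 0)) (at t)"
      using *[OF U(1) imageI[OF U(2)], of t] by simp
    then show ?thesis using DERIV_imp_deriv by metis
  qed
  show "smooth_family A (\<lambda>t m. deriv (\<lambda>t. u t m) t)"
    unfolding smooth_family_iff
  proof clarify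
    fix U \<phi> assume U: "(U, \<phi>) \<in> A"
    show "smooth_on (UNIV \<times> \<phi> ` U) (\<lambda>z. deriv (\<lambda>t. u t (inv_into U \<phi> (snd z))) (fst z))"
      by (rule smooth_on_cong[OF chart_open_Times[OF U] _
            smooth_on_frechet_derivative[OF smooth_family_chart[OF u U], of "(1, 0)"]])
        (use DERIV_imp_deriv[OF *[OF U]] in auto)
  qed
qed

text \<open>The difference quotient in the parameter extends through s = 0 as a smooth family v.
  This allows an operator to be applied to the quotient and the limit to be taken afterwards,
  without any topology on functions.\<close>

lemma smooth_family_hadamard:
  assumes u: "smooth_family A u"
  obtains v where "smooth_family A v" "\<And>s m. u (\<tau> + s) m = u \<tau> m + s * v s m"
    "\<And>m. v 0 m = deriv (\<lambda>t. u t m) \<tau>"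
proof
  define D where "D t m = deriv (\<lambda>t. u t m) t" for t m
  define v where "v s m = integral {0..1} (\<lambda>r. D (\<tau> + r * s) m)" for s m
  have D: "smooth_family A D"
    using smooth_family_deriv[OF u] unfolding D_def .
  have Dd: "((\<lambda>t. u t m) has_real_derivative D t m) (at t)" for t m
    unfolding D_def by (rule smooth_family_has_deriv[OF u])
  show "smooth_family A v"
    unfolding smooth_family_iff
  proof clarify
    fix U \<phi> assume U: "(U, \<phi>) \<in> A"
    \<comment> \<open>Three variables: the integration variable r first, where
      \<open>smooth_on_integral\<close> expects it, then s and the coordinates.\<close>
    let ?W = "(UNIV :: real set) \<times> (UNIV :: real set) \<times> \<phi> ` U"
    have oW: "open ?W" by (intro open_Times open_UNIV chart_open[OF U])
    have "smooth_on ?W (\<lambda>z. fst (snd z))" "smooth_on ?W (\<lambda>z. snd (snd z))"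
      by (rule smooth_on_compose[OF oW open_UNIV _ smooth_on_snd smooth_on_fst], simp)
        (rule smooth_on_compose[OF oW open_UNIV _ smooth_on_snd smooth_on_snd], simp)
    then have lin: "smooth_on ?W (\<lambda>z. (\<tau> + fst z * fst (snd z), snd (snd z)))"
      by (intro smooth_on_Pair smooth_on_add smooth_on_mult smooth_on_const smooth_on_fst oW)
    have "smooth_on ?W (\<lambda>z. D (fst (\<tau> + fst z * fst (snd z), snd (snd z)))
        (inv_into U \<phi> (snd (\<tau> + fst z * fst (snd z), snd (snd z)))))"
      by (rule smooth_on_compose[OF oW chart_open_Times[OF U] _ lin smooth_family_chart[OF D U]]) auto
    from smooth_on_integral[OF oW chart_open_Times[OF U] _ this, of 0 1]
    show "smooth_on (UNIV \<times> \<phi> ` U) (\<lambda>z. v (fst z) (inv_into U \<phi> (snd z)))"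
      by (auto simp: v_def)
  qed
  show "v 0 m = deriv (\<lambda>t. u t m) \<tau>" for m
    by (simp add: v_def D_def)
  show "u (\<tau> + s) m = u \<tau> m + s * v s m" for s m
  proof -
    have "((\<lambda>r. D (\<tau> + r * s) m * s) has_integral u (\<tau> + 1 * s) m - u (\<tau> + 0 * s) m) {0..1}"
    proof (rule fundamental_theorem_of_calculus)
      fix r :: real assume "r \<in> {0..1}"
      have "((\<lambda>r. u (\<tau> + r * s) m) has_real_derivative D (\<tau> + r * s) m * s) (at r)"
        by (rule DERIV_chain2[OF Dd]) (auto intro!: derivative_eq_intros)
      then show "((\<lambda>r. u (\<tau> + r * s) m) has_vector_derivative D (\<tau> + r * s) m * s) (at r within {0..1})"
        unfolding has_real_derivative_iff_has_vector_derivative by (rule has_vector_derivative_at_within)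
    qed simp
    from integral_unique[OF this]
    have "integral {0..1} (\<lambda>r. D (\<tau> + r * s) m * s) = u (\<tau> + s) m - u \<tau> m"
      by simp
    then show ?thesis by (simp add: v_def mult.commute)
  qed
qed

subsection \<open>Vector fields in coordinates\<close>

text \<open>Two open sets cover the manifold: the part N of the chart over the large ball, where the
  function is a product of smooth functions, and the complement of K, where it is zero. K is
  compact, hence closed by the Hausdorff property; the gap between r' and r puts the closed small
  ball inside the domain of g.\<close>

lemma smooth_extension_by_zero:
  assumes U: "(U, \<phi>) \<in> A" and b: "ball c r \<subseteq> \<phi> ` U" and r: "r' < r"
    and h: "smooth_on UNIV h" "\<And>x. h x \<noteq> 0 \<longleftrightarrow> x \<in> ball c r'"
    and g: "smooth_on (ball c r) g"
  shows "(\<lambda>m. if m \<in> U then h (\<phi> m) * g (\<phi> m) else 0) \<in> smooth_functions A"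
    (is "?f \<in> _")
proof -
  note cU = is_chartD[OF manifold_chart[OF A U]]
  have inv: "inv_into U \<phi> (\<phi> q) = q" if "q \<in> U" for q using that cU(3) by simp
  define K where "K = inv_into U \<phi> ` cball c r'"
  have "cball c r' \<subseteq> \<phi> ` U" using b r by (auto simp: subset_iff)
  then have "compact K"
    unfolding K_def by (intro compact_continuous_image continuous_on_subset[OF cU(5)] compact_cball)
  then have cK: "open (- K)" using compact_imp_closed by blast
  have zero: "?f q = 0" if "q \<in> - K" for q
  proof -
    have "\<phi> q \<notin> cball c r'" if "q \<in> U"
      using \<open>q \<in> - K\<close> inv[OF that] unfolding K_def by force
    then show ?thesis using h(2)[of "\<phi> q"] by (auto simp: mem_ball)
  qed
  define N where "N = U \<inter> \<phi> -` ball c r"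
  have oN: "open N"
    unfolding N_def using continuous_on_open_vimage[OF cU(1)] cU(4) open_ball by (metis Int_commute)
  have N: "\<phi> ` N \<subseteq> ball c r" by (auto simp: N_def)
  have oN': "open (\<phi> ` N)"
    by (rule chart_open_image[OF manifold_chart[OF A U] oN]) (simp add: N_def)
  have smN: "smooth_on (\<phi> ` N) (\<lambda>x. ?f (inv_into U \<phi> x))"
    by (rule smooth_on_cong[OF oN' _ smooth_on_mult[OF oN' smooth_on_subset[OF h(1)] smooth_on_subset[OF g N]]])
      (auto simp: N_def inv)
  show ?thesis
    unfolding smooth_functions_def mem_Collect_eq
  proof (rule smooth_mapI_local[OF A std_R])
    fix p
    show "\<exists>U \<phi> V \<psi> N. (U, \<phi>) \<in> A \<and> (V, \<psi>) \<in> std_R \<and> open N \<and> p \<in> N \<and> N \<subseteq> U \<and>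
      ?f ` N \<subseteq> V \<and> continuous_on N ?f \<and> smooth_on (\<phi> ` N) (\<psi> \<circ> ?f \<circ> inv_into U \<phi>)"
    proof (cases "p \<in> N")
      case True
      have "continuous_on N (\<lambda>q. ?f (inv_into U \<phi> (\<phi> q)))"
        by (rule continuous_on_compose2[OF smooth_on_imp_continuous_on[OF smN] continuous_on_subset[OF cU(4)]])
          (auto simp: N_def)
      then have "continuous_on N ?f"
        by (rule continuous_on_eq) (auto simp: N_def inv)
      then show ?thesis
        using True oN U smN
        by (intro exI[of _ U] exI[of _ \<phi>] exI[of _ UNIV] exI[of _ id] exI[of _ N])
          (auto simp: N_def std_atlas_def o_def)
    next
      case False
      have "p \<in> - K"
      proof
        assume "p \<in> K"
        then obtain x where x: "x \<in> cball c r'" "p = inv_into U \<phi> x" by (auto simp: K_def)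
        then have "x \<in> \<phi> ` U" "x \<in> ball c r" using b r by (auto simp: subset_iff)
        then have "p \<in> N" using x by (auto simp: N_def inv_into_into f_inv_into_f)
        then show False using False by simp
      qed
      obtain V \<psi> where V: "(V, \<psi>) \<in> A" "p \<in> V" by (rule manifold_chart_at[OF A])
      note cV = is_chartD[OF manifold_chart[OF A V(1)]]
      define N' where "N' = V \<inter> - K"
      have oN2: "open N'" unfolding N'_def using cV(1) cK by blast
      have oN2': "open (\<psi> ` N')"
        by (rule chart_open_image[OF manifold_chart[OF A V(1)] oN2]) (simp add: N'_def)
      have invV: "inv_into V \<psi> (\<psi> q) = q" if "q \<in> N'" for q using that cV(3) by (simp add: N'_def)
      have zN': "?f q = 0" if "q \<in> N'" for q using zero that by (simp add: N'_def)
      have "smooth_on (\<psi> ` N') (\<lambda>x. ?f (inv_into V \<psi> x))"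
        by (rule smooth_on_cong[OF oN2' _ smooth_on_const[of _ 0]]) (use invV zN' in force)
      moreover have "continuous_on N' ?f"
        by (rule continuous_on_eq[OF continuous_on_const[of _ 0]]) (use zN' in force)
      ultimately show ?thesis
        using V \<open>p \<in> - K\<close> oN2
        by (intro exI[of _ V] exI[of _ \<psi>] exI[of _ UNIV] exI[of _ id] exI[of _ N'])
          (auto simp: N'_def std_atlas_def o_def)
    qed
  qed
qed

end

text \<open>Partial derivatives alone do not give a derivative along the diagonal; joint smoothness
  gives a total derivative, whose value on (1, 1) is the sum. The typical use is an operator and its
  argument that depend on the same parameter.\<close>

lemma has_real_derivative_diagonal:
  fixes K :: "real \<times> real \<Rightarrow> real"
  assumes K: "smooth_on UNIV K"
    and a: "((\<lambda>s. K (s, t)) has_real_derivative a) (at t)"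
    and b: "((\<lambda>s. K (t, s)) has_real_derivative b) (at t)"
  shows "((\<lambda>s. K (s, s)) has_real_derivative a + b) (at t)"
proof -
  define D where "D = frechet_derivative K (at (t, t))"
  have KD: "(K has_derivative D) (at (t, t))"
    unfolding D_def using smooth_on_has_derivative[OF K] by simp
  have lin: "linear D" using KD has_derivative_linear by blast
  have "((\<lambda>s. K (s, t)) has_derivative (\<lambda>h. D (h, 0))) (at t)"
    by (rule has_derivative_compose[where f = "\<lambda>s. (s, t)" and g = K, OF _ KD])
      (auto intro!: derivative_eq_intros)
  then have "(\<lambda>h. D (h, 0)) = (*) a"
    using a has_derivative_unique unfolding has_field_derivative_def by blast
  then have 1: "D (h, 0) = a * h" for h by metis
  have "((\<lambda>s. K (t, s)) has_derivative (\<lambda>h. D (0, h))) (at t)"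
    by (rule has_derivative_compose[where f = "\<lambda>s. (t, s)" and g = K, OF _ KD])
      (auto intro!: derivative_eq_intros)
  then have "(\<lambda>h. D (0, h)) = (*) b"
    using b has_derivative_unique unfolding has_field_derivative_def by blast
  then have 2: "D (0, h) = b * h" for h by metis
  have "D (h, h) = (a + b) * h" for h
    using linear_add[OF lin, of "(h, 0)" "(0, h)"] 1 2 by (simp add: distrib_right)
  then have "(\<lambda>h. D (h, h)) = (*) (a + b)" by auto
  moreover have "((\<lambda>s. K (s, s)) has_derivative (\<lambda>h. D (h, h))) (at t)"
    by (rule has_derivative_compose[where f = "\<lambda>s. (s, s)" and g = K, OF _ KD])
      (auto intro!: derivative_eq_intros)
  ultimately show ?thesis unfolding has_field_derivative_def by metis
qed

context manifold
begin

subsection \<open>Vector fields\<close>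

lemma vector_field_smooth: "X \<in> vector_fields A \<Longrightarrow> f \<in> smooth_functions A \<Longrightarrow> X f \<in> smooth_functions A"
  unfolding vector_fields_def by blast

lemma vector_field_nonsmooth: "X \<in> vector_fields A \<Longrightarrow> f \<notin> smooth_functions A \<Longrightarrow> X f = (\<lambda>_. 0)"
  unfolding vector_fields_def by blast

lemma vector_field_linear:
  "X \<in> vector_fields A \<Longrightarrow> f \<in> smooth_functions A \<Longrightarrow> g \<in> smooth_functions A \<Longrightarrow>
    X (\<lambda>x. a * f x + b * g x) m = a * X f m + b * X g m"
  unfolding vector_fields_def by blast

lemma vector_field_mult:
  "X \<in> vector_fields A \<Longrightarrow> f \<in> smooth_functions A \<Longrightarrow> g \<in> smooth_functions A \<Longrightarrow>
    X (\<lambda>x. f x * g x) m = f m * X g m + g m * X f m"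
  unfolding vector_fields_def by blast

lemma vector_field_0: "X \<in> vector_fields A \<Longrightarrow> X (\<lambda>_. 0) m = 0"
  using vector_field_linear[of X "\<lambda>_. 0" "\<lambda>_. 0" 0 0 m] smooth_function_constI by simp

lemma vector_field_add:
  "X \<in> vector_fields A \<Longrightarrow> f \<in> smooth_functions A \<Longrightarrow> g \<in> smooth_functions A \<Longrightarrow>
    X (\<lambda>x. f x + g x) m = X f m + X g m"
  using vector_field_linear[of X f g 1 1 m] by simp

lemma vector_field_cmult:
  "X \<in> vector_fields A \<Longrightarrow> f \<in> smooth_functions A \<Longrightarrow> X (\<lambda>x. c * f x) m = c * X f m"
  using vector_field_linear[of X f f c 0 m] by simp

lemma vector_field_sum:
  assumes X: "X \<in> vector_fields A" and f: "\<And>i. i \<in> I \<Longrightarrow> f i \<in> smooth_functions A"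
  shows "X (\<lambda>x. \<Sum>i\<in>I. f i x) m = (\<Sum>i\<in>I. X (f i) m)"
  using f
  by (induction I rule: infinite_finite_induct)
    (simp_all add: vector_field_0[OF X] vector_field_add[OF X] smooth_function_sum)

text \<open>
  With a cutoff h supported near p and nonzero on a ball around p, Hadamard's lemma gives
  \<open>h\<^sup>2 f = f(q) h\<^sup>2 + \<Sum>\<^sub>b (h x\<^sub>b - q\<^sub>b h) (h g\<^sub>b)\<close> as an identity of global smooth functions;
  applying X at q yields the coordinate expression.
\<close>

lemma vector_field_local_form:
  assumes X: "X \<in> vector_fields A" and U: "(U, \<phi>) \<in> A" and p: "p \<in> U"
  obtains r B a where "r > 0" "finite B" "ball (\<phi> p) r \<subseteq> \<phi> ` U"
    "\<And>b. smooth_on (ball (\<phi> p) r) (a b)"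
    "\<And>f x. f \<in> smooth_functions A \<Longrightarrow> x \<in> ball (\<phi> p) r \<Longrightarrow>
      X f (inv_into U \<phi> x) = (\<Sum>b\<in>B. a b x * frechet_derivative (\<lambda>x. f (inv_into U \<phi> x)) (at x) b)"
proof -
  define c where "c = \<phi> p"
  note cU = is_chartD[OF manifold_chart[OF A U]]
  obtain r where r: "r > 0" "ball c r \<subseteq> \<phi> ` U"
    using chart_open[OF U] p open_contains_ball unfolding c_def by blast
  define r' where "r' = r / 2"
  have r': "0 < r'" "r' < r" using r by (simp_all add: r'_def)
  then have sub: "ball c r' \<subseteq> ball c r" by (simp add: subset_ball)
  obtain h :: "'e \<Rightarrow> real" where h: "smooth_on UNIV h" "\<And>x. h x \<noteq> 0 \<longleftrightarrow> x \<in> ball c r'"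
    using smooth_bump[OF r'(1)] by metis
  obtain B :: "'e set" where B: "finite B" "\<And>x. x = (\<Sum>b\<in>B. (x \<bullet> b) *\<^sub>R b)"
    by (rule orthonormal_spanning_set) blast
  define ext where "ext g m = (if m \<in> U then h (\<phi> m) * g (\<phi> m) else 0)" for g :: "'e \<Rightarrow> real" and m
  have ext: "ext g \<in> smooth_functions A" if "smooth_on (ball c r) g" for g
    unfolding ext_def by (rule smooth_extension_by_zero[OF U r(2) r'(2) h that])
  \<comment> \<open>By the product rule X(h x_b) - x_b X(h) = h X(x_b). Thus \<open>a b\<close> is
    the component of X along b, written with functions defined on the whole manifold.\<close>
  define a where "a b x = (X (ext (\<lambda>x. x \<bullet> b)) (inv_into U \<phi> x)
      - (x \<bullet> b) * X (ext (\<lambda>_. 1)) (inv_into U \<phi> x)) * inverse (h x)" for b x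
  have C: "ext (\<lambda>x. x \<bullet> b) \<in> smooth_functions A" "ext (\<lambda>_. 1) \<in> smooth_functions A" for b
    by (auto intro!: ext smooth_on_inner smooth_on_id smooth_on_const)
  show ?thesis
  proof (rule that[of r' B a])
    show "smooth_on (ball (\<phi> p) r') (a b)" for b
      unfolding a_def c_def[symmetric]
      by (intro smooth_on_mult smooth_on_diff smooth_on_inner smooth_on_id smooth_on_const
          smooth_on_inverse smooth_on_subset[OF smooth_function_chart[OF vector_field_smooth[OF X C(1)] U]]
          smooth_on_subset[OF smooth_function_chart[OF vector_field_smooth[OF X C(2)] U]]
          smooth_on_subset[OF h(1)] open_ball)
        (use h(2) sub r(2) in auto)
  next
    fix f x assume f: "f \<in> smooth_functions A" and x': "x \<in> ball (\<phi> p) r'"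
    define q where "q = inv_into U \<phi> x"
    have x: "x \<in> ball c r" "h x \<noteq> 0" using x' sub h(2) by (auto simp: c_def)
    have q: "q \<in> U" "\<phi> q = x"
      using x r(2) by (auto simp: q_def inv_into_into f_inv_into_f subset_iff)
    let ?f = "\<lambda>x. f (inv_into U \<phi> x)"
    have sf: "smooth_on (ball c r) ?f"
      by (rule smooth_on_subset[OF smooth_function_chart[OF f U] r(2)])
    obtain g where g: "\<And>b. smooth_on (ball c r) (g b)" "\<And>b. g b x = frechet_derivative ?f (at x) b"
      "\<And>y. y \<in> ball c r \<Longrightarrow> ?f y = ?f x + (\<Sum>b\<in>B. ((y - x) \<bullet> b) * g b y)"
      using smooth_hadamard[OF sf x(1) B] by blast
    define k where "k = ext (\<lambda>_. 1)"
    define y where "y b = ext (\<lambda>x. x \<bullet> b)" for b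
    define z where "z b = ext (g b)" for b
    have sm: "k \<in> smooth_functions A" "y b \<in> smooth_functions A" "z b \<in> smooth_functions A" for b
      using C ext[OF g(1)] by (simp_all add: k_def y_def z_def)
    \<comment> \<open>The cut-off coordinate difference h (x_b - q_b). It vanishes at q, so the
      product rule for \<open>w b * z b\<close> at q leaves only the term in which X differentiates
      \<open>w b\<close>.\<close>
    define w where "w b m = 1 * y b m + (- (x \<bullet> b)) * k m" for b m
    have smw: "w b \<in> smooth_functions A" for b
      unfolding w_def by (intro smooth_function_add smooth_function_cmult sm)
    have id: "(k m * k m) * f m = f q * (k m * k m) + (\<Sum>b\<in>B. w b m * z b m)" for m
    proof (cases "m \<in> U \<and> \<phi> m \<in> ball c r'")
      case True
      then have "f m = f q + (\<Sum>b\<in>B. ((\<phi> m - x) \<bullet> b) * g b (\<phi> m))"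
        using g(3)[of "\<phi> m"] sub cU(3) by (auto simp: q_def)
      then show ?thesis
        using True by (simp add: k_def w_def y_def z_def ext_def inner_diff_left sum_distrib_left
            algebra_simps)
    next
      case False
      then have "ext g m = 0" for g using h(2)[of "\<phi> m"] by (auto simp: ext_def)
      then show ?thesis by (simp add: k_def z_def)
    qed
    have kq: "k q = h x" "z b q = h x * g b x" "w b q = 0" for b
      using q by (simp_all add: k_def z_def w_def y_def ext_def)
    have "X (\<lambda>m. (k m * k m) * f m) q = (k q * k q) * X f q + f q * (2 * k q * X k q)"
      using vector_field_mult[OF X smooth_function_mult[OF sm(1) sm(1)] f, of q]
        vector_field_mult[OF X sm(1) sm(1), of q] by simp
    moreover have "X (\<lambda>m. (k m * k m) * f m) q = f q * (2 * k q * X k q) + (\<Sum>b\<in>B. z b q * X (w b) q)"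
    proof -
      have "X (\<lambda>m. (k m * k m) * f m) q = X (\<lambda>m. f q * (k m * k m) + (\<Sum>b\<in>B. w b m * z b m)) q"
        by (subst id) (rule refl)
      also have "\<dots> = X (\<lambda>m. f q * (k m * k m)) q + X (\<lambda>m. \<Sum>b\<in>B. w b m * z b m) q"
        by (intro vector_field_add[OF X] smooth_function_cmult smooth_function_mult smooth_function_sum sm smw)
      also have "X (\<lambda>m. f q * (k m * k m)) q = f q * (2 * k q * X k q)"
        using vector_field_cmult[OF X smooth_function_mult[OF sm(1) sm(1)], of "f q" q]
          vector_field_mult[OF X sm(1) sm(1), of q] by simp
      also have "X (\<lambda>m. \<Sum>b\<in>B. w b m * z b m) q = (\<Sum>b\<in>B. X (\<lambda>m. w b m * z b m) q)"
        by (intro vector_field_sum[OF X] smooth_function_mult sm smw)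
      also have "\<dots> = (\<Sum>b\<in>B. z b q * X (w b) q)"
        using vector_field_mult[OF X smw sm(3)] kq by simp
      finally show ?thesis .
    qed
    moreover have "X (w b) q = a b x * h x" for b
      using vector_field_linear[OF X sm(2) sm(1), of 1 b "- (x \<bullet> b)" q] x(2)
      by (simp add: w_def[abs_def] a_def q_def[symmetric] k_def y_def)
    ultimately have "h x * h x * X f q = h x * h x * (\<Sum>b\<in>B. a b x * g b x)"
      by (simp add: kq sum_distrib_left algebra_simps)
    then show "X f (inv_into U \<phi> x) = (\<Sum>b\<in>B. a b x * frechet_derivative ?f (at x) b)"
      using x(2) by (simp add: q_def g(2))
  qed (use r' r sub B in \<open>auto simp: c_def\<close>)
qed

text \<open>The definition of a derivation says nothing about how \<open>X (u t)\<close> varies with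
  t. The local form expresses it by smooth coefficients and the derivatives of the joint expression
  of u in the directions \<open>(0, b)\<close>, all of them jointly smooth.\<close>

lemma vector_field_family:
  assumes X: "X \<in> vector_fields A" and u: "smooth_family A u"
  shows "smooth_family A (\<lambda>t. X (u t))"
  unfolding smooth_family_iff
proof clarify
  fix U \<phi> assume U: "(U, \<phi>) \<in> A"
  show "smooth_on (UNIV \<times> \<phi> ` U) (\<lambda>z. X (u (fst z)) (inv_into U \<phi> (snd z)))"
  proof (rule smooth_on_local)
    fix z :: "real \<times> 'e" assume "z \<in> UNIV \<times> \<phi> ` U"
    then obtain p where p: "p \<in> U" "snd z = \<phi> p" by auto
    obtain r B a where l: "r > 0" "finite B" "ball (\<phi> p) r \<subseteq> \<phi> ` U"
      "\<And>b. smooth_on (ball (\<phi> p) r) (a b)"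
      "\<And>f x. f \<in> smooth_functions A \<Longrightarrow> x \<in> ball (\<phi> p) r \<Longrightarrow>
        X f (inv_into U \<phi> x) = (\<Sum>b\<in>B. a b x * frechet_derivative (\<lambda>x. f (inv_into U \<phi> x)) (at x) b)"
    proof (rule vector_field_local_form[OF X U p(1)], goal_cases)
      case (1 r B a)
      from 1(1)[OF 1(2-6)] show ?case .
    qed
    let ?S = "(UNIV :: real set) \<times> ball (\<phi> p) r"
    have oS: "open ?S" by (intro open_Times open_UNIV open_ball)
    let ?u = "\<lambda>z. u (fst z) (inv_into U \<phi> (snd z))"
    have su: "smooth_on ?S ?u"
      by (rule smooth_on_subset[OF smooth_family_chart[OF u U]]) (use l(3) in auto)
    have "smooth_on ?S (\<lambda>z. a b (snd z))" for b
      by (rule smooth_on_compose[OF oS open_ball _ smooth_on_snd l(4)]) auto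
    then have "smooth_on ?S (\<lambda>z. \<Sum>b\<in>B. a b (snd z) * frechet_derivative ?u (at z) (0, b))"
      by (intro smooth_on_sum smooth_on_mult smooth_on_frechet_derivative[OF su] oS)
    then have "smooth_on ?S (\<lambda>z. X (u (fst z)) (inv_into U \<phi> (snd z)))"
    proof (rule smooth_on_cong[OF oS, rotated])
      fix z assume z: "z \<in> ?S"
      obtain t x where tx: "z = (t, x)" by (cases z)
      have ud: "(?u has_derivative frechet_derivative ?u (at (t, x))) (at (t, x))"
        using smooth_on_has_derivative[OF su z] tx by simp
      have "((\<lambda>x. ?u (t, x)) has_derivative (\<lambda>b. frechet_derivative ?u (at (t, x)) (0, b))) (at x)"
        by (rule has_derivative_compose[where f = "\<lambda>x. (t, x)" and g = ?u, OF _ ud])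
          (auto intro!: derivative_eq_intros)
      from frechet_derivative_at[OF this]
      have "frechet_derivative (\<lambda>x. u t (inv_into U \<phi> x)) (at x) b = frechet_derivative ?u (at (t, x)) (0, b)" for b
        by (simp add: fun_eq_iff)
      then show "(\<Sum>b\<in>B. a b (snd z) * frechet_derivative ?u (at z) (0, b)) = X (u (fst z)) (inv_into U \<phi> (snd z))"
        using l(5)[OF smooth_family_slice[OF u], of x t] z tx by simp
    qed
    moreover have "z \<in> ?S" using p l(1) by (simp add: mem_Times_iff)
    ultimately show "\<exists>T. open T \<and> z \<in> T \<and> smooth_on T (\<lambda>z. X (u (fst z)) (inv_into U \<phi> (snd z)))"
      using oS by blast
  qed
qed

subsection \<open>Operators preserving smooth families\<close>

text \<open>Preserving smooth families takes the place of continuity: it survives composition and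
  suffices for differentiating through the operator. Unlike the Leibniz rule, it is shared by vector
  fields, exponentials of series and coefficients of the formal flow.\<close>

definition smooth_operator :: "(('m \<Rightarrow> real) \<Rightarrow> 'm \<Rightarrow> real) \<Rightarrow> bool" where
  "smooth_operator L \<longleftrightarrow>
     (\<forall>f\<in>smooth_functions A. \<forall>g\<in>smooth_functions A. \<forall>a b m.
        L (\<lambda>x. a * f x + b * g x) m = a * L f m + b * L g m) \<and>
     (\<forall>u. smooth_family A u \<longrightarrow> smooth_family A (\<lambda>t. L (u t)))"

lemma smooth_operator_linear:
  "smooth_operator L \<Longrightarrow> f \<in> smooth_functions A \<Longrightarrow> g \<in> smooth_functions A \<Longrightarrow>
    L (\<lambda>x. a * f x + b * g x) m = a * L f m + b * L g m"
  by (simp add: smooth_operator_def)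

lemma smooth_operator_family:
  "smooth_operator L \<Longrightarrow> smooth_family A u \<Longrightarrow> smooth_family A (\<lambda>t. L (u t))"
  by (simp add: smooth_operator_def)

lemma smooth_operator_smooth:
  "smooth_operator L \<Longrightarrow> f \<in> smooth_functions A \<Longrightarrow> L f \<in> smooth_functions A"
  using smooth_family_slice[OF smooth_operator_family[OF _ smooth_family_const]] by simp

lemma smooth_operator_vector_field: "X \<in> vector_fields A \<Longrightarrow> smooth_operator X"
  using vector_field_linear vector_field_family by (simp add: smooth_operator_def)

text \<open>By linearity L turns the Hadamard quotient v of u into the difference quotient of
  \<open>L (u t)\<close>. As \<open>L (v s)\<close> is again a smooth family it is continuous at s =
  0, and its value there is the claimed derivative.\<close>

lemma smooth_operator_has_derivative:
  assumes L: "smooth_operator L" and u: "smooth_family A u"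
  shows "((\<lambda>t. L (u t) m) has_real_derivative L (\<lambda>m. deriv (\<lambda>t. u t m) t) m) (at t)"
proof -
  obtain v where v: "smooth_family A v" "\<And>s m. u (t + s) m = u t m + s * v s m"
    "\<And>m. v 0 m = deriv (\<lambda>t. u t m) t"
    using smooth_family_hadamard[OF u] by metis
  have "L (u (t + s)) m = L (u t) m + s * L (v s) m" for s
  proof -
    have "u (t + s) = (\<lambda>m. 1 * u t m + s * v s m)" using v(2) by auto
    then show ?thesis
      using smooth_operator_linear[OF L smooth_family_slice[OF u] smooth_family_slice[OF v(1)], of 1 t s s m]
      by simp
  qed
  then have quot: "(L (u (t + s)) m - L (u t) m) / s = L (v s) m" if "s \<noteq> 0" for s
    using that by simp
  have "isCont (\<lambda>s. L (v s) m) 0"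
    using smooth_family_has_deriv[OF smooth_operator_family[OF L v(1)]] DERIV_isCont by blast
  then have "((\<lambda>s. L (v s) m) \<longlongrightarrow> L (v 0) m) (at 0)" by (simp add: isCont_def)
  then have "((\<lambda>s. (L (u (t + s)) m - L (u t) m) / s) \<longlongrightarrow> L (v 0) m) (at 0)"
    by (rule Lim_transform_eventually) (auto simp: eventually_at_filter quot)
  moreover have "v 0 = (\<lambda>m. deriv (\<lambda>t. u t m) t)" using v(3) by auto
  ultimately show ?thesis by (simp add: DERIV_def)
qed

end

section \<open>Averaging along a circle action\<close>

locale circle_manifold = manifold A
  for A :: "('m::{t2_space,second_countable_topology}, 'e::finite_dim_space) chart set" +
  fixes \<Phi> :: "real \<Rightarrow> 'm \<Rightarrow> 'm"
  assumes action: "circle_action A \<Phi>"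
begin

abbreviation R0 :: "'m vfield" where "R0 \<equiv> infinitesimal_generator A \<Phi>"

lemma flow_0 [simp]: "\<Phi> 0 m = m"
  and flow_add: "\<Phi> (s + t) m = \<Phi> s (\<Phi> t m)"
  and flow_2pi [simp]: "\<Phi> (2 * pi) m = m"
  using action by (simp_all add: circle_action_def)

lemma flow_uminus [simp]: "\<Phi> (- t) (\<Phi> t m) = m" "\<Phi> t (\<Phi> (- t) m) = m"
  using flow_add[of "- t" t m] flow_add[of t "- t" m] by simp_all

lemma flow_minus_2pi [simp]: "\<Phi> (- (2 * pi)) m = m"
  using flow_uminus(1)[of "2 * pi" m] by simp

lemma flow_smooth:
  assumes "smooth_on UNIV c"
  shows "smooth_map (prod_atlas std_R A) A (\<lambda>(t, m). \<Phi> (c t) m)"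
proof -
  have c: "smooth_map (prod_atlas std_R A) std_R (\<lambda>z. c (fst z))"
    using smooth_map_compose[OF RA std_R std_R smooth_map_fst[OF std_R A]] assms
    by (simp add: smooth_map_std_std_iff)
  have "smooth_map (prod_atlas std_R A) A (\<lambda>(t, m). \<Phi> t m)"
    using action by (simp add: circle_action_def)
  from smooth_map_compose[OF RA RA A smooth_map_Pair[OF RA std_R A c smooth_map_snd[OF std_R A]] this]
  show ?thesis
    by (simp add: case_prod_unfold)
qed

lemma smooth_family_flow:
  "smooth_family A u \<Longrightarrow> smooth_on UNIV c \<Longrightarrow> smooth_family A (\<lambda>t m. u t (\<Phi> (c t) m))"
  using smooth_family_comp[OF _ smooth_on_id flow_smooth] by simp

lemma smooth_on_uminus: "smooth_on UNIV (\<lambda>t::real. - t)"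
  using smooth_on_diff[OF open_UNIV smooth_on_const[of _ 0] smooth_on_id] by simp

lemma smooth_family_pull:
  "f \<in> smooth_functions A \<Longrightarrow> smooth_family A (\<lambda>t m. f (\<Phi> t m))"
  "f \<in> smooth_functions A \<Longrightarrow> smooth_family A (\<lambda>t m. f (\<Phi> (- t) m))"
  using smooth_family_flow[OF smooth_family_const smooth_on_id]
    smooth_family_flow[OF smooth_family_const smooth_on_uminus] by auto

lemma smooth_function_pull: "f \<in> smooth_functions A \<Longrightarrow> (\<lambda>m. f (\<Phi> t m)) \<in> smooth_functions A"
  using smooth_family_slice[OF smooth_family_pull(1)] by simp

lemma generator_has_derivative:
  assumes f: "f \<in> smooth_functions A"
  shows "((\<lambda>t. f (\<Phi> t m)) has_real_derivative R0 f (\<Phi> t m)) (at t)"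
proof -
  have "((\<lambda>s. f (\<Phi> s (\<Phi> t m))) has_real_derivative R0 f (\<Phi> t m)) (at (0 :: real))"
    using smooth_family_has_deriv[OF smooth_family_pull(1)[OF f]] f
    by (simp add: infinitesimal_generator_def)
  then have "((\<lambda>s. f (\<Phi> (s + t) m)) has_real_derivative R0 f (\<Phi> t m)) (at 0)"
    by (simp add: flow_add)
  then show ?thesis using DERIV_shift[of "\<lambda>t. f (\<Phi> t m)" _ 0 t] by simp
qed

lemma generator_smooth:
  assumes "f \<in> smooth_functions A"
  shows "R0 f \<in> smooth_functions A"
  using smooth_family_slice[OF smooth_family_deriv[OF smooth_family_pull(1)[OF assms]], of 0] assms
  by (simp add: infinitesimal_generator_def)

text \<open>Both sides are derivatives at s = 0 of f along the same curve, since the flows for s and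
  t commute.\<close>

lemma generator_commute:
  assumes f: "f \<in> smooth_functions A"
  shows "R0 (\<lambda>m. f (\<Phi> t m)) m = R0 f (\<Phi> t m)"
proof -
  have "((\<lambda>s. f (\<Phi> (t + s) m)) has_real_derivative R0 f (\<Phi> t m)) (at 0)"
    using generator_has_derivative[OF f, of m t] DERIV_shift[of "\<lambda>t. f (\<Phi> t m)" _ 0 t]
    by (simp add: add.commute)
  then have "((\<lambda>s. f (\<Phi> t (\<Phi> s m))) has_real_derivative R0 f (\<Phi> t m)) (at 0)"
    by (simp add: flow_add)
  moreover have "((\<lambda>s. f (\<Phi> t (\<Phi> s m))) has_real_derivative R0 (\<lambda>m. f (\<Phi> t m)) m) (at 0)"
    using generator_has_derivative[OF smooth_function_pull[OF f], of t m 0] by simp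
  ultimately show ?thesis using DERIV_unique by blast
qed

lemma pull_back_deriv:
  assumes f: "f \<in> smooth_functions A"
  shows "deriv (\<lambda>t. f (\<Phi> (- t) m)) t = - R0 (\<lambda>m. f (\<Phi> (- t) m)) m"
proof -
  have "((\<lambda>t. f (\<Phi> (- t) m)) has_real_derivative R0 f (\<Phi> (- t) m) * (- 1)) (at t)"
    by (rule DERIV_chain2[OF generator_has_derivative[OF f]]) (auto intro!: derivative_eq_intros)
  then show ?thesis using DERIV_imp_deriv generator_commute[OF f] by fastforce
qed

text \<open>The pullback of D along \<open>\<Phi> t\<close>, that is
  \<open>pull_vfield (\<Phi> t) D\<close>, with \<open>\<Phi> (- t)\<close> written for the
  inverse.\<close>

definition conjugate :: "'m vfield \<Rightarrow> real \<Rightarrow> 'm vfield" where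
  "conjugate D t f m = D (\<lambda>x. f (\<Phi> (- t) x)) (\<Phi> t m)"

lemma conjugate_0 [simp]: "conjugate D 0 f m = D f m"
  and conjugate_2pi [simp]: "conjugate D (2 * pi) f m = D f m"
  by (simp_all add: conjugate_def)

lemma conjugate_family:
  assumes D: "D \<in> vector_fields A" and f: "f \<in> smooth_functions A"
  shows "smooth_family A (\<lambda>t. conjugate D t f)"
  unfolding conjugate_def[abs_def]
  by (rule smooth_family_flow[OF vector_field_family[OF D smooth_family_pull(2)[OF f]] smooth_on_id])

text \<open>The parameter enters twice, in the function to which D is applied and in the point of
  evaluation. Separated by \<open>has_real_derivative_diagonal\<close>, the two dependences
  contribute the two terms of the bracket.\<close>

lemma conjugate_has_derivative_0:
  assumes D: "D \<in> vector_fields A" and f: "f \<in> smooth_functions A"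
  shows "((\<lambda>t. conjugate D t f m) has_real_derivative lie_bracket R0 D f m) (at 0)"
proof -
  define w where "w t = D (\<lambda>x. f (\<Phi> (- t) x))" for t
  have w: "smooth_family A w"
    unfolding w_def by (rule vector_field_family[OF D smooth_family_pull(2)[OF f]])
  have RR: "smooth_manifold (std_atlas :: (real \<times> real, real \<times> real) chart set)"
    by (rule smooth_manifold_std_atlas)
  have proj: "smooth_map std_atlas std_R (fst :: real \<times> real \<Rightarrow> real)"
    "smooth_map std_atlas std_R (snd :: real \<times> real \<Rightarrow> real)"
    by (simp_all add: smooth_map_std_std_iff smooth_on_fst smooth_on_snd)
  have "smooth_map std_atlas A (\<lambda>z :: real \<times> real. case (fst z, m) of (t, m) \<Rightarrow> \<Phi> t m)"
    by (rule smooth_map_compose[OF RR RA A smooth_map_Pair[OF RR std_R A proj(1) smooth_map_const[OF RR A]]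
          flow_smooth[OF smooth_on_id]])
  then have "smooth_map std_atlas A (\<lambda>z :: real \<times> real. \<Phi> (fst z) m)" by simp
  from smooth_map_compose[OF RR RA std_R smooth_map_Pair[OF RR std_R A proj(2) this]
      w[unfolded smooth_family_def]]
  have K: "smooth_on UNIV (\<lambda>z :: real \<times> real. w (snd z) (\<Phi> (fst z) m))"
    by (simp add: smooth_map_std_std_iff)
  have "((\<lambda>s. w 0 (\<Phi> s m)) has_real_derivative R0 (D f) m) (at 0)"
    using generator_has_derivative[OF vector_field_smooth[OF D f], of m 0] by (simp add: w_def)
  moreover have "((\<lambda>s. w s (\<Phi> 0 m)) has_real_derivative - D (R0 f) m) (at 0)"
  proof -
    have "((\<lambda>s. w s m) has_real_derivative D (\<lambda>m. deriv (\<lambda>t. f (\<Phi> (- t) m)) 0) m) (at 0)"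
      unfolding w_def
      by (rule smooth_operator_has_derivative[OF smooth_operator_vector_field[OF D] smooth_family_pull(2)[OF f]])
    moreover have "(\<lambda>m. deriv (\<lambda>t. f (\<Phi> (- t) m)) 0) = (\<lambda>m. - 1 * R0 f m)"
      using pull_back_deriv[OF f] by simp
    ultimately show ?thesis
      using vector_field_cmult[OF D generator_smooth[OF f], of "- 1" m] by simp
  qed
  ultimately have "((\<lambda>s. w s (\<Phi> s m)) has_real_derivative R0 (D f) m + - D (R0 f) m) (at 0)"
    using has_real_derivative_diagonal[OF K, of 0 "R0 (D f) m" "- D (R0 f) m"] by simp
  then show ?thesis by (simp add: conjugate_def w_def lie_bracket_def)
qed

text \<open>The factor 1 / (2 pi) normalizes the boundary term left by integration by parts, and the
  sign comes from the order of the bracket: shifting along the action produces [R0, X], while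
  [X, R0] = D is wanted. The value 0 off the smooth functions is the convention of
  \<open>vector_fields\<close>.\<close>

definition homotopy :: "'m vfield \<Rightarrow> 'm vfield" where
  "homotopy D f m =
    (if f \<in> smooth_functions A then - integral {0..2 * pi} (\<lambda>t. t * conjugate D t f m) / (2 * pi) else 0)"

lemma smooth_family_integrable:
  assumes "smooth_family A u"
  shows "(\<lambda>t. u t m) integrable_on {a..b}"
  using smooth_family_has_deriv[OF assms]
  by (intro integrable_continuous_real continuous_at_imp_continuous_on ballI) (rule DERIV_isCont)

lemma homotopy_integrable:
  assumes "D \<in> vector_fields A" "f \<in> smooth_functions A"
  shows "(\<lambda>t. t * conjugate D t f m) integrable_on {a..b}"
  by (rule smooth_family_integrable[OF smooth_family_mult[OF smooth_family_param conjugate_family[OF assms]]])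

lemma homotopy_vector_field:
  assumes D: "D \<in> vector_fields A"
  shows "homotopy D \<in> vector_fields A"
  unfolding vector_fields_def mem_Collect_eq
proof (intro conjI ballI allI impI)
  fix f assume f: "f \<in> smooth_functions A"
  have "(\<lambda>m. - 1 / (2 * pi) * integral {0..2 * pi} (\<lambda>t. t * conjugate D t f m)) \<in> smooth_functions A"
    by (intro smooth_function_cmult smooth_family_integral smooth_family_mult
        smooth_family_param conjugate_family D f)
  then show "homotopy D f \<in> smooth_functions A"
    using f by (simp add: homotopy_def[abs_def])
next
  fix f assume "f \<notin> smooth_functions A"
  then show "homotopy D f = (\<lambda>_. 0)" by (auto simp: homotopy_def)
next
  fix f g a b m assume f: "f \<in> smooth_functions A" and g: "g \<in> smooth_functions A"
  have eq: "(\<lambda>t. t * conjugate D t (\<lambda>x. a * f x + b * g x) m) =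
      (\<lambda>t. a * (t * conjugate D t f m) + b * (t * conjugate D t g m))"
    unfolding conjugate_def
    using vector_field_linear[OF D smooth_function_pull[OF f] smooth_function_pull[OF g], of a _ b]
    by (simp add: algebra_simps)
  have "integral {0..2 * pi} (\<lambda>t. t * conjugate D t (\<lambda>x. a * f x + b * g x) m) =
      a * integral {0..2 * pi} (\<lambda>t. t * conjugate D t f m) +
      b * integral {0..2 * pi} (\<lambda>t. t * conjugate D t g m)"
    unfolding eq
    by (subst integral_add)
      (auto intro!: integrable_on_mult_right homotopy_integrable D f g)
  moreover have "(\<lambda>x. a * f x + b * g x) \<in> smooth_functions A"
    by (intro smooth_function_add smooth_function_cmult f g)
  ultimately show "homotopy D (\<lambda>x. a * f x + b * g x) m = a * homotopy D f m + b * homotopy D g m"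
    using f g by (simp add: homotopy_def field_simps)
next
  fix f g m assume f: "f \<in> smooth_functions A" and g: "g \<in> smooth_functions A"
  \<comment> \<open>The undifferentiated factors are pulled back by \<open>\<Phi> (- t)\<close> and
    evaluated at \<open>\<Phi> t m\<close>, so they become the constants \<open>f m\<close> and
    \<open>g m\<close> and leave the integral.\<close>
  have eq: "(\<lambda>t. t * conjugate D t (\<lambda>x. f x * g x) m) =
      (\<lambda>t. f m * (t * conjugate D t g m) + g m * (t * conjugate D t f m))"
    unfolding conjugate_def
    using vector_field_mult[OF D smooth_function_pull[OF f] smooth_function_pull[OF g]]
    by (simp add: algebra_simps)
  have "integral {0..2 * pi} (\<lambda>t. t * conjugate D t (\<lambda>x. f x * g x) m) =
      f m * integral {0..2 * pi} (\<lambda>t. t * conjugate D t g m) +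
      g m * integral {0..2 * pi} (\<lambda>t. t * conjugate D t f m)"
    unfolding eq
    by (subst integral_add)
      (auto intro!: integrable_on_mult_right homotopy_integrable D f g)
  moreover have "(\<lambda>x. f x * g x) \<in> smooth_functions A"
    by (intro smooth_function_mult f g)
  ultimately show "homotopy D (\<lambda>x. f x * g x) m = f m * homotopy D g m + g m * homotopy D f m"
    using f g by (simp add: homotopy_def field_simps)
qed

lemma generator_nonsmooth: "f \<notin> smooth_functions A \<Longrightarrow> R0 f = (\<lambda>_. 0)"
  by (auto simp: infinitesimal_generator_def)

lemma generator_0: "R0 (\<lambda>_. 0) m = 0"
  by (simp add: infinitesimal_generator_def smooth_function_constI)

text \<open>
  The vector field \<open>homotopy D\<close> is shifted along the circle action; its rate of change is computed
  once by differentiating under the integral sign and integrating by parts, and once as a bracket.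
\<close>

lemma homotopy_bracket:
  assumes D: "D \<in> vector_fields A"
    and average: "\<And>f m. f \<in> smooth_functions A \<Longrightarrow> integral {0..2 * pi} (\<lambda>t. conjugate D t f m) = 0"
  shows "lie_bracket (homotopy D) R0 = D"
proof (intro ext)
  fix f m
  show "lie_bracket (homotopy D) R0 f m = D f m"
  proof (cases "f \<in> smooth_functions A")
    case False
    then show ?thesis
      using vector_field_nonsmooth[OF homotopy_vector_field[OF D]] vector_field_nonsmooth[OF D]
        generator_nonsmooth vector_field_0[OF homotopy_vector_field[OF D]] generator_0
      by (simp add: lie_bracket_def)
  next
    case f: True
    define k where "k t = conjugate D t f m" for t
    define k' where "k' t = deriv k t" for t
    have k: "(k has_real_derivative k' t) (at t)" for t
      using smooth_family_has_deriv[OF conjugate_family[OF D f]]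
      by (simp add: k_def[abs_def] k'_def)
    have "((\<lambda>t. k' t) has_real_derivative deriv k' t) (at t)" for t
      using smooth_family_has_deriv[OF smooth_family_deriv[OF conjugate_family[OF D f]], of m t]
      by (simp add: k_def[abs_def] k'_def[abs_def])
    then have ck': "continuous_on S k'" for S
      by (intro continuous_at_imp_continuous_on ballI) (rule DERIV_isCont)
    have ck: "continuous_on S k" for S
      using k by (intro continuous_at_imp_continuous_on ballI) (rule DERIV_isCont)
    have conj: "conjugate (homotopy D) s f m = - integral {0..2 * pi} (\<lambda>t. t * k (s + t)) / (2 * pi)" for s
    proof -
      have "conjugate D t (\<lambda>x. f (\<Phi> (- s) x)) (\<Phi> s m) = k (s + t)" for t
        unfolding k_def conjugate_def flow_add[symmetric] by (simp add: add.commute)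
      then show ?thesis
        by (simp add: homotopy_def smooth_function_pull[OF f] conjugate_def[of "homotopy D"])
    qed
    have "((\<lambda>s. integral (cbox 0 (2 * pi)) (\<lambda>t. t * k (s + t))) has_field_derivative
        integral (cbox 0 (2 * pi)) (\<lambda>t. t * k' (0 + t))) (at 0 within UNIV)"
    proof (rule leibniz_rule_field_derivative)
      show "((\<lambda>s. t * k (s + t)) has_real_derivative t * k' (s + t)) (at s within UNIV)" for s t
        by (rule DERIV_cmult, rule DERIV_chain2[OF k, where s = UNIV, THEN DERIV_cong])
          (auto intro!: derivative_eq_intros)
      show "(\<lambda>t. t * k (s + t)) integrable_on cbox 0 (2 * pi)" for s
        by (intro integrable_continuous continuous_intros continuous_on_compose2[OF ck[of UNIV]]) auto
      show "continuous_on (UNIV \<times> cbox 0 (2 * pi)) (\<lambda>(s, t). t * k' (s + t))"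
        unfolding split_beta by (intro continuous_intros continuous_on_compose2[OF ck'[of UNIV]]) auto
    qed auto
    then have 1: "((\<lambda>s. integral {0..2 * pi} (\<lambda>t. t * k (s + t))) has_real_derivative
        integral {0..2 * pi} (\<lambda>t. t * k' t)) (at 0)"
      by simp
    have "((\<lambda>t. k t + t * k' t) has_integral (2 * pi) * k (2 * pi) - 0 * k 0) {0..2 * pi}"
    proof (rule fundamental_theorem_of_calculus)
      show "((\<lambda>t. t * k t) has_vector_derivative k t + t * k' t) (at t within {0..2 * pi})" for t
        unfolding has_real_derivative_iff_has_vector_derivative[symmetric]
        by (rule has_field_derivative_at_within) (auto intro!: derivative_eq_intros k)
    qed simp
    \<comment> \<open>The boundary value at the end of the period is that at 0, namely
      \<open>D f m\<close>, because the action is periodic.\<close>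
    then have "integral {0..2 * pi} (\<lambda>t. k t + t * k' t) = 2 * pi * D f m"
      by (simp add: integral_unique k_def)
    moreover have "integral {0..2 * pi} (\<lambda>t. k t + t * k' t) =
        integral {0..2 * pi} k + integral {0..2 * pi} (\<lambda>t. t * k' t)"
      by (intro integral_add integrable_continuous_real continuous_intros ck ck')
    ultimately have 2: "integral {0..2 * pi} (\<lambda>t. t * k' t) = 2 * pi * D f m"
      using average[OF f, of m] by (simp add: k_def[abs_def])
    have "((\<lambda>s. conjugate (homotopy D) s f m) has_real_derivative - D f m) (at 0)"
      unfolding conj using 1 by (auto intro!: derivative_eq_intros simp: 2)
    then have "lie_bracket R0 (homotopy D) f m = - D f m"
      using conjugate_has_derivative_0[OF homotopy_vector_field[OF D] f, of m] DERIV_unique by blast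
    then show ?thesis by (simp add: lie_bracket_def)
  qed
qed

end

context manifold
begin

section \<open>Formal series of vector fields acting on series of functions\<close>

lemma zero_vector_field: "(\<lambda>f m. 0) \<in> vector_fields A"
  by (simp add: vector_fields_def smooth_function_constI)

lemma vector_field_lincomb:
  assumes X: "X \<in> vector_fields A" and Y: "Y \<in> vector_fields A"
  shows "(\<lambda>f m. a * X f m + b * Y f m) \<in> vector_fields A"
  unfolding vector_fields_def mem_Collect_eq
proof (intro conjI ballI allI impI)
  fix f assume "f \<in> smooth_functions A"
  then show "(\<lambda>m. a * X f m + b * Y f m) \<in> smooth_functions A"
    by (intro smooth_function_add smooth_function_cmult vector_field_smooth[OF X] vector_field_smooth[OF Y])
next
  fix f assume "f \<notin> smooth_functions A"
  then show "(\<lambda>m. a * X f m + b * Y f m) = (\<lambda>_. 0)"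
    using vector_field_nonsmooth X Y by simp
next
  fix f g c d m assume "f \<in> smooth_functions A" "g \<in> smooth_functions A"
  then show "a * X (\<lambda>x. c * f x + d * g x) m + b * Y (\<lambda>x. c * f x + d * g x) m =
      c * (a * X f m + b * Y f m) + d * (a * X g m + b * Y g m)"
    by (simp add: vector_field_linear[OF X] vector_field_linear[OF Y] algebra_simps)
next
  fix f g m assume "f \<in> smooth_functions A" "g \<in> smooth_functions A"
  then show "a * X (\<lambda>x. f x * g x) m + b * Y (\<lambda>x. f x * g x) m =
      f m * (a * X g m + b * Y g m) + g m * (a * X f m + b * Y f m)"
    by (simp add: vector_field_mult[OF X] vector_field_mult[OF Y] algebra_simps)
qed

lemma vector_field_sumI:
  assumes "\<And>i. i \<in> I \<Longrightarrow> X i \<in> vector_fields A"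
  shows "(\<lambda>f m. \<Sum>i\<in>I. X i f m) \<in> vector_fields A"
  using assms
proof (induction I rule: infinite_finite_induct)
  case (insert i I)
  then show ?case using vector_field_lincomb[of "X i" "\<lambda>f m. \<Sum>i\<in>I. X i f m" 1 1] by simp
qed (simp_all add: zero_vector_field)

lemma vector_field_divide: "X \<in> vector_fields A \<Longrightarrow> (\<lambda>f m. X f m / c) \<in> vector_fields A"
  using vector_field_lincomb[of X X "1 / c" 0] by simp

lemma lie_bracket_vector_field:
  assumes X: "X \<in> vector_fields A" and Y: "Y \<in> vector_fields A"
  shows "lie_bracket X Y \<in> vector_fields A"
  unfolding vector_fields_def mem_Collect_eq lie_bracket_def
proof (intro conjI ballI allI impI)
  fix f assume "f \<in> smooth_functions A"
  then show "(\<lambda>m. X (Y f) m - Y (X f) m) \<in> smooth_functions A"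
    by (intro smooth_function_diff vector_field_smooth[OF X] vector_field_smooth[OF Y])
next
  fix f assume "f \<notin> smooth_functions A"
  then show "(\<lambda>m. X (Y f) m - Y (X f) m) = (\<lambda>_. 0)"
    using vector_field_nonsmooth[OF X] vector_field_nonsmooth[OF Y] vector_field_0[OF X] vector_field_0[OF Y]
    by simp
next
  fix f g a b m assume f: "f \<in> smooth_functions A" and g: "g \<in> smooth_functions A"
  note sm = vector_field_smooth[OF X f] vector_field_smooth[OF X g]
    vector_field_smooth[OF Y f] vector_field_smooth[OF Y g]
  have "X (\<lambda>x. a * f x + b * g x) = (\<lambda>m. a * X f m + b * X g m)"
    "Y (\<lambda>x. a * f x + b * g x) = (\<lambda>m. a * Y f m + b * Y g m)"
    using vector_field_linear[OF X f g] vector_field_linear[OF Y f g] by auto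
  then show "X (Y (\<lambda>x. a * f x + b * g x)) m - Y (X (\<lambda>x. a * f x + b * g x)) m =
      a * (X (Y f) m - Y (X f) m) + b * (X (Y g) m - Y (X g) m)"
    using vector_field_linear[OF X sm(3,4)] vector_field_linear[OF Y sm(1,2)]
    by (simp add: algebra_simps)
next
  fix f g m assume f: "f \<in> smooth_functions A" and g: "g \<in> smooth_functions A"
  note sm = vector_field_smooth[OF X f] vector_field_smooth[OF X g]
    vector_field_smooth[OF Y f] vector_field_smooth[OF Y g]
  have eq: "X (\<lambda>x. f x * g x) = (\<lambda>m. f m * X g m + g m * X f m)"
    "Y (\<lambda>x. f x * g x) = (\<lambda>m. f m * Y g m + g m * Y f m)"
    using vector_field_mult[OF X f g] vector_field_mult[OF Y f g] by auto
  have "X (\<lambda>m. f m * Y g m + g m * Y f m) m = X (\<lambda>m. f m * Y g m) m + X (\<lambda>m. g m * Y f m) m"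
    by (intro vector_field_add[OF X] smooth_function_mult f g sm)
  moreover have "Y (\<lambda>m. f m * X g m + g m * X f m) m = Y (\<lambda>m. f m * X g m) m + Y (\<lambda>m. g m * X f m) m"
    by (intro vector_field_add[OF Y] smooth_function_mult f g sm)
  ultimately show "X (Y (\<lambda>x. f x * g x)) m - Y (X (\<lambda>x. f x * g x)) m =
      f m * (X (Y g) m - Y (X g) m) + g m * (X (Y f) m - Y (X f) m)"
    unfolding eq
    by (simp add: vector_field_mult[OF X f sm(4)] vector_field_mult[OF X g sm(3)]
        vector_field_mult[OF Y f sm(2)] vector_field_mult[OF Y g sm(1)] algebra_simps)
qed

text \<open>The Cauchy product of a series of operators with a series of functions. The parameter
  \<gamma> has been fixed beforehand, so that series are plain sequences here.\<close>

definition act :: "(nat \<Rightarrow> 'm vfield) \<Rightarrow> (nat \<Rightarrow> 'm \<Rightarrow> real) \<Rightarrow> nat \<Rightarrow> 'm \<Rightarrow> real" where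
  "act X u n m = (\<Sum>j\<le>n. X j (u (n - j)) m)"

lemma act_smooth:
  assumes "\<And>n. X n \<in> vector_fields A" "\<And>n. u n \<in> smooth_functions A"
  shows "act X u n \<in> smooth_functions A"
  unfolding act_def[abs_def]
  by (intro smooth_function_sum vector_field_smooth[OF assms(1)] assms(2))

lemma act_power_smooth:
  assumes "\<And>n. X n \<in> vector_fields A" "\<And>n. u n \<in> smooth_functions A"
  shows "(act X ^^ k) u n \<in> smooth_functions A"
  by (induction k arbitrary: n) (use assms act_smooth in auto)

text \<open>The composite as a sum over triples of degrees with total n, in the index form of
  \<open>fps_mult_assoc_lemma\<close>.\<close>

lemma act_act:
  assumes X: "\<And>n. X n \<in> vector_fields A" and Y: "\<And>n. Y n \<in> vector_fields A"
    and u: "\<And>n. u n \<in> smooth_functions A"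
  shows "act X (act Y u) n m = (\<Sum>j=0..n. \<Sum>i=0..n-j. X j (Y i (u (n - j - i))) m)"
proof -
  have "X j (act Y u (n - j)) m = (\<Sum>i\<le>n-j. X j (Y i (u (n - j - i))) m)" for j
    unfolding act_def[abs_def]
    by (rule vector_field_sum[OF X]) (intro vector_field_smooth[OF Y] u)
  then show ?thesis by (simp add: act_def[of X] atMost_atLeast0)
qed

lemma act_sum:
  assumes X: "\<And>n. X n \<in> vector_fields A" and v: "\<And>i n. i \<in> I \<Longrightarrow> v i n \<in> smooth_functions A"
  shows "act X (\<lambda>n m. \<Sum>i\<in>I. c i * v i n m) n m = (\<Sum>i\<in>I. c i * act X (v i) n m)"
proof -
  have "X j (\<lambda>m. \<Sum>i\<in>I. c i * v i (n - j) m) m = (\<Sum>i\<in>I. c i * X j (v i (n - j)) m)" for j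
    using v by (subst vector_field_sum[OF X])
      (auto intro!: smooth_function_cmult sum.cong vector_field_cmult[OF X])
  then show ?thesis
    by (simp add: act_def sum_distrib_left) (rule sum.swap)
qed

lemma act_lincomb:
  assumes X: "\<And>n. X n \<in> vector_fields A" and "\<And>n. u n \<in> smooth_functions A" "\<And>n. v n \<in> smooth_functions A"
  shows "act X (\<lambda>n m. a * u n m + b * v n m) n m = a * act X u n m + b * act X v n m"
  using vector_field_linear[OF X assms(2,3)]
  by (simp add: act_def sum.distrib sum_distrib_left)

lemma lie_series_vector_field:
  assumes "\<And>n. G n \<gamma> \<in> vector_fields A" "\<And>n. S n \<gamma> \<in> vector_fields A"
  shows "lie_series G S n \<gamma> \<in> vector_fields A"
  unfolding lie_series_def by (intro vector_field_sumI lie_bracket_vector_field assms)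

lemma lie_series_power_vector_field:
  assumes "\<And>n. G n \<gamma> \<in> vector_fields A" "\<And>n. S n \<gamma> \<in> vector_fields A"
  shows "(lie_series G ^^ k) S n \<gamma> \<in> vector_fields A"
  by (induction k arbitrary: n) (use assms lie_series_vector_field[where \<gamma> = \<gamma>] in auto)

lemma lie_transform_vector_field:
  assumes "\<And>n. G n \<gamma> \<in> vector_fields A" "\<And>n. S n \<gamma> \<in> vector_fields A"
  shows "lie_transform G S n \<gamma> \<in> vector_fields A"
  unfolding lie_transform_def
  by (intro vector_field_sumI vector_field_divide lie_series_power_vector_field assms)

text \<open>On operators, \<open>lie_series G\<close> is the commutator with G. Both sides are sums
  over three degrees with total n; the two groupings are exchanged by the associativity lemma for
  power series.\<close>

lemma act_lie_series:
  assumes G: "\<And>n. G n \<gamma> \<in> vector_fields A" and S: "\<And>n. S n \<gamma> \<in> vector_fields A"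
    and u: "\<And>n. u n \<in> smooth_functions A"
  shows "act (\<lambda>n. G n \<gamma>) (act (\<lambda>n. S n \<gamma>) u) n m =
    act (\<lambda>n. lie_series G S n \<gamma>) u n m + act (\<lambda>n. S n \<gamma>) (act (\<lambda>n. G n \<gamma>) u) n m"
proof -
  have "act (\<lambda>n. lie_series G S n \<gamma>) u n m =
      (\<Sum>j=0..n. \<Sum>i=0..j. G i \<gamma> (S (j - i) \<gamma> (u (n - j))) m) -
      (\<Sum>j=0..n. \<Sum>i=0..j. S (j - i) \<gamma> (G i \<gamma> (u (n - j))) m)"
    by (simp add: act_def lie_series_def lie_bracket_def atMost_atLeast0 sum_subtractf)
  \<comment> \<open>Reversing the inner index puts the degree of the outer operator S first, the
    order in which the associativity lemma reads the indices.\<close>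
  also have "(\<Sum>j=0..n. \<Sum>i=0..j. S (j - i) \<gamma> (G i \<gamma> (u (n - j))) m) =
      (\<Sum>j=0..n. \<Sum>i=0..j. S i \<gamma> (G (j - i) \<gamma> (u (n - j))) m)"
    by (rule sum.cong[OF refl], subst sum.atLeastAtMost_rev) simp
  also have "(\<Sum>j=0..n. \<Sum>i=0..j. S i \<gamma> (G (j - i) \<gamma> (u (n - j))) m) =
      act (\<lambda>n. S n \<gamma>) (act (\<lambda>n. G n \<gamma>) u) n m"
    by (subst act_act[OF S G u])
      (rule fps_mult_assoc_lemma[of "\<lambda>i j k. S i \<gamma> (G j \<gamma> (u k)) m"])
  also have "(\<Sum>j=0..n. \<Sum>i=0..j. G i \<gamma> (S (j - i) \<gamma> (u (n - j))) m) =
      act (\<lambda>n. G n \<gamma>) (act (\<lambda>n. S n \<gamma>) u) n m"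
    by (subst act_act[OF G S u])
      (rule fps_mult_assoc_lemma[of "\<lambda>i j k. G i \<gamma> (S j \<gamma> (u k)) m"])
  finally show ?thesis by simp
qed

text \<open>Pascal's rule, in the form needed for the induction step of a Leibniz formula.\<close>

lemma binomial_recursion:
  fixes T :: "nat \<Rightarrow> nat \<Rightarrow> real"
  shows "(\<Sum>j\<le>k. real (k choose j) * (T (Suc j) (k - j) + T j (Suc k - j))) =
    (\<Sum>j\<le>Suc k. real (Suc k choose j) * T j (Suc k - j))"
proof -
  \<comment> \<open>The added term j = k + 1 carries the binomial coefficient
    \<open>k choose Suc k\<close>, which is 0.\<close>
  have "(\<Sum>j\<le>k. real (k choose j) * T j (Suc k - j)) =
      (\<Sum>j\<le>Suc k. real (k choose j) * T j (Suc k - j))" by simp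
  also have "\<dots> = T 0 (Suc k) + (\<Sum>j\<le>k. real (k choose Suc j) * T (Suc j) (k - j))"
    by (simp only: sum.atMost_Suc_shift) simp
  finally have "(\<Sum>j\<le>k. real (k choose j) * (T (Suc j) (k - j) + T j (Suc k - j))) =
      T 0 (Suc k) + (\<Sum>j\<le>k. real (Suc k choose Suc j) * T (Suc j) (k - j))"
    by (simp add: algebra_simps sum.distrib)
  also have "\<dots> = (\<Sum>j\<le>Suc k. real (Suc k choose j) * T j (Suc k - j))"
    by (simp only: sum.atMost_Suc_shift[of _ k]) simp
  finally show ?thesis .
qed

text \<open>The Leibniz formula for moving powers of G past S: each further G either enters an
  iterated bracket with S or passes through to the right, and \<open>act_lie_series\<close> says
  that these two contributions add up.\<close>

lemma act_power_act:
  assumes G: "\<And>n. G n \<gamma> \<in> vector_fields A" and S: "\<And>n. S n \<gamma> \<in> vector_fields A"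
    and u: "\<And>n. u n \<in> smooth_functions A"
  shows "(act (\<lambda>n. G n \<gamma>) ^^ k) (act (\<lambda>n. S n \<gamma>) u) n m =
    (\<Sum>j\<le>k. real (k choose j) *
      act (\<lambda>n. (lie_series G ^^ j) S n \<gamma>) ((act (\<lambda>n. G n \<gamma>) ^^ (k - j)) u) n m)"
proof (induction k arbitrary: n m)
  case 0
  then show ?case by simp
next
  case (Suc k)
  let ?G = "act (\<lambda>n. G n \<gamma>)"
  define T where "T j i = act (\<lambda>n. (lie_series G ^^ j) S n \<gamma>) ((?G ^^ i) u) n m" for j i
  note vf = lie_series_power_vector_field[of G \<gamma> S, OF G S]
  note sm = act_power_smooth[of "\<lambda>n. G n \<gamma>" u, OF G u]
  have "(?G ^^ k) (act (\<lambda>n. S n \<gamma>) u) = (\<lambda>n m. \<Sum>j\<le>k. real (k choose j) *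
      act (\<lambda>n. (lie_series G ^^ j) S n \<gamma>) ((?G ^^ (k - j)) u) n m)"
    using Suc.IH by (intro ext)
  then have "(?G ^^ Suc k) (act (\<lambda>n. S n \<gamma>) u) n m =
      ?G (\<lambda>n m. \<Sum>j\<le>k. real (k choose j) *
      act (\<lambda>n. (lie_series G ^^ j) S n \<gamma>) ((?G ^^ (k - j)) u) n m) n m"
    by simp
  also have "\<dots> = (\<Sum>j\<le>k. real (k choose j) *
      ?G (act (\<lambda>n. (lie_series G ^^ j) S n \<gamma>) ((?G ^^ (k - j)) u)) n m)"
    by (rule act_sum[OF G act_smooth[OF vf sm]])
  also have "\<dots> = (\<Sum>j\<le>k. real (k choose j) * (T (Suc j) (k - j) + T j (Suc k - j)))"
  proof (rule sum.cong[OF refl])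
    fix j assume "j \<in> {..k}"
    then have "Suc k - j = Suc (k - j)" by auto
    then show "real (k choose j) * ?G (act (\<lambda>n. (lie_series G ^^ j) S n \<gamma>) ((?G ^^ (k - j)) u)) n m =
        real (k choose j) * (T (Suc j) (k - j) + T j (Suc k - j))"
      by (simp add: T_def act_lie_series[of G \<gamma> "(lie_series G ^^ j) S", OF G vf sm])
  qed
  also have "\<dots> = (\<Sum>j\<le>Suc k. real (Suc k choose j) * T j (Suc k - j))"
    by (rule binomial_recursion)
  finally show ?case by (simp add: T_def)
qed

text \<open>Without a constant term each application raises the degree by at least one. Hence
  stopping the exponential at k = n loses nothing in degree n, and summation ranges may be enlarged
  at will.\<close>

lemma act_power_eq_0:
  assumes X: "\<And>n. X n \<in> vector_fields A" and X0: "X 0 = (\<lambda>f m. 0)"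
  shows "n < k \<Longrightarrow> (act X ^^ k) u n = (\<lambda>_. 0)"
proof (induction k arbitrary: n)
  case (Suc k)
  have "X j ((act X ^^ k) u (n - j)) m = 0" if "j \<le> n" for j m
  proof (cases j)
    case 0
    then show ?thesis by (simp add: X0)
  next
    case (Suc i)
    then have "n - j < k" using Suc.prems that by auto
    then show ?thesis using Suc.IH vector_field_0[OF X] by simp
  qed
  then have "act X ((act X ^^ k) u) n = (\<lambda>_. 0)" by (simp add: act_def[of X _ n, abs_def])
  then show ?case by simp
qed simp

lemma lie_bracket_0_right: "X \<in> vector_fields A \<Longrightarrow> lie_bracket X (\<lambda>f m. 0) = (\<lambda>f m. 0)"
  by (simp add: lie_bracket_def vector_field_0)

lemma lie_bracket_0_left: "X \<in> vector_fields A \<Longrightarrow> lie_bracket (\<lambda>f m. 0) X = (\<lambda>f m. 0)"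
  by (simp add: lie_bracket_def vector_field_0)

lemma lie_series_power_eq_0:
  assumes G: "\<And>n. G n \<gamma> \<in> vector_fields A" and S: "\<And>n. S n \<gamma> \<in> vector_fields A"
    and G0: "G 0 \<gamma> = (\<lambda>f m. 0)"
  shows "n < k \<Longrightarrow> (lie_series G ^^ k) S n \<gamma> = (\<lambda>f m. 0)"
proof (induction k arbitrary: n)
  case (Suc k)
  have "lie_bracket (G j \<gamma>) ((lie_series G ^^ k) S (n - j) \<gamma>) = (\<lambda>f m. 0)" if "j \<le> n" for j
  proof (cases j)
    case 0
    then show ?thesis
      using lie_bracket_0_left[OF lie_series_power_vector_field[of G \<gamma> S, OF G S]] by (simp add: G0)
  next
    case (Suc i)
    then have "n - j < k" using Suc.prems that by auto
    then show ?thesis using Suc.IH lie_bracket_0_right[OF G] by simp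
  qed
  then have "lie_series G ((lie_series G ^^ k) S) n \<gamma> = (\<lambda>f m. 0)"
    unfolding lie_series_def[of G "(lie_series G ^^ k) S"] by simp
  then show ?case by simp
qed simp

definition act_exp :: "(nat \<Rightarrow> 'm vfield) \<Rightarrow> (nat \<Rightarrow> 'm \<Rightarrow> real) \<Rightarrow> nat \<Rightarrow> 'm \<Rightarrow> real" where
  "act_exp X u n m = (\<Sum>k\<le>n. (act X ^^ k) u n m / fact k)"

text \<open>\<open>exp(G) \<circ> S = (exp(ad G) S) \<circ> exp(G)\<close> on series of functions.\<close>

lemma act_exp_act:
  assumes G: "\<And>n. G n \<gamma> \<in> vector_fields A" and S: "\<And>n. S n \<gamma> \<in> vector_fields A"
    and G0: "G 0 \<gamma> = (\<lambda>f m. 0)" and u: "\<And>n. u n \<in> smooth_functions A"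
  shows "act_exp (\<lambda>n. G n \<gamma>) (act (\<lambda>n. S n \<gamma>) u) n m =
    act (\<lambda>n. lie_transform G S n \<gamma>) (act_exp (\<lambda>n. G n \<gamma>) u) n m"
proof -
  let ?G = "act (\<lambda>n. G n \<gamma>)"
  let ?S = "\<lambda>j p. (lie_series G ^^ j) S p \<gamma>"
  note vf = lie_series_power_vector_field[of G \<gamma> S, OF G S]
  note sm = act_power_smooth[of "\<lambda>n. G n \<gamma>" u, OF G u]
  note vf0 = lie_series_power_eq_0[of G \<gamma> S, OF G S G0]
  note sm0 = act_power_eq_0[of "\<lambda>n. G n \<gamma>" _ _ u, OF G G0]
  define q where "q j i = act (?S j) ((?G ^^ i) u) n m / (fact j * fact i)" for j i
  \<comment> \<open>In each product either the bracket factor or the function factor sits in too low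
    a degree to be nonzero.\<close>
  have q0: "q j i = 0" if "n < j + i" for j i
  proof -
    have "?S j p ((?G ^^ i) u (n - p)) m = 0" if "p \<le> n" for p
    proof (cases "p < j")
      case True
      then show ?thesis using vf0 by simp
    next
      case False
      then have "n - p < i" using \<open>n < j + i\<close> that by auto
      then show ?thesis using sm0 vector_field_0[OF vf] by simp
    qed
    then show ?thesis by (simp add: q_def act_def)
  qed
  have "act_exp (\<lambda>n. G n \<gamma>) (act (\<lambda>n. S n \<gamma>) u) n m = (\<Sum>k\<le>n. \<Sum>j\<le>k. q j (k - j))"
    unfolding act_exp_def act_power_act[of G \<gamma> S u, OF G S u] sum_divide_distrib
    by (intro sum.cong refl) (simp add: q_def binomial_fact divide_simps)
  also have "\<dots> = (\<Sum>(j, i)\<in>{(j, i). j + i \<le> n}. q j i)"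
    by (rule sum.triangle_reindex_eq[symmetric])
  \<comment> \<open>The triangle is enlarged to a square by terms that vanish, so that the two
    exponential sums separate.\<close>
  also have "\<dots> = (\<Sum>(j, i)\<in>{..n} \<times> {..n}. q j i)"
    by (rule sum.mono_neutral_left) (auto intro!: q0)
  also have "\<dots> = (\<Sum>j\<le>n. \<Sum>i\<le>n. q j i)"
    by (simp add: sum.cartesian_product)
  also have "\<dots> = (\<Sum>p\<le>n. \<Sum>j\<le>n. \<Sum>i\<le>n. ?S j p ((?G ^^ i) u (n - p)) m / (fact j * fact i))"
    unfolding q_def act_def[of "?S _"] sum_divide_distrib
    by (subst sum.swap, subst sum.swap, subst sum.swap, intro sum.cong refl sum.swap)
  also have "\<dots> = (\<Sum>p\<le>n. lie_transform G S p \<gamma> (act_exp (\<lambda>n. G n \<gamma>) u (n - p)) m)"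
  proof (rule sum.cong[OF refl])
    fix p assume p: "p \<in> {..n}"
    have e: "act_exp (\<lambda>n. G n \<gamma>) u (n - p) = (\<lambda>m. \<Sum>i\<le>n. (1 / fact i) * (?G ^^ i) u (n - p) m)"
      unfolding act_exp_def[abs_def]
      by (intro ext, subst sum.mono_neutral_left[of "{..n}" "{..n - p}"]) (auto simp: sm0)
    have "lie_transform G S p \<gamma> (act_exp (\<lambda>n. G n \<gamma>) u (n - p)) m =
        (\<Sum>j\<le>n. ?S j p (act_exp (\<lambda>n. G n \<gamma>) u (n - p)) m / fact j)"
      unfolding lie_transform_def
      by (rule sum.mono_neutral_left) (use p in \<open>auto simp: vf0\<close>)
    also have "\<dots> = (\<Sum>j\<le>n. \<Sum>i\<le>n. ?S j p ((?G ^^ i) u (n - p)) m / (fact j * fact i))"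
    proof (rule sum.cong[OF refl])
      fix j assume "j \<in> {..n}"
      have "?S j p (act_exp (\<lambda>n. G n \<gamma>) u (n - p)) m = (\<Sum>i\<le>n. (1 / fact i) * ?S j p ((?G ^^ i) u (n - p)) m)"
        unfolding e by (subst vector_field_sum[OF vf])
          (auto intro!: smooth_function_cmult sm sum.cong vector_field_cmult[OF vf] simp del: times_divide_eq_left)
      then show "?S j p (act_exp (\<lambda>n. G n \<gamma>) u (n - p)) m / fact j =
          (\<Sum>i\<le>n. ?S j p ((?G ^^ i) u (n - p)) m / (fact j * fact i))"
        by (simp add: sum_divide_distrib mult.commute)
    qed
    finally show "(\<Sum>j\<le>n. \<Sum>i\<le>n. ?S j p ((?G ^^ i) u (n - p)) m / (fact j * fact i)) =
        lie_transform G S p \<gamma> (act_exp (\<lambda>n. G n \<gamma>) u (n - p)) m" by simp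
  qed
  finally show ?thesis by (simp add: act_def)
qed

end

section \<open>Exponentials of formal vector fields as smooth operators\<close>

context manifold
begin

lemma act_power_lincomb:
  assumes X: "\<And>n. X n \<in> vector_fields A"
    and u: "\<And>n. u n \<in> smooth_functions A" and v: "\<And>n. v n \<in> smooth_functions A"
  shows "(act X ^^ k) (\<lambda>n m. a * u n m + b * v n m) =
    (\<lambda>n m. a * (act X ^^ k) u n m + b * (act X ^^ k) v n m)"
proof (induction k)
  case (Suc k)
  show ?case
    using act_lincomb[of X "(act X ^^ k) u" "(act X ^^ k) v" a b, OF X act_power_smooth[of X u, OF X u]
        act_power_smooth[of X v, OF X v]]
    by (simp add: Suc.IH)
qed simp

lemma act_power_family:
  assumes X: "\<And>n. X n \<in> vector_fields A" and u: "\<And>n. smooth_family A (\<lambda>t. u t n)"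
  shows "smooth_family A (\<lambda>t. (act X ^^ k) (u t) n)"
proof (induction k arbitrary: n)
  case (Suc k)
  have "smooth_family A (\<lambda>t m. \<Sum>j\<le>n. X j ((act X ^^ k) (u t) (n - j)) m)"
    by (intro smooth_family_sum vector_field_family[OF X] Suc.IH)
  then show ?case by (simp add: act_def[of X "(act X ^^ k) _" n, abs_def])
qed (simp add: u)

definition const_fun_series :: "('m \<Rightarrow> real) \<Rightarrow> nat \<Rightarrow> 'm \<Rightarrow> real" where
  "const_fun_series f n = (if n = 0 then f else (\<lambda>_. 0))"

lemma const_fun_series_smooth: "f \<in> smooth_functions A \<Longrightarrow> const_fun_series f n \<in> smooth_functions A"
  by (simp add: const_fun_series_def smooth_function_constI)

text \<open>A coefficient of the exponential is in general no derivation, but it is a finite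
  combination of compositions of vector fields, each of which preserves smooth families.\<close>

lemma smooth_operator_act_exp:
  assumes X: "\<And>n. X n \<in> vector_fields A"
  shows "smooth_operator (\<lambda>f. act_exp X (const_fun_series f) n)"
  unfolding smooth_operator_def
proof (intro conjI ballI allI impI)
  fix f g a b m assume f: "f \<in> smooth_functions A" and g: "g \<in> smooth_functions A"
  have "const_fun_series (\<lambda>x. a * f x + b * g x) =
      (\<lambda>n m. a * const_fun_series f n m + b * const_fun_series g n m)"
    by (auto simp: const_fun_series_def)
  then show "act_exp X (const_fun_series (\<lambda>x. a * f x + b * g x)) n m =
      a * act_exp X (const_fun_series f) n m + b * act_exp X (const_fun_series g) n m"
    using act_power_lincomb[of X "const_fun_series f" "const_fun_series g", OF X
        const_fun_series_smooth[OF f] const_fun_series_smooth[OF g]]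
    by (simp add: act_exp_def add_divide_distrib sum.distrib sum_distrib_left)
next
  fix u assume u: "smooth_family A u"
  have "smooth_family A (\<lambda>t. const_fun_series (u t) n)" for n
    using u by (cases "n = 0") (simp_all add: const_fun_series_def smooth_family_const smooth_function_constI)
  from act_power_family[of X "\<lambda>t. const_fun_series (u t)", OF X this]
  have "smooth_family A (\<lambda>t m. \<Sum>k\<le>n. (1 / fact k) * (act X ^^ k) (const_fun_series (u t)) n m)"
    by (intro smooth_family_sum smooth_family_cmult)
  then show "smooth_family A (\<lambda>t. act_exp X (const_fun_series (u t)) n)"
    by (simp add: act_exp_def[abs_def])
qed

lemma smooth_operator_compose:
  assumes L: "smooth_operator L" and M: "smooth_operator M"
  shows "smooth_operator (\<lambda>f. L (M f))"
proof -
  have "M (\<lambda>x. a * f x + b * g x) = (\<lambda>m. a * M f m + b * M g m)"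
    if "f \<in> smooth_functions A" "g \<in> smooth_functions A" for a f b g
    using smooth_operator_linear[OF M that] by auto
  then show ?thesis
    using smooth_operator_linear[OF L smooth_operator_smooth[OF M] smooth_operator_smooth[OF M]]
      smooth_operator_family[OF L smooth_operator_family[OF M]]
    by (simp add: smooth_operator_def)
qed

lemma smooth_operator_0:
  "smooth_operator L \<Longrightarrow> L (\<lambda>_. 0) m = 0"
  using smooth_operator_linear[of L "\<lambda>_. 0" "\<lambda>_. 0" 0 0 m] smooth_function_constI by simp

lemma smooth_operator_cmult:
  "smooth_operator L \<Longrightarrow> f \<in> smooth_functions A \<Longrightarrow> L (\<lambda>x. c * f x) m = c * L f m"
  using smooth_operator_linear[of L f f c 0 m] by simp

lemma smooth_operator_sum:
  assumes L: "smooth_operator L" and f: "\<And>i. i \<in> I \<Longrightarrow> f i \<in> smooth_functions A"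
  shows "L (\<lambda>x. \<Sum>i\<in>I. f i x) m = (\<Sum>i\<in>I. L (f i) m)"
  using f
proof (induction I rule: infinite_finite_induct)
  case (insert i I)
  then show ?case
    using smooth_operator_linear[OF L, of "f i" "\<lambda>x. \<Sum>i\<in>I. f i x" 1 1 m] by (simp add: smooth_function_sum)
qed (simp_all add: smooth_operator_0[OF L])

end

section \<open>Vanishing average of the first discrepancy\<close>

context circle_manifold
begin

lemma act_const_series:
  assumes "R0 \<in> vector_fields A"
  shows "act (\<lambda>n. const_series R0 n \<gamma>) (const_fun_series f) = const_fun_series (R0 f)"
proof (intro ext)
  fix n m
  have "act (\<lambda>n. const_series R0 n \<gamma>) (const_fun_series f) n m =
      (\<Sum>j\<le>n. if j = 0 then R0 (const_fun_series f n) m else 0)"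
    unfolding act_def by (rule sum.cong) (auto simp: const_series_def)
  also have "\<dots> = const_fun_series (R0 f) n m"
    using vector_field_0[OF assms] by (simp add: const_fun_series_def)
  finally show "act (\<lambda>n. const_series R0 n \<gamma>) (const_fun_series f) n m = const_fun_series (R0 f) n m" .
qed

lemma const_series_vector_field:
  "R0 \<in> vector_fields A \<Longrightarrow> const_series R0 n \<gamma> \<in> vector_fields A"
  by (simp add: const_series_def zero_vector_field)

text \<open>
  Here \<open>e \<theta> k\<close> stands for the degree k coefficient of \<open>exp(\<theta> \<L>\<^sub>X)\<close> on functions; the fundamental
  theorem of calculus is applied to the degree n coefficient of \<open>e \<theta> \<circ> exp(\<L>\<^sub>G) \<circ> \<Phi>\<^sub>-\<^sub>\<theta>\<^sup>*\<close>.
\<close>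

lemma average_eq_0:
  fixes e :: "real \<Rightarrow> nat \<Rightarrow> ('m \<Rightarrow> real) \<Rightarrow> 'm \<Rightarrow> real"
    and G :: "('m, 'g::real_vector) vfield_series"
  assumes e_0: "\<And>\<theta> f m. f \<in> smooth_functions A \<Longrightarrow> e \<theta> 0 f m = f (\<Phi> \<theta> m)"
    and e_op: "\<And>\<theta> n. smooth_operator (e \<theta> n)"
    and e_smooth: "\<And>n u m. smooth_family A u \<Longrightarrow> smooth_on UNIV (\<lambda>z :: real \<times> real. e (fst z) n (u (snd z)) m)"
    and e_init: "\<And>n f m. f \<in> smooth_functions A \<Longrightarrow> e 0 n f m = (if n = 0 then f m else 0)"
    and e_end: "\<And>n f m. f \<in> smooth_functions A \<Longrightarrow> e (2 * pi) n f m = (if n = 0 then f m else 0)"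
    and e_deriv: "\<And>\<theta> n f m. f \<in> smooth_functions A \<Longrightarrow>
      ((\<lambda>\<theta>. e \<theta> n f m) has_real_derivative (\<Sum>k\<le>n. e \<theta> k (X (n - k) f) m)) (at \<theta>)"
    and X: "\<And>n. X n \<in> vector_fields A" and R0: "R0 \<in> vector_fields A"
    and G: "\<And>n. G n \<gamma> \<in> vector_fields A" and G0: "G 0 \<gamma> = (\<lambda>f m. 0)"
    and agree: "\<And>j. j < n \<Longrightarrow> X j = lie_transform G (const_series R0) j \<gamma>"
    and f: "f \<in> smooth_functions A"
  shows "integral {0..2 * pi}
    (\<lambda>t. conjugate (\<lambda>f m. 1 * X n f m + - 1 * lie_transform G (const_series R0) n \<gamma> f m) t f m) = 0"
proof -
  define S where "S j = lie_transform G (const_series R0) j \<gamma>" for j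
  define P where "P j f = act_exp (\<lambda>n. G n \<gamma>) (const_fun_series f) j" for j f
  define w where "w t = (\<lambda>m. f (\<Phi> (- t) m))" for t
  define D where "D = (\<lambda>f m. 1 * X n f m + - 1 * S n f m)"
  have S: "S j \<in> vector_fields A" for j
    unfolding S_def by (rule lie_transform_vector_field[of G \<gamma> "const_series R0", OF G const_series_vector_field[OF R0]])
  have P: "smooth_operator (P j)" for j
    unfolding P_def by (rule smooth_operator_act_exp[OF G])
  have P0: "P 0 g = g" for g
    by (auto simp: P_def act_exp_def const_fun_series_def)
  \<comment> \<open>With P the exponential of G, this is P R0 = S P degree by degree. It lets the R0
    produced by differentiating the backward flow be moved to the left of P, where it meets the X
    produced by e.\<close>
  have PR: "P j (R0 g) m = (\<Sum>i\<le>j. S i (P (j - i) g) m)" if "g \<in> smooth_functions A" for j g m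
    using act_exp_act[of G \<gamma> "const_series R0" "const_fun_series g" j m, OF G
        const_series_vector_field[OF R0] G0 const_fun_series_smooth[OF that]]
    by (simp add: act_const_series[OF R0] P_def S_def act_def[of "\<lambda>n. lie_transform _ _ n _"])
  have w: "smooth_family A w"
    unfolding w_def by (rule smooth_family_pull(2)[OF f])
  have ws: "w t \<in> smooth_functions A" for t
    using smooth_family_slice[OF w] .
  note Pw = smooth_operator_smooth[OF P ws]
  note eP = smooth_operator_compose[OF e_op P]
  define h where "h t = (\<Sum>k\<le>n. e t k (P (n - k) (w t)) m)" for t
  have "(h has_real_derivative conjugate D t f m) (at t)" for t
  proof -
    have term_deriv: "((\<lambda>t. e t k (P (n - k) (w t)) m) has_real_derivative
        (\<Sum>i\<le>k. e t i (X (k - i) (P (n - k) (w t))) m) +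
        - (\<Sum>j\<le>n-k. e t k (S j (P (n - k - j) (w t))) m)) (at t)" if k: "k \<le> n" for k
    proof -
      have "smooth_on UNIV (\<lambda>z :: real \<times> real. e (fst z) k (P (n - k) (w (snd z))) m)"
        by (rule e_smooth[OF smooth_operator_family[OF P w]])
      moreover have "((\<lambda>s. e s k (P (n - k) (w t)) m) has_real_derivative
          (\<Sum>i\<le>k. e t i (X (k - i) (P (n - k) (w t))) m)) (at t)"
        by (rule e_deriv[OF Pw])
      moreover have "((\<lambda>s. e t k (P (n - k) (w s)) m) has_real_derivative
          - (\<Sum>j\<le>n-k. e t k (S j (P (n - k - j) (w t))) m)) (at t)"
      proof -
        have "((\<lambda>s. e t k (P (n - k) (w s)) m) has_real_derivative
            e t k (P (n - k) (\<lambda>m. deriv (\<lambda>t. w t m) t)) m) (at t)"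
          by (rule smooth_operator_has_derivative[OF eP w])
        moreover have "(\<lambda>m. deriv (\<lambda>t. w t m) t) = (\<lambda>m. - 1 * R0 (w t) m)"
          using pull_back_deriv[OF f] by (simp add: w_def)
        moreover have "e t k (P (n - k) (\<lambda>m. - 1 * R0 (w t) m)) m = - 1 * e t k (P (n - k) (R0 (w t))) m"
          by (rule smooth_operator_cmult[OF eP vector_field_smooth[OF R0 ws]])
        moreover have "P (n - k) (R0 (w t)) = (\<lambda>m. \<Sum>j\<le>n-k. S j (P (n - k - j) (w t)) m)"
          using PR[OF ws] by (intro ext)
        moreover have "e t k (\<lambda>m. \<Sum>j\<le>n-k. S j (P (n - k - j) (w t)) m) m =
            (\<Sum>j\<le>n-k. e t k (S j (P (n - k - j) (w t))) m)"
          by (rule smooth_operator_sum[OF e_op vector_field_smooth[OF S Pw]])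
        ultimately show ?thesis by simp
      qed
      ultimately show ?thesis
        by (rule has_real_derivative_diagonal[of "\<lambda>z. e (fst z) k (P (n - k) (w (snd z))) m", unfolded fst_conv snd_conv])
    qed
    have "(h has_real_derivative (\<Sum>k\<le>n. (\<Sum>i\<le>k. e t i (X (k - i) (P (n - k) (w t))) m) +
        - (\<Sum>j\<le>n-k. e t k (S j (P (n - k - j) (w t))) m))) (at t)"
      unfolding h_def by (rule DERIV_sum) (use term_deriv in auto)
    moreover have "(\<Sum>k\<le>n. (\<Sum>i\<le>k. e t i (X (k - i) (P (n - k) (w t))) m) +
        - (\<Sum>j\<le>n-k. e t k (S j (P (n - k - j) (w t))) m)) = conjugate D t f m"
    proof -
      define q where "q k j = e t k (X j (P (n - k - j) (w t))) m - e t k (S j (P (n - k - j) (w t))) m" for k j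
      have q0: "q k j = 0" if "j < n" for k j
        using agree[OF that] by (simp add: q_def S_def)
      \<comment> \<open>Re-summed over the degrees of e, X and P, the X terms take the same index
        pattern as the S terms, so they can be subtracted one by one.\<close>
      have "(\<Sum>k\<le>n. \<Sum>i\<le>k. e t i (X (k - i) (P (n - k) (w t))) m) =
          (\<Sum>k\<le>n. \<Sum>j\<le>n-k. e t k (X j (P (n - k - j) (w t))) m)"
        unfolding atMost_atLeast0
        by (rule fps_mult_assoc_lemma[of "\<lambda>i j k. e t i (X j (P k (w t))) m"])
      then have "(\<Sum>k\<le>n. (\<Sum>i\<le>k. e t i (X (k - i) (P (n - k) (w t))) m) +
        - (\<Sum>j\<le>n-k. e t k (S j (P (n - k - j) (w t))) m)) = (\<Sum>k\<le>n. \<Sum>j\<le>n-k. q k j)"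
        by (simp add: sum_subtractf q_def)
      \<comment> \<open>Terms with j < n vanish because X and S agree there. In the remaining terms
        j = n forces k = 0, where e is the pullback by the flow and P is the identity.\<close>
      also have "\<dots> = (\<Sum>k\<le>n. if k = 0 then q 0 n else 0)"
      proof (rule sum.cong[OF refl])
        fix k assume "k \<in> {..n}"
        show "(\<Sum>j\<le>n-k. q k j) = (if k = 0 then q 0 n else 0)"
        proof (cases "k = 0")
          case True
          have "(\<Sum>j\<le>n. q 0 j) = (\<Sum>j\<le>n. if j = n then q 0 n else 0)"
            by (rule sum.cong) (auto intro!: q0)
          then show ?thesis using True by simp
        next
          case False
          then show ?thesis using \<open>k \<in> {..n}\<close> by (auto intro!: sum.neutral q0)
        qed
      qed
      also have "\<dots> = q 0 n" by simp
      also have "\<dots> = conjugate D t f m"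
        by (simp add: q_def P0 e_0 vector_field_smooth[OF X ws] vector_field_smooth[OF S ws]
            conjugate_def D_def w_def[symmetric])
      finally show ?thesis .
    qed
    ultimately show ?thesis by simp
  qed
  then have "((\<lambda>t. conjugate D t f m) has_integral h (2 * pi) - h 0) {0..2 * pi}"
    by (intro fundamental_theorem_of_calculus)
      (auto simp: has_real_derivative_iff_has_vector_derivative[symmetric] intro: has_field_derivative_at_within)
  \<comment> \<open>At both ends of the period e is the identity in degree 0 and zero in higher
    degrees, so just the k = 0 summand survives; periodicity of w makes the two endpoint values
    equal.\<close>
  moreover have "h 0 = P n (w 0) m"
    unfolding h_def using e_init[OF Pw] by simp
  moreover have "h (2 * pi) = P n (w (2 * pi)) m"
    unfolding h_def using e_end[OF Pw] by simp
  moreover have "w (2 * pi) = w 0" by (simp add: w_def)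
  ultimately show ?thesis by (simp add: D_def S_def integral_unique)
qed

end

context manifold
begin

section \<open>Homogeneous polynomials with values in vector fields\<close>

abbreviation poly_vf :: "nat \<Rightarrow> ('g::real_vector \<Rightarrow> 'm vfield) \<Rightarrow> bool" where
  "poly_vf n \<equiv> homogeneous_polynomial n (vector_fields A) (\<lambda>X (f, m). X f m)"

lemma poly_vfI:
  assumes "\<And>vs. length vs = n \<Longrightarrow> B vs \<in> vector_fields A"
    and "\<And>vs i f m. length vs = n \<Longrightarrow> i < n \<Longrightarrow> linear (\<lambda>v. B (vs[i := v]) f m)"
    and "\<And>\<gamma>. P \<gamma> = B (replicate n \<gamma>)"
  shows "poly_vf n P"
  unfolding homogeneous_polynomial_def
  by (rule exI[of _ B]) (use assms in auto)

lemma poly_vfE: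
  assumes "poly_vf n P"
  obtains B where "\<And>vs. length vs = n \<Longrightarrow> B vs \<in> vector_fields A"
    "\<And>vs i f m. length vs = n \<Longrightarrow> i < n \<Longrightarrow> linear (\<lambda>v. B (vs[i := v]) f m)"
    "\<And>\<gamma>. P \<gamma> = B (replicate n \<gamma>)"
proof -
  obtain B where B: "\<forall>vs. length vs = n \<longrightarrow> B vs \<in> vector_fields A"
    "\<forall>vs i x. length vs = n \<longrightarrow> i < n \<longrightarrow> linear (\<lambda>v. case x of (f, m) \<Rightarrow> B (vs[i := v]) f m)"
    "\<forall>\<gamma>. P \<gamma> = B (replicate n \<gamma>)"
    using assms unfolding homogeneous_polynomial_def by blast
  have "linear (\<lambda>v. B (vs[i := v]) f m)" if "length vs = n" "i < n" for vs i f m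
    using B(2) that by (auto dest!: spec[of _ vs] spec[of _ i] spec[of _ "(f, m)"])
  then show ?thesis using that[of B] B by blast
qed

lemma poly_vf_vector_field: "poly_vf n P \<Longrightarrow> P \<gamma> \<in> vector_fields A"
  by (elim poly_vfE) simp

lemma poly_vf_0: "poly_vf n (\<lambda>\<gamma> f m. 0)"
  by (rule poly_vfI[of _ "\<lambda>vs f m. 0"]) (simp_all add: zero_vector_field linear_iff)

lemma poly_vf_lincomb:
  assumes P: "poly_vf n P" and Q: "poly_vf n Q"
  shows "poly_vf n (\<lambda>\<gamma> f m. a * P \<gamma> f m + b * Q \<gamma> f m)"
proof -
  obtain B where B: "\<And>vs. length vs = n \<Longrightarrow> B vs \<in> vector_fields A"
    "\<And>vs i f m. length vs = n \<Longrightarrow> i < n \<Longrightarrow> linear (\<lambda>v. B (vs[i := v]) f m)"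
    "\<And>\<gamma>. P \<gamma> = B (replicate n \<gamma>)" by (rule poly_vfE[OF P]) blast
  obtain C where C: "\<And>vs. length vs = n \<Longrightarrow> C vs \<in> vector_fields A"
    "\<And>vs i f m. length vs = n \<Longrightarrow> i < n \<Longrightarrow> linear (\<lambda>v. C (vs[i := v]) f m)"
    "\<And>\<gamma>. Q \<gamma> = C (replicate n \<gamma>)" by (rule poly_vfE[OF Q]) blast
  show ?thesis
  proof (rule poly_vfI[of _ "\<lambda>vs f m. a * B vs f m + b * C vs f m"])
    show "linear (\<lambda>v. a * B (vs[i := v]) f m + b * C (vs[i := v]) f m)"
      if "length vs = n" "i < n" for vs i f m
      using B(2)[OF that, of f m] C(2)[OF that, of f m] by (simp add: linear_iff algebra_simps)
  qed (simp_all add: B C vector_field_lincomb)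
qed

lemma poly_vf_sum:
  "(\<And>i. i \<in> I \<Longrightarrow> poly_vf n (P i)) \<Longrightarrow> poly_vf n (\<lambda>\<gamma> f m. \<Sum>i\<in>I. P i \<gamma> f m)"
proof (induction I rule: infinite_finite_induct)
  case (insert i I)
  then show ?case using poly_vf_lincomb[of n "P i" "\<lambda>\<gamma> f m. \<Sum>i\<in>I. P i \<gamma> f m" 1 1] by simp
qed (simp_all add: poly_vf_0)

lemma poly_vf_divide: "poly_vf n P \<Longrightarrow> poly_vf n (\<lambda>\<gamma> f m. P \<gamma> f m / c)"
  using poly_vf_lincomb[of n P P "1 / c" 0] by simp

text \<open>Linearity in v at each point makes \<open>X v f\<close> linear in v as a function, and
  Y, being linear on smooth functions, preserves this. For nonsmooth f all terms are 0, and the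
  second claim is the first up to sign.\<close>

lemma linear_lie_bracket:
  fixes X :: "'g::real_vector \<Rightarrow> 'm vfield"
  assumes X: "\<And>v. X v \<in> vector_fields A" and lin: "\<And>f m. linear (\<lambda>v. X v f m)"
    and Y: "Y \<in> vector_fields A"
  shows "linear (\<lambda>v. lie_bracket (X v) Y f m)" "linear (\<lambda>v. lie_bracket Y (X v) f m)"
proof -
  show "linear (\<lambda>v. lie_bracket (X v) Y f m)"
  proof (cases "f \<in> smooth_functions A")
    case False
    then show ?thesis
      using vector_field_nonsmooth[OF X] vector_field_nonsmooth[OF Y] vector_field_0[OF X] vector_field_0[OF Y]
      by (simp add: lie_bracket_def linear_iff)
  next
    case f: True
    note sm = vector_field_smooth[OF X f]
    have "linear (\<lambda>v. Y (X v f) m)"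
      unfolding linear_iff
    proof (intro conjI allI)
      fix v w c
      have "X (v + w) f = (\<lambda>m. X v f m + X w f m)" "X (c *\<^sub>R v) f = (\<lambda>m. c * X v f m)"
        using lin by (auto simp: linear_iff)
      then show "Y (X (v + w) f) m = Y (X v f) m + Y (X w f) m" "Y (X (c *\<^sub>R v) f) m = c *\<^sub>R Y (X v f) m"
        using vector_field_add[OF Y sm sm] vector_field_cmult[OF Y sm] by simp_all
    qed
    then show ?thesis
      using lin[of "Y f" m] unfolding lie_bracket_def by (rule linear_compose_sub[rotated])
  qed
  then have "linear (\<lambda>v. - lie_bracket (X v) Y f m)" by (rule linear_compose_neg)
  then show "linear (\<lambda>v. lie_bracket Y (X v) f m)" by (simp add: lie_bracket_def)
qed

text \<open>The multilinear form of the bracket feeds the first i arguments to the form of P and the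
  last j to that of Q; a constant argument list splits accordingly.\<close>

lemma poly_vf_lie_bracket:
  assumes P: "poly_vf i P" and Q: "poly_vf j Q"
  shows "poly_vf (i + j) (\<lambda>\<gamma>. lie_bracket (P \<gamma>) (Q \<gamma>))"
proof -
  obtain B where B: "\<And>vs. length vs = i \<Longrightarrow> B vs \<in> vector_fields A"
    "\<And>vs l f m. length vs = i \<Longrightarrow> l < i \<Longrightarrow> linear (\<lambda>v. B (vs[l := v]) f m)"
    "\<And>\<gamma>. P \<gamma> = B (replicate i \<gamma>)" by (rule poly_vfE[OF P]) blast
  obtain C where C: "\<And>vs. length vs = j \<Longrightarrow> C vs \<in> vector_fields A"
    "\<And>vs l f m. length vs = j \<Longrightarrow> l < j \<Longrightarrow> linear (\<lambda>v. C (vs[l := v]) f m)"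
    "\<And>\<gamma>. Q \<gamma> = C (replicate j \<gamma>)" by (rule poly_vfE[OF Q]) blast
  show ?thesis
  proof (rule poly_vfI[of _ "\<lambda>vs. lie_bracket (B (take i vs)) (C (drop i vs))"])
    fix vs :: "'a list" assume vs: "length vs = i + j"
    then show "lie_bracket (B (take i vs)) (C (drop i vs)) \<in> vector_fields A"
      by (intro lie_bracket_vector_field B C) simp_all
    fix l f m assume l: "l < i + j"
    show "linear (\<lambda>v. lie_bracket (B (take i (vs[l := v]))) (C (drop i (vs[l := v]))) f m)"
    proof (cases "l < i")
      case True
      have "linear (\<lambda>v. lie_bracket (B ((take i vs)[l := v])) (C (drop i vs)) f m)"
        by (rule linear_lie_bracket(1)) (use vs True in \<open>auto intro!: B C\<close>)
      then show ?thesis using True by (simp add: take_update_swap)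
    next
      case False
      have "linear (\<lambda>v. lie_bracket (B (take i vs)) (C ((drop i vs)[l - i := v])) f m)"
        by (rule linear_lie_bracket(2)) (use vs False l in \<open>auto intro!: B C\<close>)
      then show ?thesis using False by (simp add: drop_update_swap)
    qed
  qed (simp add: B C take_replicate drop_replicate)
qed

lemma poly_vf_lie_series:
  assumes "\<And>n. poly_vf n (G n)" "\<And>n. poly_vf n (S n)"
  shows "poly_vf n (lie_series G S n)"
proof -
  have "poly_vf n (\<lambda>\<gamma>. lie_bracket (G j \<gamma>) (S (n - j) \<gamma>))" if "j \<le> n" for j
    using poly_vf_lie_bracket[OF assms(1)[of j] assms(2)[of "n - j"]] that by simp
  then have "poly_vf n (\<lambda>\<gamma> f m. \<Sum>j\<le>n. lie_bracket (G j \<gamma>) (S (n - j) \<gamma>) f m)"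
    by (intro poly_vf_sum) auto
  then show ?thesis by (simp add: lie_series_def[abs_def])
qed

lemma poly_vf_lie_transform:
  assumes G: "\<And>n. poly_vf n (G n)" and S: "\<And>n. poly_vf n (S n)"
  shows "poly_vf n (lie_transform G S n)"
proof -
  have "poly_vf n ((lie_series G ^^ k) S n)" for k
    by (induction k arbitrary: n) (use S poly_vf_lie_series[OF G] in auto)
  then have "poly_vf n (\<lambda>\<gamma> f m. \<Sum>k\<le>n. (lie_series G ^^ k) S n \<gamma> f m / fact k)"
    by (intro poly_vf_sum poly_vf_divide)
  then show ?thesis by (simp add: lie_transform_def[abs_def])
qed

lemma poly_vf_const_series:
  assumes "X \<in> vector_fields A"
  shows "poly_vf n (const_series X n)"
proof (cases n)
  case 0
  then show ?thesis
    by (intro poly_vfI[of _ "\<lambda>vs. X"]) (simp_all add: assms const_series_def)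
next
  case (Suc k)
  then show ?thesis using poly_vf_0 by (simp add: const_series_def[abs_def])
qed

subsection \<open>Dependence of a Lie transform on its generator\<close>

text \<open>All degrees are nonnegative, so a coefficient of degree i is built from coefficients of
  G of degree at most i.\<close>

lemma lie_series_power_cong:
  assumes "\<And>j. j \<le> n \<Longrightarrow> G j \<gamma> = G' j \<gamma>"
  shows "i \<le> n \<Longrightarrow> (lie_series G ^^ k) S i \<gamma> = (lie_series G' ^^ k) S i \<gamma>"
proof (induction k arbitrary: i)
  case (Suc k)
  then have "lie_series G ((lie_series G ^^ k) S) i \<gamma> = lie_series G' ((lie_series G' ^^ k) S) i \<gamma>"
    unfolding lie_series_def[of G "(lie_series G ^^ k) S"] lie_series_def[of G' "(lie_series G' ^^ k) S"]
    by (intro ext sum.cong refl) (use assms in auto)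
  then show ?case by simp
qed simp

lemma lie_transform_cong:
  "(\<And>j. j \<le> n \<Longrightarrow> G j \<gamma> = G' j \<gamma>) \<Longrightarrow> lie_transform G S n \<gamma> = lie_transform G' S n \<gamma>"
  unfolding lie_transform_def using lie_series_power_cong[of n G \<gamma> G' n _ S]
  by (intro ext sum.cong refl) simp

text \<open>In degree n + 1 the new coefficient of G can only act on a term of degree 0. Such a term
  exists only before the first bracket, where it is X itself, so the change is a single bracket,
  with the coefficient 1 of the k = 1 summand.\<close>

lemma lie_transform_update:
  assumes G: "\<And>j. G j \<gamma> \<in> vector_fields A" and G0: "G 0 \<gamma> = (\<lambda>f m. 0)"
    and Gn: "G (Suc n) \<gamma> = (\<lambda>f m. 0)"
    and G': "\<And>j. j \<noteq> Suc n \<Longrightarrow> G' j \<gamma> = G j \<gamma>" "G' (Suc n) \<gamma> \<in> vector_fields A"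
    and X: "X \<in> vector_fields A"
  shows "lie_transform G' (const_series X) (Suc n) \<gamma> f m =
    lie_transform G (const_series X) (Suc n) \<gamma> f m + lie_bracket (G' (Suc n) \<gamma>) X f m"
proof -
  let ?C = "const_series X :: ('m, _) vfield_series"
  have C: "?C j \<gamma> \<in> vector_fields A" for j
    using X by (simp add: const_series_def zero_vector_field)
  have VG': "G' j \<gamma> \<in> vector_fields A" for j using G G' by metis
  have G'0: "G' 0 \<gamma> = (\<lambda>f m. 0)" using G' G0 by simp
  define T where "T k = (lie_series G' ^^ k) ?C (Suc n) \<gamma> f m - (lie_series G ^^ k) ?C (Suc n) \<gamma> f m" for k
  have "T k = (if k = 1 then lie_bracket (G' (Suc n) \<gamma>) X f m else 0)" for k
  proof (cases k)
    case 0
    then show ?thesis by (simp add: T_def)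
  next
    case (Suc l)
    define a where "a j = lie_bracket (G' j \<gamma>) ((lie_series G' ^^ l) ?C (Suc n - j) \<gamma>) f m -
      lie_bracket (G j \<gamma>) ((lie_series G ^^ l) ?C (Suc n - j) \<gamma>) f m" for j
    have "T k = (\<Sum>j\<le>Suc n. a j)"
      unfolding T_def Suc a_def
      by (simp only: funpow.simps o_apply sum_subtractf
          lie_series_def[of G "(lie_series G ^^ l) ?C"] lie_series_def[of G' "(lie_series G' ^^ l) ?C"])
    also have "\<dots> = (\<Sum>j\<le>Suc n. if j = Suc n then a (Suc n) else 0)"
    proof (rule sum.cong[OF refl])
      fix j assume j: "j \<in> {..Suc n}"
      consider "j = 0" | "0 < j" "j \<le> n" | "j = Suc n" using j by force
      then show "a j = (if j = Suc n then a (Suc n) else 0)"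
      proof cases
        case 1
        then show ?thesis
          using lie_bracket_0_left[OF lie_series_power_vector_field[of G' \<gamma> ?C, OF VG' C]]
            lie_bracket_0_left[OF lie_series_power_vector_field[of G \<gamma> ?C, OF G C]]
          by (simp add: a_def G0 G'0)
      next
        case 2
        then show ?thesis
          using lie_series_power_cong[of n G' \<gamma> G "Suc n - j" l ?C] G'(1) by (simp add: a_def)
      qed simp
    qed
    also have "\<dots> = a (Suc n)" by simp
    also have "\<dots> = lie_bracket (G' (Suc n) \<gamma>) ((lie_series G' ^^ l) ?C 0 \<gamma>) f m"
      using lie_bracket_0_left[OF lie_series_power_vector_field[of G \<gamma> ?C, OF G C]]
      by (simp add: a_def Gn)
    \<comment> \<open>For l > 0 the l-fold bracket has no degree 0 part, as G has no constant term;
      for l = 0 the degree 0 part is X.\<close>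
    also have "\<dots> = (if k = 1 then lie_bracket (G' (Suc n) \<gamma>) X f m else 0)"
    proof (cases l)
      case 0
      then show ?thesis using Suc by (simp add: const_series_def)
    next
      case (Suc i)
      then show ?thesis
        using lie_series_power_eq_0[of G' \<gamma> ?C 0 l, OF VG' C G'0] lie_bracket_0_right[OF G'(2)] \<open>k = Suc l\<close>
        by simp
    qed
    finally show ?thesis .
  qed
  then have "(\<Sum>k\<le>Suc n. T k / fact k) = lie_bracket (G' (Suc n) \<gamma>) X f m"
    by (subst sum.cong[where h = "\<lambda>k. if k = 1 then lie_bracket (G' (Suc n) \<gamma>) X f m else 0"]) auto
  then show ?thesis
    by (simp only: lie_transform_def T_def diff_divide_distrib sum_subtractf)
qed

end

context circle_manifold
begin

section \<open>The normalizing transformation\<close>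

text \<open>\<open>homotopy\<close> is linear in its vector field, so applying it to the values of
  the multilinear form of P gives a multilinear form again.\<close>

lemma poly_vf_homotopy:
  fixes P :: "'g::real_vector \<Rightarrow> 'm vfield"
  assumes P: "poly_vf n P"
  shows "poly_vf n (\<lambda>\<gamma>. homotopy (P \<gamma>))"
proof -
  obtain B where B: "\<And>vs. length vs = n \<Longrightarrow> B vs \<in> vector_fields A"
    "\<And>vs i f m. length vs = n \<Longrightarrow> i < n \<Longrightarrow> linear (\<lambda>v. B (vs[i := v]) f m)"
    "\<And>\<gamma>. P \<gamma> = B (replicate n \<gamma>)" by (rule poly_vfE[OF P]) blast
  show ?thesis
  proof (rule poly_vfI[of _ "\<lambda>vs. homotopy (B vs)"])
    fix vs :: "'g list" and i f m assume vs: "length vs = n" and i: "i < n"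
    show "linear (\<lambda>v. homotopy (B (vs[i := v])) f m)"
    proof (cases "f \<in> smooth_functions A")
      case f: True
      define I where "I v = integral {0..2 * pi} (\<lambda>t. t * conjugate (B (vs[i := v])) t f m)" for v
      have int: "(\<lambda>t. t * conjugate (B (vs[i := v])) t f m) integrable_on {0..2 * pi}" for v
        by (rule homotopy_integrable[OF B(1) f]) (simp add: vs)
      note lin = B(2)[OF vs i, unfolded linear_iff]
      have "I (v + w) = I v + I w" for v w
        unfolding I_def integral_add[OF int int, symmetric]
        by (rule integral_cong) (use lin in \<open>simp add: conjugate_def distrib_left\<close>)
      moreover have "I (c *\<^sub>R v) = c * I v" for c v
        unfolding I_def integral_mult_right[symmetric]
        by (rule integral_cong) (use lin in \<open>simp add: conjugate_def\<close>)
      ultimately show ?thesis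
        using f by (simp add: linear_iff homotopy_def I_def[symmetric] add_divide_distrib)
    qed (simp add: homotopy_def linear_iff)
  qed (simp_all add: B homotopy_vector_field)
qed

text \<open>Stage n is zero in degrees above n, so each correction overwrites a zero coefficient, as
  \<open>lie_transform_update\<close> requires. Stage 0 needs no correction because R starts with
  the generator of the action. The coefficients 1 and - 1 give the discrepancy the shape of
  \<open>vector_field_lincomb\<close>.\<close>

primrec generator_approx :: "('m, 'g::real_vector) vfield_series \<Rightarrow> nat \<Rightarrow> ('m, 'g) vfield_series" where
  "generator_approx R 0 = (\<lambda>n \<gamma> f m. 0)"
| "generator_approx R (Suc n) = (generator_approx R n)(Suc n := (\<lambda>\<gamma>.
     homotopy (\<lambda>f m. 1 * R (Suc n) \<gamma> f m +
       - 1 * lie_transform (generator_approx R n) (const_series R0) (Suc n) \<gamma> f m)))"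

text \<open>This separates the recursion from the flow: all that is asked of the flow is that, for
  every G matching R below degree n, the discrepancy in degree n averages to zero.\<close>

lemma normalizing_transformation_exists:
  fixes R :: "('m, 'g::real_vector) vfield_series"
  assumes R: "vector_field_series A R" and R_0: "\<And>\<gamma>. R 0 \<gamma> = R0"
    and average: "\<And>n \<gamma> (G :: ('m, 'g) vfield_series) f m.
      (\<And>j. G j \<gamma> \<in> vector_fields A) \<Longrightarrow> G 0 \<gamma> = (\<lambda>f m. 0) \<Longrightarrow>
      (\<And>j. j < n \<Longrightarrow> R j \<gamma> = lie_transform G (const_series R0) j \<gamma>) \<Longrightarrow> f \<in> smooth_functions A \<Longrightarrow>
      integral {0..2 * pi} (\<lambda>t. conjugate
        (\<lambda>f m. 1 * R n \<gamma> f m + - 1 * lie_transform G (const_series R0) n \<gamma> f m) t f m) = 0"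
  shows "\<exists>G. normalizing_transformation A \<Phi> R G"
proof -
  let ?C = "const_series R0 :: ('m, 'g) vfield_series"
  let ?H = "generator_approx R"
  have pR: "poly_vf n (R n)" for n
    using R by (simp add: vector_field_series_def)
  \<comment> \<open>The generator is a vector field because it is the degree 0 coefficient of
    R.\<close>
  have R0: "R0 \<in> vector_fields A"
    using poly_vf_vector_field[OF pR, of 0 0] by (simp add: R_0)
  have pC: "poly_vf n (?C n)" for n by (rule poly_vf_const_series[OF R0])
  have pH: "poly_vf j (?H n j)" for n j
  proof (induction n arbitrary: j)
    case (Suc n)
    show ?case
      using Suc poly_vf_homotopy[OF poly_vf_lincomb[OF pR poly_vf_lie_transform[OF Suc pC]], of "Suc n" 1 "- 1"]
      by (cases "j = Suc n") simp_all
  qed (simp add: poly_vf_0)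
  have vH: "?H n j \<gamma> \<in> vector_fields A" for n j \<gamma>
    by (rule poly_vf_vector_field[OF pH])
  have H0: "?H n 0 \<gamma> = (\<lambda>f m. 0)" for n \<gamma>
    by (induction n) simp_all
  have H_above: "?H n j \<gamma> = (\<lambda>f m. 0)" if "n < j" for n j \<gamma>
    using that by (induction n) auto
  have H_stable: "?H n j = ?H j j" if "j \<le> n" for n j
    using that by (induction n) (auto simp: le_Suc_eq)
  have match: "R j \<gamma> = lie_transform (?H n) ?C j \<gamma>" if "j \<le> n" for j n \<gamma>
    using that
  proof (induction n arbitrary: j)
    case 0
    then show ?case by (simp add: lie_transform_def const_series_def R_0)
  next
    case (Suc n)
    show ?case
    proof (cases "j = Suc n")
      case False
      then have "lie_transform (?H (Suc n)) ?C j \<gamma> = lie_transform (?H n) ?C j \<gamma>"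
        using Suc.prems by (intro lie_transform_cong) simp
      moreover have "R j \<gamma> = lie_transform (?H n) ?C j \<gamma>"
        using Suc False by simp
      ultimately show ?thesis by (simp only:)
    next
      case True
      define D where "D = (\<lambda>f m. 1 * R (Suc n) \<gamma> f m + - 1 * lie_transform (?H n) ?C (Suc n) \<gamma> f m)"
      have D: "D \<in> vector_fields A"
        unfolding D_def
        by (intro vector_field_lincomb poly_vf_vector_field[OF pR]
            poly_vf_vector_field[OF poly_vf_lie_transform[OF pH pC]])
      have agree: "R i \<gamma> = lie_transform (?H n) ?C i \<gamma>" if "i < Suc n" for i
        using Suc.IH[of i] that by simp
      have br: "lie_bracket (homotopy D) R0 = D"
        by (rule homotopy_bracket[OF D]) (unfold D_def, rule average[OF vH H0 agree])
      have "lie_transform (?H (Suc n)) ?C (Suc n) \<gamma> f m =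
          lie_transform (?H n) ?C (Suc n) \<gamma> f m + lie_bracket (?H (Suc n) (Suc n) \<gamma>) R0 f m" for f m
        by (rule lie_transform_update[of "?H n" \<gamma> n "?H (Suc n)", OF vH H0 H_above _ vH R0]) simp_all
      moreover have "?H (Suc n) (Suc n) \<gamma> = homotopy D"
        by (simp add: D_def)
      ultimately have "lie_transform (?H (Suc n)) ?C (Suc n) \<gamma> f m =
          lie_transform (?H n) ?C (Suc n) \<gamma> f m + D f m" for f m
        by (simp only: br)
      then have "R (Suc n) \<gamma> f m = lie_transform (?H (Suc n)) ?C (Suc n) \<gamma> f m" for f m
        by (simp only: D_def)
      then show ?thesis unfolding True by (intro ext)
    qed
  qed
  \<comment> \<open>The diagonal of the stages. Degree j is settled at stage j, so G and stage n
    coincide up to degree n and have the same Lie transform in degree n.\<close>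
  define G where "G = (\<lambda>n. ?H n n)"
  have R_eq: "R n \<gamma> = lie_transform G ?C n \<gamma>" for n \<gamma>
  proof -
    have "lie_transform G ?C n \<gamma> = lie_transform (?H n) ?C n \<gamma>"
      by (rule lie_transform_cong) (simp only: G_def H_stable[of _ n])
    then show ?thesis using match[of n n \<gamma>] by simp
  qed
  have "R = lie_transform G ?C" by (intro ext) (simp only: R_eq)
  moreover have "vector_field_series A G"
    using pH by (simp add: vector_field_series_def G_def)
  ultimately have "normalizing_transformation A \<Phi> R G"
    using H0[of 0] by (simp add: normalizing_transformation_def G_def)
  then show ?thesis by blast
qed

end

subsection \<open>Smooth functions as tensor fields\<close>

text \<open>The formal flow acts on tensor fields, and functions enter it as those of type (0, 0);
  nonempty argument lists get the value 0 that \<open>tensor_fields\<close> prescribes.\<close>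

definition function_tensor :: "('m \<Rightarrow> real) \<Rightarrow> 'm tensor" where
  "function_tensor f \<alpha>s Xs = (if \<alpha>s = [] \<and> Xs = [] then f else (\<lambda>_. 0))"

context manifold
begin

lemma function_tensor_field:
  "f \<in> smooth_functions A \<Longrightarrow> function_tensor f \<in> tensor_fields A 0 0"
  by (auto simp: tensor_fields_def function_tensor_def)

lemma lie_function_tensor:
  assumes X: "X \<in> vector_fields A"
  shows "lie_tensor A X (function_tensor f) = function_tensor (X f)"
proof (intro ext)
  fix \<alpha>s :: "'m form list" and Ys :: "'m vfield list" and m
  show "lie_tensor A X (function_tensor f) \<alpha>s Ys m = function_tensor (X f) \<alpha>s Ys m"
  proof (cases "\<alpha>s = [] \<and> Ys = []")
    case True
    then show ?thesis by (simp add: lie_tensor_def function_tensor_def)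
  next
    case False
    then have "function_tensor f (\<alpha>s[i := \<beta>]) Ys = (\<lambda>_. 0)" "function_tensor f \<alpha>s (Ys[i := Z]) = (\<lambda>_. 0)"
      "function_tensor f \<alpha>s Ys = (\<lambda>_. 0)" for i \<beta> Z
      by (auto simp: function_tensor_def)
    then show ?thesis
      using False vector_field_0[OF X] by (auto simp: lie_tensor_def function_tensor_def[of "X f"])
  qed
qed

lemma function_tensor_family:
  assumes "smooth_family A u"
  shows "smooth_tensor_family A 0 0 (\<lambda>\<tau>. function_tensor (u \<tau>))"
  unfolding smooth_tensor_family_def
proof (intro conjI allI)
  show "function_tensor (u \<tau>) \<in> tensor_fields A 0 0" for \<tau>
    by (rule function_tensor_field[OF smooth_family_slice[OF assms]])
  show "smooth_map (prod_atlas std_R A) std_R (\<lambda>(\<tau>, m). function_tensor (u \<tau>) \<alpha>s Xs m)" for \<alpha>s Xs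
    using assms smooth_map_const[OF RA std_R, of 0]
    by (cases "\<alpha>s = [] \<and> Xs = []") (auto simp: function_tensor_def smooth_family_def case_prod_unfold)
qed

end

section \<open>Restriction of the formal flow to functions, and conclusion\<close>

theorem theorem2:
  fixes A :: "('m::{t2_space,second_countable_topology}, 'e::finite_dim_space) chart set"
    and F :: "'m \<times> 'g::finite_dim_space \<Rightarrow> 'm"
    and \<Phi> :: "real \<Rightarrow> 'm \<Rightarrow> 'm"
    and \<theta>\<^sub>0 :: real
    and R :: "('m, 'g) vfield_series"
  assumes "smooth_manifold A"
    and "nearly_periodic_map A F \<Phi> \<theta>\<^sub>0"
    and "\<not> resonant \<theta>\<^sub>0"
    and "roto_rate A F \<Phi> R"
  shows "\<exists>G. normalizing_transformation A \<Phi> R G"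
proof -
  interpret circle_manifold A \<Phi>
    by unfold_locales (use assms(1,2) in \<open>simp_all add: nearly_periodic_map_def\<close>)
  have R: "vector_field_series A R" and R_0: "\<And>\<gamma>. R 0 \<gamma> = R0"
    using assms(4) by (simp_all add: roto_rate_def)
  obtain E where flow: "formal_pullback_flow A \<Phi> R E"
    and E_end: "\<And>r s T n \<gamma>. T \<in> tensor_fields A r s \<Longrightarrow>
      E (2 * pi) n \<gamma> T = (if n = 0 then T else (\<lambda>\<alpha>s Xs m. 0))"
    using assms(4) unfolding roto_rate_def by blast
  note flow' = conjunct1[OF flow[unfolded formal_pullback_flow_def]]
    conjunct1[OF conjunct2[OF flow[unfolded formal_pullback_flow_def]]]
    conjunct1[OF conjunct2[OF conjunct2[OF flow[unfolded formal_pullback_flow_def]]]]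
    conjunct1[OF conjunct2[OF conjunct2[OF conjunct2[OF flow[unfolded formal_pullback_flow_def]]]]]
    conjunct2[OF conjunct2[OF conjunct2[OF conjunct2[OF flow[unfolded formal_pullback_flow_def]]]]]
  have E_poly: "homogeneous_polynomial n (tensor_operators A) (\<lambda>D (T, \<alpha>s, Xs, m). D T \<alpha>s Xs m) (E \<theta> n)" for n \<theta>
    using flow'(1) by simp
  have E_0: "E \<theta> 0 \<gamma> T = pull_tensor (\<Phi> \<theta>) T" if "T \<in> tensor_fields A r s" for \<theta> \<gamma> r s T
    using flow'(2) that by blast
  have E_smooth: "smooth_map (prod_atlas std_atlas (prod_atlas std_atlas A)) std_atlas
      (\<lambda>(\<theta>, \<tau>, m). E \<theta> n \<gamma> (U \<tau>) \<alpha>s Xs m)" if "smooth_tensor_family A r s U" for n \<gamma> r s U \<alpha>s Xs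
    using flow'(3) that by blast
  have E_init: "E 0 n \<gamma> T = (if n = 0 then T else (\<lambda>\<alpha>s Xs m. 0))" if "T \<in> tensor_fields A r s" for n \<gamma> r s T
    using flow'(4) that by blast
  have E_deriv: "((\<lambda>\<theta>. E \<theta> n \<gamma> T \<alpha>s Xs m) has_real_derivative
      (\<Sum>k\<le>n. E \<theta> k \<gamma> (lie_tensor A (R (n - k) \<gamma>) T) \<alpha>s Xs m)) (at \<theta>)"
    if "T \<in> tensor_fields A r s" for n \<theta> \<gamma> r s T \<alpha>s Xs m
    using flow'(5) that by blast
  \<comment> \<open>A value of a homogeneous polynomial map is its multilinear form on a constant
    list, hence lies in the target set.\<close>
  have E_op: "E \<theta> n \<gamma> \<in> tensor_operators A" for \<theta> n \<gamma>
    using E_poly[of n \<theta>] unfolding homogeneous_polynomial_def by auto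
  have VR: "R n \<gamma> \<in> vector_fields A" for n \<gamma>
    using R by (intro poly_vf_vector_field[where n = n]) (simp add: vector_field_series_def)
  note T = function_tensor_field
  define e where "e \<gamma> \<theta> n f = E \<theta> n \<gamma> (function_tensor f) [] []" for \<gamma> \<theta> n f
  have e_smooth3: "smooth_map (prod_atlas std_R (prod_atlas std_R A)) std_R (\<lambda>(\<theta>, \<tau>, m). e \<gamma> \<theta> n (u \<tau>) m)"
    if "smooth_family A u" for \<gamma> n u
    unfolding e_def by (rule E_smooth[OF function_tensor_family[OF that]])
  note RRA = smooth_manifold_prod_atlas[OF std_R RA]
  show ?thesis
  proof (rule normalizing_transformation_exists[OF R R_0])
    fix n \<gamma> and G :: "('m, 'g) vfield_series" and f m
    assume G: "\<And>j. G j \<gamma> \<in> vector_fields A" "G 0 \<gamma> = (\<lambda>f m. 0)"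
      and agree: "\<And>j. j < n \<Longrightarrow> R j \<gamma> = lie_transform G (const_series R0) j \<gamma>"
      and f: "f \<in> smooth_functions A"
    show "integral {0..2 * pi} (\<lambda>t. conjugate
        (\<lambda>f m. 1 * R n \<gamma> f m + - 1 * lie_transform G (const_series R0) n \<gamma> f m) t f m) = 0"
    proof (rule average_eq_0[where e = "e \<gamma>" and X = "\<lambda>n. R n \<gamma>", OF _ _ _ _ _ _ VR _ G agree f])
      show "R0 \<in> vector_fields A" using VR[of 0 \<gamma>] by (simp add: R_0)
      fix \<theta> and n :: nat and m
      show "e \<gamma> \<theta> 0 f m = f (\<Phi> \<theta> m)" if "f \<in> smooth_functions A" for f
        by (simp add: e_def E_0[OF T[OF that]] pull_tensor_def function_tensor_def)
      show "e \<gamma> 0 n f m = (if n = 0 then f m else 0)" if "f \<in> smooth_functions A" for f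
        by (simp add: e_def E_init[OF T[OF that]] function_tensor_def)
      show "e \<gamma> (2 * pi) n f m = (if n = 0 then f m else 0)" if "f \<in> smooth_functions A" for f
        by (simp add: e_def E_end[OF T[OF that]] function_tensor_def)
      show "((\<lambda>\<theta>. e \<gamma> \<theta> n f m) has_real_derivative (\<Sum>k\<le>n. e \<gamma> \<theta> k (R (n - k) \<gamma> f) m)) (at \<theta>)"
        if "f \<in> smooth_functions A" for f
        using E_deriv[OF T[OF that], of n \<gamma> "[]" "[]" m \<theta>] by (simp add: e_def lie_function_tensor[OF VR])
      show "smooth_on UNIV (\<lambda>z :: real \<times> real. e \<gamma> (fst z) n (u (snd z)) m)" if u: "smooth_family A u" for u
      proof -
        have RR: "smooth_manifold (std_atlas :: (real \<times> real, real \<times> real) chart set)"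
          by (rule smooth_manifold_std_atlas)
        have proj: "smooth_map std_atlas std_R (fst :: real \<times> real \<Rightarrow> real)"
          "smooth_map std_atlas std_R (snd :: real \<times> real \<Rightarrow> real)"
          by (simp_all add: smooth_map_std_std_iff smooth_on_fst smooth_on_snd)
        \<comment> \<open>The point m is held fixed, which leaves a smooth function of the flow time
          and the family parameter, ready to be differentiated along the diagonal.\<close>
        have "smooth_map std_atlas (prod_atlas std_R (prod_atlas std_R A)) (\<lambda>z :: real \<times> real. (fst z, snd z, m))"
          by (intro smooth_map_Pair RR std_R A RA proj smooth_map_const)
        from smooth_map_compose[OF RR RRA std_R this e_smooth3[OF u]]
        show ?thesis by (simp add: smooth_map_std_std_iff)
      qed
      show "smooth_operator (e \<gamma> \<theta> n)"
        unfolding smooth_operator_def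
      proof (intro conjI ballI allI impI)
        fix f g a b m assume f: "f \<in> smooth_functions A" and g: "g \<in> smooth_functions A"
        have "function_tensor (\<lambda>x. a * f x + b * g x) =
            (\<lambda>\<alpha>s Xs m. a * function_tensor f \<alpha>s Xs m + b * function_tensor g \<alpha>s Xs m)"
          by (intro ext) (simp add: function_tensor_def)
        then show "e \<gamma> \<theta> n (\<lambda>x. a * f x + b * g x) m = a * e \<gamma> \<theta> n f m + b * e \<gamma> \<theta> n g m"
          using E_op[of \<theta> n \<gamma>] T[OF f] T[OF g] by (simp add: e_def tensor_operators_def)
      next
        fix u assume u: "smooth_family A u"
        have "smooth_map (prod_atlas std_R A) (prod_atlas std_R (prod_atlas std_R A)) (\<lambda>z. (\<theta>, z))"
          by (intro smooth_map_Pair smooth_map_const smooth_map_id RA std_R)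
        from smooth_map_compose[OF RA RRA std_R this e_smooth3[OF u]]
        show "smooth_family A (\<lambda>t. e \<gamma> \<theta> n (u t))"
          by (simp add: smooth_family_def case_prod_unfold)
      qed
    qed
  qed
qed

end
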